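(* Let $f:\mathbb R\to\mathbb R$ be Lipschitz with $\zeta_0(f)=\mathbb E[f(\mathcal N)]=0$. For each $n$ let $u\in\mathbb R^n$ be a centered Gaussian vector with covariance matrix $S\in\mathbb R^{n\times n}$, let $y=f(u)$ (with $f$ applied entrywise), $\Sigma=\mathbb E[yy^\top]$, $\Delta=S-I_n$, and $\Sigma_{\mathrm{lin}}=\|f\|_{\mathcal H}^2I_n+\zeta_1(f)^2\Delta$. Assume that, as $n\to\infty$, $|||\Delta|||$ and $\|\vec{\mathrm{diag}}(\Delta)\|$ are bounded and $\|\Delta\|_{\max}$ converges to $0$. Then $|||\Sigma-\Sigma_{\mathrm{lin}}|||$ is bounded, and with $\epsilon_n=\zeta_2(f)^2\|\Delta\|_{\max}^2+\zeta_3(f)^2\|\Delta\|_{\max}^3$: $$\|\Sigma-\Sigma_{\mathrm{lin}}\|_{\max}\le O(\|\Delta\|_{\max}),$$ $$|||\Sigma-\Sigma_{\mathrm{lin}}|||\le O(\|\Delta\|_{\max}+n\epsilon_n),$$ $$|g_\Sigma(z)-g_{\Sigma_{\mathrm{lin}}}(z)|\le\frac1{\Im(z)^2}\,O(\|\Delta\|_{\max}+\sqrt n\,\epsilon_n)\qquad(z\in\mathbb C^+),$$ the implicit constants not depending on $z$.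
   Context: $\|\cdot\|$ is the Euclidean norm, $|||\cdot|||$ the spectral norm, $\|\cdot\|_{\max}$ the entrywise maximum norm. $\vec{\mathrm{diag}}(\Delta)\in\mathbb R^n$ is the vector of diagonal entries. $\mathcal N$ is a standard Gaussian variable; $\|f\|_{\mathcal H}^2=\mathbb E[f(\mathcal N)^2]$; $\zeta_r(f)=\mathbb E[f(\mathcal N)h_r(\mathcal N)]/\sqrt{r!}$ with the Hermite polynomials $h_r(t)=(-1)^re^{t^2/2}\frac{d^r}{dt^r}e^{-t^2/2}$. For a symmetric $M\in\mathbb R^{n\times n}$ and $z\in\mathbb C^+=\{\Im z>0\}$, $g_M(z)=\frac1n\mathrm{Tr}(M-zI_n)^{-1}$. *)

theory Defs
  imports
    "HOL-Probability.Probability"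
    "HOL-Library.Landau_Symbols"
    "Jordan_Normal_Form.Gauss_Jordan_Elimination"
begin

unbundle no vec_syntax
unbundle no inner_syntax

text \<open>All dimensions vary with \<open>n\<close>, so vectors and matrices are the size-carrying types
  \<open>vec\<close> and \<open>mat\<close> of the Jordan normal form library.\<close>

definition euclid_norm :: "real vec \<Rightarrow> real" where
  "euclid_norm v = sqrt (\<Sum>i<dim_vec v. (v $ i)\<^sup>2)"

definition spectral_norm :: "real mat \<Rightarrow> real" where
  "spectral_norm A =
     (SUP v \<in> {v \<in> carrier_vec (dim_col A). euclid_norm v \<le> 1}. euclid_norm (A *\<^sub>v v))"

text \<open>Unspecified on matrices without entries.\<close>

definition max_norm :: "real mat \<Rightarrow> real" where
  "max_norm A = Max (abs ` elements_mat A)"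

definition diag_vec :: "'a mat \<Rightarrow> 'a vec" where
  "diag_vec A = vec (dim_row A) (\<lambda>i. A $$ (i, i))"

definition mat_trace :: "'a :: comm_monoid_add mat \<Rightarrow> 'a" where
  "mat_trace A = (\<Sum>i<dim_row A. A $$ (i, i))"

text \<open>For symmetric real \<open>M\<close> and \<open>Im z > 0\<close> the matrix \<open>M - z I\<close> is invertible, so
  \<^const>\<open>mat_inverse\<close> does not return \<^const>\<open>None\<close> there.\<close>

definition stieltjes :: "real mat \<Rightarrow> complex \<Rightarrow> complex" where
  "stieltjes M z =
     mat_trace (the (mat_inverse (map_mat complex_of_real M - z \<cdot>\<^sub>m 1\<^sub>m (dim_row M))))
       / of_nat (dim_row M)"

definition std_gaussian :: "real measure" where
  "std_gaussian = density lborel (\<lambda>x. ennreal (std_normal_density x))"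

definition hermite :: "nat \<Rightarrow> real \<Rightarrow> real" where
  "hermite r t = (-1) ^ r * exp (t\<^sup>2 / 2) * (deriv ^^ r) (\<lambda>s. exp (- s\<^sup>2 / 2)) t"

definition gauss_norm :: "(real \<Rightarrow> real) \<Rightarrow> real" where
  "gauss_norm f = sqrt (\<integral>x. (f x)\<^sup>2 \<partial>std_gaussian)"

definition hermite_coeff :: "nat \<Rightarrow> (real \<Rightarrow> real) \<Rightarrow> real" where
  "hermite_coeff r f = (\<integral>x. f x * hermite r x \<partial>std_gaussian) / sqrt (fact r)"

text \<open>The law may be a point mass, so that singular covariance matrices are allowed.\<close>

definition gaussian_rv :: "'a measure \<Rightarrow> ('a \<Rightarrow> real) \<Rightarrow> bool" where
  "gaussian_rv M X \<longleftrightarrow>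
     X \<in> borel_measurable M \<and>
     (\<exists>\<mu>. (AE \<omega> in M. X \<omega> = \<mu>) \<or>
          (\<exists>\<sigma>>0. distributed M lborel X (\<lambda>x. ennreal (normal_density \<mu> \<sigma> x))))"

definition gaussian_vector :: "'a measure \<Rightarrow> nat \<Rightarrow> ('a \<Rightarrow> real vec) \<Rightarrow> bool" where
  "gaussian_vector M n u \<longleftrightarrow>
     prob_space M \<and> (\<forall>\<omega>\<in>space M. u \<omega> \<in> carrier_vec n) \<and>
     (\<forall>a\<in>carrier_vec n. gaussian_rv M (\<lambda>\<omega>. a \<bullet> u \<omega>))"

definition mean_vec :: "'a measure \<Rightarrow> nat \<Rightarrow> ('a \<Rightarrow> real vec) \<Rightarrow> real vec" where
  "mean_vec M n u = vec n (\<lambda>i. \<integral>\<omega>. u \<omega> $ i \<partial>M)"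

definition second_moment_mat :: "'a measure \<Rightarrow> nat \<Rightarrow> ('a \<Rightarrow> real vec) \<Rightarrow> real mat" where
  "second_moment_mat M n y = mat n n (\<lambda>(i, j). \<integral>\<omega>. y \<omega> $ i * y \<omega> $ j \<partial>M)"

definition covariance_mat :: "'a measure \<Rightarrow> nat \<Rightarrow> ('a \<Rightarrow> real vec) \<Rightarrow> real mat" where
  "covariance_mat M n u = second_moment_mat M n (\<lambda>\<omega>. u \<omega> - mean_vec M n u)"

end

theory Submission
  imports Defs "Jordan_Normal_Form.Determinant"
begin

text \<open>Let \<open>s\<^sub>i\<^sup>2 = S\<^sub>i\<^sub>i\<close>. A pair \<open>(u\<^sub>i, u\<^sub>j)\<close> is \<open>(s\<^sub>i X, s\<^sub>j Y)\<close> with standard normal \<open>X\<close>, \<open>Y\<close> of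
  correlation \<open>\<rho>\<close>, and a Taylor expansion of the density of \<open>(X, Y)\<close> with respect to the product
  Gaussian measure gives the off-diagonal entries of \<open>\<Sigma>\<close> up to \<open>O(\<bar>\<rho>\<bar>\<^sup>3)\<close>. The resulting error matrix
  splits into three parts. The means of \<open>f(u\<^sub>i)\<close> contribute a rank-one matrix
  \<open>\<alpha> \<alpha>\<^sup>T\<close> with \<open>\<alpha>\<^sub>i = O(\<bar>\<zeta>\<^sub>2 \<Delta>\<^sub>i\<^sub>i\<bar> + \<Delta>\<^sub>i\<^sub>i\<^sup>2)\<close>. The slopes contribute \<open>(w\<^sub>i w\<^sub>j - \<zeta>\<^sub>1\<^sup>2) \<Delta>\<^sub>i\<^sub>j\<close>, a
  diagonal perturbation of a multiple of \<open>\<Delta>\<close>. The rest is entrywise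
  \<open>O((\<zeta>\<^sub>2\<^sup>2 + max \<bar>\<Delta>\<bar>) \<Delta>\<^sub>i\<^sub>j\<^sup>2)\<close> off the diagonal; since the rows of \<open>\<Delta>\<close> are bounded in \<open>\<ell>\<^sup>2\<close>, the Schur
  test bounds its spectral norm. The Stieltjes transforms are compared through the Frobenius norm of
  the error, using \<open>R - T = R (B - A) T\<close> for the resolvents \<open>R\<close>, \<open>T\<close> of \<open>A\<close>, \<open>B\<close>.\<close>

section \<open>Spectral and Frobenius norms\<close>

text \<open>Since \<open>f\<close> is only Lipschitz, its dependence on variance and correlation
  cannot be read off by differentiating \<open>f\<close>. Both parameters are therefore moved into
  likelihood ratios against the standard Gaussian, which are smooth and whose Taylor coefficients
  are Hermite polynomials. One bookkeeping of growth rates runs through all integrals: Lipschitz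
  functions and Hermite polynomials grow at most like exp(x^2/16), expansion remainders like
  exp(x^2/8), and every product stays below exp(x^2/4), whose Gaussian integral is sqrt 2. The
  thresholds 1/32 for entries of \<Delta> and 1/16 for correlations keep the exponents within these
  rates. A cubic remainder is harmless in every dimension: one factor is given up for the maximum
  norm, and the remaining square sums over a row to O(1). The quadratic term has no factor to spare,
  so smallness can only come from counting n entries; this is how n times the square of \<zeta>_2
  arises. On the diagonal the correlation is one and no expansion around independence is available,
  but a diagonal matrix costs only its largest entry, so Lipschitz dependence on the variance is
  enough there.\<close>

definition op_bounded :: "nat \<Rightarrow> (nat \<Rightarrow> nat \<Rightarrow> real) \<Rightarrow> real \<Rightarrow> bool" where
  "op_bounded n E K \<longleftrightarrow>
     (\<forall>v. L2_set (\<lambda>i. \<Sum>j<n. E i j * v j) {..<n} \<le> K * L2_set v {..<n})"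

text \<open>Matrices are handled as functions of two indices below \<open>n\<close>, so that the
  pieces of the error can be written pointwise and added without carrier conditions. The norm is an
  \<open>L2_set\<close> over pairs, which makes Minkowski and Cauchy-Schwarz available as they
  stand.\<close>

definition frobenius :: "nat \<Rightarrow> (nat \<Rightarrow> nat \<Rightarrow> real) \<Rightarrow> real" where
  "frobenius n E = L2_set (\<lambda>(i, j). E i j) ({..<n} \<times> {..<n})"

lemma euclid_norm_L2_set: "euclid_norm v = L2_set (($) v) {..<dim_vec v}"
  by (simp add: euclid_norm_def L2_set_def)

lemma frobenius_nonneg: "0 \<le> frobenius n E"
  by (simp add: frobenius_def)

lemma frobenius_power2: "(frobenius n E)\<^sup>2 = (\<Sum>i<n. \<Sum>j<n. (E i j)\<^sup>2)"
  by (simp add: frobenius_def L2_set_def sum_nonneg sum.cartesian_product split_def)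

lemma L2_set_power2: "(L2_set f A)\<^sup>2 = (\<Sum>i\<in>A. (f i)\<^sup>2)"
  by (simp add: L2_set_def sum_nonneg)

lemma sum_mult_le_L2_set: "\<bar>\<Sum>i\<in>A. f i * g i\<bar> \<le> L2_set f A * L2_set g A"
proof -
  have "\<bar>\<Sum>i\<in>A. f i * g i\<bar> \<le> (\<Sum>i\<in>A. \<bar>f i\<bar> * \<bar>g i\<bar>)"
    using sum_abs[of "\<lambda>i. f i * g i" A] by (simp add: abs_mult)
  also have "\<dots> \<le> L2_set f A * L2_set g A" by (rule L2_set_mult_ineq)
  finally show ?thesis .
qed

lemma frobenius_triangle:
  "frobenius n (\<lambda>i j. E i j + F i j) \<le> frobenius n E + frobenius n F"
  using L2_set_triangle_ineq[of "\<lambda>(i, j). E i j" "\<lambda>(i, j). F i j" "{..<n} \<times> {..<n}"]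
  by (simp add: frobenius_def split_def)

lemma frobenius_mono:
  assumes "\<And>i j. i < n \<Longrightarrow> j < n \<Longrightarrow> \<bar>E i j\<bar> \<le> F i j"
  shows "frobenius n E \<le> frobenius n F"
proof -
  have "(E i j)\<^sup>2 \<le> (F i j)\<^sup>2" if "i < n" "j < n" for i j
    using assms[OF that] by (simp add: abs_le_square_iff[symmetric] abs_le_iff)
  then show ?thesis
    unfolding frobenius_def L2_set_def by (intro real_sqrt_le_mono sum_mono) auto
qed

lemma frobenius_scale: "0 \<le> c \<Longrightarrow> frobenius n (\<lambda>i j. c * E i j) = c * frobenius n E"
  by (simp add: frobenius_def L2_set_right_distrib split_def)

lemma frobenius_rank_one:
  "frobenius n (\<lambda>i j. a i * b j) = L2_set a {..<n} * L2_set b {..<n}"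
proof -
  have "(frobenius n (\<lambda>i j. a i * b j))\<^sup>2 = (L2_set a {..<n} * L2_set b {..<n})\<^sup>2"
    unfolding frobenius_power2 power_mult_distrib L2_set_power2
    by (simp add: sum_product)
  then show ?thesis
    using frobenius_nonneg[of n] by (simp add: power2_eq_iff_nonneg)
qed

lemma frobenius_const: "frobenius n (\<lambda>i j. c) = real n * \<bar>c\<bar>"
  by (simp add: frobenius_def split_def L2_set_constant)

lemma frobenius_diag: "frobenius n (\<lambda>i j. if i = j then c else 0) = sqrt (real n) * \<bar>c\<bar>"
proof -
  have "(\<Sum>j<n. (if i = j then c else 0)\<^sup>2) = c\<^sup>2" if "i < n" for i
  proof -
    have "(\<Sum>j<n. (if i = j then c else 0)\<^sup>2) = (\<Sum>j<n. if i = j then c\<^sup>2 else 0)"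
      by (intro sum.cong) auto
    also have "\<dots> = c\<^sup>2" using that by (simp add: sum.delta')
    finally show ?thesis .
  qed
  then have "(frobenius n (\<lambda>i j. if i = j then c else 0))\<^sup>2 = (sqrt (real n) * \<bar>c\<bar>)\<^sup>2"
    unfolding frobenius_power2 by (simp add: power_mult_distrib)
  then show ?thesis using frobenius_nonneg[of n] by (simp add: power2_eq_iff_nonneg)
qed

text \<open>Cauchy-Schwarz in each row. Besides being an estimate, it shows that the supremum in
  \<open>spectral_norm\<close> is taken over a bounded set, and it is sharp for rank-one
  arrays.\<close>

lemma op_bounded_frobenius: "op_bounded n E (frobenius n E)"
  unfolding op_bounded_def
proof
  fix v :: "nat \<Rightarrow> real"
  have "(L2_set (\<lambda>i. \<Sum>j<n. E i j * v j) {..<n})\<^sup>2 = (\<Sum>i<n. (\<Sum>j<n. E i j * v j)\<^sup>2)"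
    by (rule L2_set_power2)
  also have "\<dots> \<le> (\<Sum>i<n. (\<Sum>j<n. (E i j)\<^sup>2) * (L2_set v {..<n})\<^sup>2)"
  proof (rule sum_mono)
    fix i assume "i \<in> {..<n}"
    have "(\<Sum>j<n. E i j * v j)\<^sup>2 \<le> (L2_set (E i) {..<n} * L2_set v {..<n})\<^sup>2"
      using power_mono[OF sum_mult_le_L2_set[of "E i" v "{..<n}"] abs_ge_zero, of 2] by simp
    then show "(\<Sum>j<n. E i j * v j)\<^sup>2 \<le> (\<Sum>j<n. (E i j)\<^sup>2) * (L2_set v {..<n})\<^sup>2"
      by (simp add: power_mult_distrib L2_set_power2)
  qed
  also have "\<dots> = (frobenius n E * L2_set v {..<n})\<^sup>2"
    by (simp add: frobenius_power2 power_mult_distrib sum_distrib_right)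
  finally show "L2_set (\<lambda>i. \<Sum>j<n. E i j * v j) {..<n} \<le> frobenius n E * L2_set v {..<n}"
    by (rule power2_le_imp_le) (simp add: frobenius_nonneg)
qed

lemma op_bounded_mono: "op_bounded n E K \<Longrightarrow> K \<le> K' \<Longrightarrow> op_bounded n E K'"
  unfolding op_bounded_def by (meson L2_set_nonneg mult_right_mono order_trans)

lemma op_bounded_add:
  assumes "op_bounded n E K" "op_bounded n F L"
  shows "op_bounded n (\<lambda>i j. E i j + F i j) (K + L)"
  unfolding op_bounded_def
proof
  fix v :: "nat \<Rightarrow> real"
  have "L2_set (\<lambda>i. \<Sum>j<n. (E i j + F i j) * v j) {..<n}
      \<le> L2_set (\<lambda>i. \<Sum>j<n. E i j * v j) {..<n} + L2_set (\<lambda>i. \<Sum>j<n. F i j * v j) {..<n}"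
    using L2_set_triangle_ineq[of "\<lambda>i. \<Sum>j<n. E i j * v j" "\<lambda>i. \<Sum>j<n. F i j * v j" "{..<n}"]
    by (simp add: sum.distrib distrib_right)
  also have "\<dots> \<le> K * L2_set v {..<n} + L * L2_set v {..<n}"
    using assms by (intro add_mono) (auto simp: op_bounded_def)
  finally show "L2_set (\<lambda>i. \<Sum>j<n. (E i j + F i j) * v j) {..<n} \<le> (K + L) * L2_set v {..<n}"
    by (simp add: distrib_right)
qed

lemma op_bounded_cong:
  assumes "\<And>i j. i < n \<Longrightarrow> j < n \<Longrightarrow> E i j = F i j"
  shows "op_bounded n E K = op_bounded n F K"
proof -
  have "L2_set (\<lambda>i. \<Sum>j<n. E i j * v j) {..<n} = L2_set (\<lambda>i. \<Sum>j<n. F i j * v j) {..<n}" for v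
    by (intro L2_set_cong) (simp_all add: assms)
  then show ?thesis by (simp add: op_bounded_def)
qed

lemma L2_set_mult_le:
  assumes "\<And>i. i \<in> A \<Longrightarrow> \<bar>a i\<bar> \<le> c" "0 \<le> c"
  shows "L2_set (\<lambda>i. a i * x i) A \<le> c * L2_set x A"
proof -
  have "L2_set (\<lambda>i. a i * x i) A \<le> L2_set (\<lambda>i. c * x i) A"
    unfolding L2_set_def
  proof (intro real_sqrt_le_mono sum_mono)
    fix i assume "i \<in> A"
    then have "\<bar>a i * x i\<bar> \<le> \<bar>c * x i\<bar>"
      using assms by (simp add: abs_mult mult_right_mono)
    then show "(a i * x i)\<^sup>2 \<le> (c * x i)\<^sup>2" by (rule abs_le_square_iff[THEN iffD1])
  qed
  then show ?thesis using assms(2) by (simp add: L2_set_right_distrib)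
qed

text \<open>The array is diag(a) E diag(b), and each diagonal factor costs only its largest entry.
  No factor depending on the dimension appears.\<close>

lemma op_bounded_diag_mult:
  assumes E: "op_bounded n E K" and K: "0 \<le> K"
    and a: "\<And>i. i < n \<Longrightarrow> \<bar>a i\<bar> \<le> \<alpha>" "0 \<le> \<alpha>" and b: "\<And>i. i < n \<Longrightarrow> \<bar>b i\<bar> \<le> \<beta>" "0 \<le> \<beta>"
  shows "op_bounded n (\<lambda>i j. a i * E i j * b j) (\<alpha> * \<beta> * K)"
  unfolding op_bounded_def
proof
  fix v :: "nat \<Rightarrow> real"
  have "L2_set (\<lambda>i. \<Sum>j<n. a i * E i j * b j * v j) {..<n}
      = L2_set (\<lambda>i. a i * (\<Sum>j<n. E i j * (b j * v j))) {..<n}"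
    by (simp add: sum_distrib_left mult_ac)
  also have "\<dots> \<le> \<alpha> * L2_set (\<lambda>i. \<Sum>j<n. E i j * (b j * v j)) {..<n}"
    using a by (intro L2_set_mult_le) auto
  also have "\<dots> \<le> \<alpha> * (K * L2_set (\<lambda>j. b j * v j) {..<n})"
    using E a by (intro mult_left_mono) (auto simp: op_bounded_def)
  also have "\<dots> \<le> \<alpha> * (K * (\<beta> * L2_set v {..<n}))"
    using a b K by (intro mult_left_mono L2_set_mult_le) auto
  finally show "L2_set (\<lambda>i. \<Sum>j<n. a i * E i j * b j * v j) {..<n} \<le> \<alpha> * \<beta> * K * L2_set v {..<n}"
    by (simp add: mult_ac)
qed

text \<open>Schur test. Cauchy-Schwarz with the weight \<open>F i j\<close> split into two square
  roots leaves one row sum of \<open>F\<close>; interchanging the sums produces a column sum, which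
  symmetry turns into a row sum again.\<close>

lemma op_bounded_schur:
  assumes le: "\<And>i j. i < n \<Longrightarrow> j < n \<Longrightarrow> \<bar>E i j\<bar> \<le> F i j"
    and sym: "\<And>i j. i < n \<Longrightarrow> j < n \<Longrightarrow> F i j = F j i"
    and row: "\<And>i. i < n \<Longrightarrow> (\<Sum>j<n. F i j) \<le> K" and K: "0 \<le> K"
  shows "op_bounded n E K"
  unfolding op_bounded_def
proof
  fix v :: "nat \<Rightarrow> real"
  have F0: "0 \<le> F i j" if "i < n" "j < n" for i j using le[OF that] by linarith
  have "(L2_set (\<lambda>i. \<Sum>j<n. E i j * v j) {..<n})\<^sup>2 = (\<Sum>i<n. (\<Sum>j<n. E i j * v j)\<^sup>2)"
    by (rule L2_set_power2)
  also have "\<dots> \<le> (\<Sum>i<n. K * (\<Sum>j<n. F i j * (v j)\<^sup>2))"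
  proof (rule sum_mono)
    fix i assume i: "i \<in> {..<n}"
    have "\<bar>\<Sum>j<n. E i j * v j\<bar> \<le> (\<Sum>j<n. \<bar>E i j * v j\<bar>)" by (rule sum_abs)
    also have "\<dots> \<le> (\<Sum>j<n. F i j * \<bar>v j\<bar>)"
      using i by (intro sum_mono) (simp add: abs_mult mult_right_mono le)
    also have "\<dots> = (\<Sum>j<n. sqrt (F i j) * (sqrt (F i j) * \<bar>v j\<bar>))"
      using i F0 by (intro sum.cong) (simp_all add: mult.assoc[symmetric])
    also have "\<dots> \<le> L2_set (\<lambda>j. sqrt (F i j)) {..<n} * L2_set (\<lambda>j. sqrt (F i j) * \<bar>v j\<bar>) {..<n}"
      by (rule abs_le_D1[OF sum_mult_le_L2_set])
    finally have "\<bar>\<Sum>j<n. E i j * v j\<bar>\<^sup>2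
        \<le> (L2_set (\<lambda>j. sqrt (F i j)) {..<n} * L2_set (\<lambda>j. sqrt (F i j) * \<bar>v j\<bar>) {..<n})\<^sup>2"
      by (intro power_mono abs_ge_zero)
    also have "\<dots> = (\<Sum>j<n. F i j) * (\<Sum>j<n. F i j * (v j)\<^sup>2)"
      using i F0 by (simp add: power_mult_distrib L2_set_power2)
    also have "\<dots> \<le> K * (\<Sum>j<n. F i j * (v j)\<^sup>2)"
      using i row F0 by (intro mult_right_mono sum_nonneg) auto
    finally show "(\<Sum>j<n. E i j * v j)\<^sup>2 \<le> K * (\<Sum>j<n. F i j * (v j)\<^sup>2)" by simp
  qed
  also have "\<dots> = K * (\<Sum>j<n. \<Sum>i<n. F i j * (v j)\<^sup>2)"
    unfolding sum_distrib_left[symmetric] by (subst sum.swap) simp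
  also have "\<dots> = K * (\<Sum>j<n. (\<Sum>i<n. F j i) * (v j)\<^sup>2)"
    by (simp add: sum_distrib_right sym)
  also have "\<dots> \<le> K * (\<Sum>j<n. K * (v j)\<^sup>2)"
    using K row by (intro mult_left_mono sum_mono mult_right_mono) auto
  also have "\<dots> = (K * L2_set v {..<n})\<^sup>2"
    unfolding power_mult_distrib L2_set_power2
    by (simp add: sum_distrib_left power2_eq_square mult.assoc)
  finally show "L2_set (\<lambda>i. \<Sum>j<n. E i j * v j) {..<n} \<le> K * L2_set v {..<n}"
    by (rule power2_le_imp_le) (simp add: K)
qed

text \<open>Apply the operator bound to the j-th unit vector.\<close>

lemma op_bounded_column:
  assumes E: "op_bounded n E K" and j: "j < n"
  shows "(\<Sum>i<n. (E i j)\<^sup>2) \<le> K\<^sup>2"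
proof -
  let ?e = "\<lambda>k. if k = j then 1 else 0 :: real"
  have a: "(\<Sum>k<n. E i k * ?e k) = E i j" for i
  proof -
    have "(\<Sum>k<n. E i k * ?e k) = (\<Sum>k<n. if k = j then E i k else 0)"
      by (intro sum.cong) auto
    then show ?thesis using j by simp
  qed
  have b: "L2_set ?e {..<n} = 1"
  proof -
    have "(\<Sum>k<n. (?e k)\<^sup>2) = (\<Sum>k<n. if k = j then 1 else 0)" by (intro sum.cong) auto
    then show ?thesis using j by (simp add: L2_set_def)
  qed
  have "L2_set (\<lambda>i. E i j) {..<n} \<le> K"
    using E[unfolded op_bounded_def, rule_format, of ?e] unfolding a b by simp
  then have "(L2_set (\<lambda>i. E i j) {..<n})\<^sup>2 \<le> K\<^sup>2" by (intro power_mono) auto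
  then show ?thesis by (simp add: L2_set_power2)
qed

text \<open>Each of the n columns has length at most \<open>K\<close>. The loss of sqrt n is exactly
  what the normalisation in \<open>stieltjes_diff_le\<close> gives back.\<close>

lemma frobenius_le_op_bounded:
  assumes E: "op_bounded n E K" and K: "0 \<le> K"
  shows "frobenius n E \<le> sqrt (real n) * K"
proof -
  have "(frobenius n E)\<^sup>2 = (\<Sum>j<n. \<Sum>i<n. (E i j)\<^sup>2)"
    unfolding frobenius_power2 by (rule sum.swap)
  also have "\<dots> \<le> (\<Sum>j<n. K\<^sup>2)"
    using op_bounded_column[OF E] by (intro sum_mono) auto
  also have "\<dots> = (sqrt (real n) * K)\<^sup>2" by (simp add: power_mult_distrib)
  finally show ?thesis by (rule power2_le_imp_le) (simp add: K)
qed

section \<open>From index functions back to matrices\<close>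

lemma euclid_norm_mult_mat_vec:
  assumes "A \<in> carrier_mat n n" "v \<in> carrier_vec n"
  shows "euclid_norm (A *\<^sub>v v) = L2_set (\<lambda>i. \<Sum>j<n. A $$ (i, j) * v $ j) {..<n}"
  using assms unfolding euclid_norm_L2_set
  by (intro L2_set_cong) (auto simp: scalar_prod_def atLeast0LessThan)

lemma spectral_norm_le:
  assumes A: "A \<in> carrier_mat n n" and K: "op_bounded n (\<lambda>i j. A $$ (i, j)) K" "0 \<le> K"
  shows "spectral_norm A \<le> K"
  unfolding spectral_norm_def
proof (rule cSUP_least)
  have "0\<^sub>v n \<in> {v \<in> carrier_vec (dim_col A). euclid_norm v \<le> 1}"
    using A by (auto simp: euclid_norm_def)
  then show "{v \<in> carrier_vec (dim_col A). euclid_norm v \<le> 1} \<noteq> {}" by blast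
next
  fix v assume "v \<in> {v \<in> carrier_vec (dim_col A). euclid_norm v \<le> 1}"
  then have v: "v \<in> carrier_vec n" and v1: "L2_set (($) v) {..<n} \<le> 1"
    using A by (auto simp: euclid_norm_L2_set)
  have "euclid_norm (A *\<^sub>v v) \<le> K * L2_set (($) v) {..<n}"
    unfolding euclid_norm_mult_mat_vec[OF A v] using K(1) by (simp add: op_bounded_def)
  also have "\<dots> \<le> K * 1" using v1 K by (intro mult_left_mono)
  finally show "euclid_norm (A *\<^sub>v v) \<le> K" by simp
qed

text \<open>A real \<open>SUP\<close> carries information only once its set is known to be bounded
  above; the Frobenius norm provides that bound. Homogeneity then extends the estimate from the unit
  ball to all vectors.\<close>

lemma
  assumes A: "A \<in> carrier_mat n n"
  shows spectral_norm_nonneg: "0 \<le> spectral_norm A"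
    and op_bounded_spectral_norm: "op_bounded n (\<lambda>i j. A $$ (i, j)) (spectral_norm A)"
proof -
  let ?B = "{v \<in> carrier_vec (dim_col A). euclid_norm v \<le> 1}"
  let ?E = "\<lambda>i j. A $$ (i, j)"
  have le: "euclid_norm (A *\<^sub>v v) \<le> spectral_norm A" if "v \<in> ?B" for v
    unfolding spectral_norm_def
  proof (rule cSUP_upper[OF that])
    show "bdd_above ((\<lambda>v. euclid_norm (A *\<^sub>v v)) ` ?B)"
    proof (rule bdd_aboveI2)
      fix v assume "v \<in> ?B"
      then have v: "v \<in> carrier_vec n" and v1: "L2_set (($) v) {..<n} \<le> 1"
        using A by (auto simp: euclid_norm_L2_set)
      have "euclid_norm (A *\<^sub>v v) \<le> frobenius n ?E * L2_set (($) v) {..<n}"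
        unfolding euclid_norm_mult_mat_vec[OF A v]
        using op_bounded_frobenius[of n ?E] by (simp add: op_bounded_def)
      also have "\<dots> \<le> frobenius n ?E * 1"
        using v1 by (intro mult_left_mono frobenius_nonneg)
      finally show "euclid_norm (A *\<^sub>v v) \<le> frobenius n ?E" by simp
    qed
  qed
  have "0\<^sub>v n \<in> ?B" using A by (auto simp: euclid_norm_def)
  from le[OF this] show "0 \<le> spectral_norm A"
    by (rule order_trans[rotated]) (simp add: euclid_norm_L2_set)
  show "op_bounded n ?E (spectral_norm A)"
    unfolding op_bounded_def
  proof
    fix v :: "nat \<Rightarrow> real"
    define r where "r = L2_set v {..<n}"
    show "L2_set (\<lambda>i. \<Sum>j<n. ?E i j * v j) {..<n} \<le> spectral_norm A * L2_set v {..<n}"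
    proof (cases "r = 0")
      case True
      then have "v i = 0" if "i < n" for i
        using that by (simp add: r_def L2_set_eq_0_iff)
      then show ?thesis using True by (simp add: r_def L2_set_0')
    next
      case False
      then have r: "0 < r" by (simp add: r_def order_less_le)
      let ?w = "vec n (\<lambda>i. v i / r)"
      have "L2_set (($) ?w) {..<n} = L2_set (\<lambda>i. (1 / r) * v i) {..<n}"
        by (intro L2_set_cong) auto
      also have "\<dots> = 1"
        using r by (subst L2_set_right_distrib[symmetric]) (auto simp: r_def)
      finally have "?w \<in> ?B" using A by (auto simp: euclid_norm_L2_set)
      from le[OF this] have "L2_set (\<lambda>i. \<Sum>j<n. ?E i j * ?w $ j) {..<n} \<le> spectral_norm A"
        using A by (subst (asm) euclid_norm_mult_mat_vec) auto
      also have "L2_set (\<lambda>i. \<Sum>j<n. ?E i j * ?w $ j) {..<n}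
          = L2_set (\<lambda>i. (1 / r) * (\<Sum>j<n. ?E i j * v j)) {..<n}"
        by (intro L2_set_cong) (auto simp: sum_distrib_left intro!: sum.cong)
      also have "\<dots> = (1 / r) * L2_set (\<lambda>i. \<Sum>j<n. ?E i j * v j) {..<n}"
        using r by (subst L2_set_right_distrib) auto
      finally show ?thesis using r by (simp add: r_def field_simps)
    qed
  qed
qed

lemma elements_mat_nth: "A \<in> carrier_mat n n \<Longrightarrow> elements_mat A = (\<lambda>(i, j). A $$ (i, j)) ` ({..<n} \<times> {..<n})"
  unfolding elements_mat_def by (force simp: image_iff atLeast0LessThan)

lemma abs_le_max_norm:
  assumes "A \<in> carrier_mat n n" "i < n" "j < n"
  shows "\<bar>A $$ (i, j)\<bar> \<le> max_norm A"
  unfolding max_norm_def elements_mat_nth[OF assms(1)] using assms(2,3)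
  by (intro Max_ge) (auto simp: image_image intro!: image_eqI[of _ _ "(i, j)"])

text \<open>With \<open>0 < n\<close> the maximum ranges over a nonempty finite set; on the empty
  set \<open>Max\<close> has no specified value.\<close>

lemma max_norm_le:
  assumes "A \<in> carrier_mat n n" "0 < n" "\<And>i j. i < n \<Longrightarrow> j < n \<Longrightarrow> \<bar>A $$ (i, j)\<bar> \<le> K"
  shows "max_norm A \<le> K"
  unfolding max_norm_def elements_mat_nth[OF assms(1)] using assms(2,3)
  by (subst Max_le_iff) (auto simp: lessThan_empty_iff)

section \<open>Resolvents of symmetric matrices\<close>

text \<open>The inverse inside \<open>stieltjes\<close>, under its own name. Its use of
  \<open>the\<close> becomes meaningful through \<open>resolvent_carrier\<close> and its companions,
  whose proof excludes \<open>None\<close>.\<close>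

definition resolvent :: "real mat \<Rightarrow> complex \<Rightarrow> complex mat" where
  "resolvent A z = the (mat_inverse (map_mat complex_of_real A - z \<cdot>\<^sub>m 1\<^sub>m (dim_row A)))"

text \<open>For symmetric real A the form <v, A v> is real, so the imaginary part of <v, (A - z) v>
  is minus Im z times the squared length of v; Cauchy-Schwarz finishes. This yields both the
  injectivity of A - z and the norm bound 1/Im z for its inverse.\<close>

lemma shifted_symmetric_bound:
  fixes A :: "nat \<Rightarrow> nat \<Rightarrow> real" and v :: "nat \<Rightarrow> complex"
  assumes sym: "\<And>i j. i < n \<Longrightarrow> j < n \<Longrightarrow> A i j = A j i"
  shows "\<bar>Im z\<bar> * L2_set (\<lambda>i. cmod (v i)) {..<n}
    \<le> L2_set (\<lambda>i. cmod ((\<Sum>j<n. complex_of_real (A i j) * v j) - z * v i)) {..<n}"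
proof -
  define w where "w i = (\<Sum>j<n. complex_of_real (A i j) * v j) - z * v i" for i
  let ?N = "L2_set (\<lambda>i. cmod (v i)) {..<n}"
  define Q where "Q = (\<Sum>i<n. \<Sum>j<n. cnj (v i) * complex_of_real (A i j) * v j)"
  \<comment> \<open>Conjugation swaps the two summation indices, so the quadratic form equals its
    own conjugate.\<close>
  have "cnj Q = (\<Sum>i<n. \<Sum>j<n. cnj (v j) * complex_of_real (A j i) * v i)"
    unfolding Q_def cnj_sum by (intro sum.cong) (auto simp: sym)
  also have "\<dots> = Q" unfolding Q_def by (rule sum.swap)
  finally have Q: "Im Q = 0" by (simp add: complex_eq_iff)
  have "(\<Sum>i<n. cnj (v i) * w i) = Q - z * (\<Sum>i<n. cnj (v i) * v i)"
    by (simp add: w_def Q_def right_diff_distrib sum_subtractf sum_distrib_left mult_ac)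
  also have "(\<Sum>i<n. cnj (v i) * v i) = complex_of_real (?N\<^sup>2)"
    unfolding L2_set_power2 of_real_sum
    by (intro sum.cong refl) (simp add: mult.commute[of "cnj _"] complex_norm_square[symmetric])
  finally have "Im (\<Sum>i<n. cnj (v i) * w i) = - Im z * ?N\<^sup>2" using Q by simp
  then have "\<bar>Im z\<bar> * ?N\<^sup>2 \<le> cmod (\<Sum>i<n. cnj (v i) * w i)"
    using abs_Im_le_cmod[of "\<Sum>i<n. cnj (v i) * w i"] by (simp add: abs_mult)
  also have "\<dots> \<le> (\<Sum>i<n. \<bar>cmod (v i)\<bar> * \<bar>cmod (w i)\<bar>)"
    by (rule order_trans[OF norm_sum]) (simp add: norm_mult)
  also have "\<dots> \<le> ?N * L2_set (\<lambda>i. cmod (w i)) {..<n}" by (rule L2_set_mult_ineq)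
  finally have *: "\<bar>Im z\<bar> * ?N * ?N \<le> L2_set (\<lambda>i. cmod (w i)) {..<n} * ?N"
    by (simp add: power2_eq_square mult_ac)
  show ?thesis
  proof (cases "?N = 0")
    case True
    then show ?thesis by simp
  next
    case False
    then have "0 < ?N" by (simp add: order_less_le)
    with * show ?thesis unfolding w_def by (rule mult_right_le_imp_le)
  qed
qed

lemma mat_mult_entry:
  assumes "A \<in> carrier_mat n n" "B \<in> carrier_mat n n" "i < n" "j < n"
  shows "(A * B) $$ (i, j) = (\<Sum>k<n. A $$ (i, k) * B $$ (k, j))"
  using assms by (auto simp: scalar_prod_def atLeast0LessThan)

context
  fixes A :: "real mat" and n :: nat and z :: complex
  assumes A: "A \<in> carrier_mat n n"
    and sym: "\<And>i j. i < n \<Longrightarrow> j < n \<Longrightarrow> A $$ (i, j) = A $$ (j, i)"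
    and z: "0 < Im z"
begin

text \<open>A vector in the kernel of A - z would have length zero by
  \<open>shifted_symmetric_bound\<close>. Hence the determinant does not vanish and
  \<open>mat_inverse\<close> returns \<open>Some\<close>.\<close>

lemma
  shows resolvent_carrier: "resolvent A z \<in> carrier_mat n n"
    and resolvent_right: "(map_mat complex_of_real A - z \<cdot>\<^sub>m 1\<^sub>m n) * resolvent A z = 1\<^sub>m n"
    and resolvent_left: "resolvent A z * (map_mat complex_of_real A - z \<cdot>\<^sub>m 1\<^sub>m n) = 1\<^sub>m n"
proof -
  define H where "H = map_mat complex_of_real A - z \<cdot>\<^sub>m 1\<^sub>m n"
  have H: "H \<in> carrier_mat n n" using A by (intro carrier_matI) (auto simp: H_def)
  have dim: "dim_row A = n" using A by simp
  have "Determinant.det H \<noteq> 0"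
  proof
    assume "Determinant.det H = 0"
    then obtain v where v: "v \<in> carrier_vec n" "v \<noteq> 0\<^sub>v n" "H *\<^sub>v v = 0\<^sub>v n"
      using det_0_iff_vec_prod_zero[OF H] by auto
    have zero: "(\<Sum>j<n. complex_of_real (A $$ (i, j)) * v $ j) - z * v $ i = 0" if "i < n" for i
    proof -
      have "0 = (H *\<^sub>v v) $ i" using v that by simp
      also have "\<dots> = (\<Sum>j<n. (complex_of_real (A $$ (i, j)) - z * (if i = j then 1 else 0)) * v $ j)"
        using that A v(1) by (simp add: H_def scalar_prod_def atLeast0LessThan)
      also have "\<dots> = (\<Sum>j<n. complex_of_real (A $$ (i, j)) * v $ j)
          - (\<Sum>j<n. if i = j then z * v $ j else 0)"
        unfolding sum_subtractf[symmetric] by (intro sum.cong) (auto simp: left_diff_distrib)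
      also have "(\<Sum>j<n. if i = j then z * v $ j else 0) = z * v $ i" using that by simp
      finally show ?thesis by simp
    qed
    have "\<bar>Im z\<bar> * L2_set (\<lambda>i. cmod (v $ i)) {..<n} \<le> 0"
      using shifted_symmetric_bound[of n "\<lambda>i j. A $$ (i, j)" z "($) v"] sym
      by (simp add: L2_set_0' zero)
    then have "L2_set (\<lambda>i. cmod (v $ i)) {..<n} = 0"
      using z L2_set_nonneg[of "\<lambda>i. cmod (v $ i)" "{..<n}"] by (simp add: mult_le_0_iff)
    then have "v = 0\<^sub>v n" using v(1) by (intro eq_vecI) (auto simp: L2_set_eq_0_iff)
    with v(2) show False ..
  qed
  then have "H \<in> Units (ring_mat TYPE(complex) n ())" by (rule det_non_zero_imp_unit[OF H])
  then obtain B where "mat_inverse H = Some B" using mat_inverse(1)[OF H, where b = "()"] by (cases "mat_inverse H") auto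
  then show "resolvent A z \<in> carrier_mat n n"
    and "(map_mat complex_of_real A - z \<cdot>\<^sub>m 1\<^sub>m n) * resolvent A z = 1\<^sub>m n"
    and "resolvent A z * (map_mat complex_of_real A - z \<cdot>\<^sub>m 1\<^sub>m n) = 1\<^sub>m n"
    using mat_inverse(2)[OF H] by (auto simp: resolvent_def dim H_def[symmetric])
qed

text \<open>With x = R v one has (A - z) x = v, so the lower bound for A - z becomes an upper bound
  for R.\<close>

lemma resolvent_bound:
  "Im z * L2_set (\<lambda>i. cmod (\<Sum>j<n. resolvent A z $$ (i, j) * v j)) {..<n}
    \<le> L2_set (\<lambda>i. cmod (v i)) {..<n}"
proof -
  define R where "R = resolvent A z"
  have R: "R \<in> carrier_mat n n" by (simp add: R_def resolvent_carrier)
  define x where "x i = (\<Sum>j<n. R $$ (i, j) * v j)" for i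
  have "(\<Sum>j<n. complex_of_real (A $$ (i, j)) * x j) - z * x i = v i" if i: "i < n" for i
  proof -
    have one: "(\<Sum>j<n. complex_of_real (A $$ (i, j)) * R $$ (j, k)) - z * R $$ (i, k)
        = (if i = k then 1 else 0)" if k: "k < n" for k
    proof -
      have "(if i = k then 1 else 0)
          = ((map_mat complex_of_real A - z \<cdot>\<^sub>m 1\<^sub>m n) * R) $$ (i, k)"
        using i k by (simp add: R_def resolvent_right)
      also have "\<dots> = (\<Sum>j<n. (complex_of_real (A $$ (i, j)) - z * (if i = j then 1 else 0)) * R $$ (j, k))"
        using A R i k by (simp add: scalar_prod_def atLeast0LessThan)
      also have "\<dots> = (\<Sum>j<n. complex_of_real (A $$ (i, j)) * R $$ (j, k))
          - (\<Sum>j<n. if i = j then z * R $$ (j, k) else 0)"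
        unfolding sum_subtractf[symmetric] by (intro sum.cong) (auto simp: left_diff_distrib)
      also have "(\<Sum>j<n. if i = j then z * R $$ (j, k) else 0) = z * R $$ (i, k)" using i by simp
      finally show ?thesis by simp
    qed
    have "(\<Sum>j<n. complex_of_real (A $$ (i, j)) * x j) - z * x i
        = (\<Sum>k<n. ((\<Sum>j<n. complex_of_real (A $$ (i, j)) * R $$ (j, k)) - z * R $$ (i, k)) * v k)"
    proof -
      have "(\<Sum>j<n. complex_of_real (A $$ (i, j)) * x j)
          = (\<Sum>j<n. \<Sum>k<n. complex_of_real (A $$ (i, j)) * R $$ (j, k) * v k)"
        by (simp add: x_def sum_distrib_left mult_ac)
      also have "\<dots> = (\<Sum>k<n. (\<Sum>j<n. complex_of_real (A $$ (i, j)) * R $$ (j, k)) * v k)"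
        by (subst sum.swap) (simp add: sum_distrib_right)
      finally show ?thesis
        by (simp add: x_def left_diff_distrib sum_subtractf sum_distrib_left[of z] mult.assoc)
    qed
    also have "\<dots> = (\<Sum>k<n. if i = k then v k else 0)"
      by (intro sum.cong) (auto simp: one)
    also have "\<dots> = v i" using i by simp
    finally show ?thesis .
  qed
  then have "L2_set (\<lambda>i. cmod ((\<Sum>j<n. complex_of_real (A $$ (i, j)) * x j) - z * x i)) {..<n}
      = L2_set (\<lambda>i. cmod (v i)) {..<n}"
    by (intro L2_set_cong) auto
  then show ?thesis
    using shifted_symmetric_bound[of n "\<lambda>i j. A $$ (i, j)" z x] sym z
    by (simp add: x_def R_def)
qed

end

lemma mat_trace_mult:
  assumes "A \<in> carrier_mat n n" "B \<in> carrier_mat n n"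
  shows "mat_trace (A * B) = (\<Sum>i<n. \<Sum>j<n. A $$ (i, j) * B $$ (j, i))"
  using assms by (simp add: mat_trace_def mat_mult_entry[OF assms] scalar_prod_def atLeast0LessThan)

text \<open>The trace of R (B - A) T pairs B - A with T R, so Cauchy-Schwarz over pairs of indices
  yields two Frobenius norms. Each of the n columns of T R has length at most 1/(Im z)^2, which
  gives sqrt n; with the factor 1/n of the normalised trace, 1/sqrt n is left. A bound by the
  spectral norm of the difference would forfeit this gain on a rank-one error.\<close>

lemma stieltjes_diff_le:
  fixes A B :: "real mat"
  assumes A: "A \<in> carrier_mat n n" "\<And>i j. i < n \<Longrightarrow> j < n \<Longrightarrow> A $$ (i, j) = A $$ (j, i)"
    and B: "B \<in> carrier_mat n n" "\<And>i j. i < n \<Longrightarrow> j < n \<Longrightarrow> B $$ (i, j) = B $$ (j, i)"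
    and n: "0 < n" and z: "0 < Im z"
  shows "cmod (stieltjes A z - stieltjes B z)
    \<le> frobenius n (\<lambda>i j. A $$ (i, j) - B $$ (i, j)) / sqrt (real n) / (Im z)\<^sup>2"
proof -
  let ?c = "map_mat complex_of_real"
  define R where "R = resolvent A z"
  define T where "T = resolvent B z"
  define HA where "HA = ?c A - z \<cdot>\<^sub>m 1\<^sub>m n"
  define HB where "HB = ?c B - z \<cdot>\<^sub>m 1\<^sub>m n"
  define D where "D = HB - HA"
  have R: "R \<in> carrier_mat n n" unfolding R_def by (rule resolvent_carrier[OF A z])
  have T: "T \<in> carrier_mat n n" unfolding T_def by (rule resolvent_carrier[OF B z])
  have H: "HA \<in> carrier_mat n n" "HB \<in> carrier_mat n n"
    using A(1) B(1) by (auto simp: HA_def HB_def intro!: carrier_matI)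
  have D: "D \<in> carrier_mat n n" using H by (intro carrier_matI) (auto simp: D_def)
  have RH: "R * HA = 1\<^sub>m n" unfolding R_def HA_def by (rule resolvent_left[OF A z])
  have HT: "HB * T = 1\<^sub>m n" unfolding T_def HB_def by (rule resolvent_right[OF B z])
  have "R * (D * T) = R * (1\<^sub>m n - HA * T)"
    unfolding D_def using R T H HT by (simp add: minus_mult_distrib_mat[of _ n n])
  also have "\<dots> = R * 1\<^sub>m n - R * (HA * T)"
    using R T H by (intro mult_minus_distrib_mat[of _ n n _ n]) auto
  also have "R * (HA * T) = T"
    using R T H RH by (simp add: assoc_mult_mat[symmetric, of _ n n _ n _ n])
  finally have id: "R - T = R * (D * T)" using R by simp
  have "mat_trace R - mat_trace T = mat_trace (R - T)"
    using R T by (simp add: mat_trace_def sum_subtractf)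
  also have "\<dots> = (\<Sum>i<n. \<Sum>j<n. R $$ (i, j) * (\<Sum>k<n. D $$ (j, k) * T $$ (k, i)))"
    unfolding id using R D T
    by (subst mat_trace_mult) (auto simp: mat_mult_entry simp del: index_mult_mat(1) intro!: sum.cong)
  also have "\<dots> = (\<Sum>i<n. \<Sum>j<n. \<Sum>k<n. D $$ (j, k) * (T $$ (k, i) * R $$ (i, j)))"
    by (simp add: sum_distrib_left mult_ac)
  \<comment> \<open>Moving the sum over i innermost is the cyclicity of the trace: the entries of D
    now face those of T R.\<close>
  also have "\<dots> = (\<Sum>j<n. \<Sum>k<n. \<Sum>i<n. D $$ (j, k) * (T $$ (k, i) * R $$ (i, j)))"
    by (subst sum.swap) (intro sum.cong refl sum.swap)
  also have "\<dots> = (\<Sum>j<n. \<Sum>k<n. D $$ (j, k) * (\<Sum>i<n. T $$ (k, i) * R $$ (i, j)))"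
    by (simp add: sum_distrib_left)
  finally have tr: "mat_trace R - mat_trace T
      = (\<Sum>j<n. \<Sum>k<n. D $$ (j, k) * (\<Sum>i<n. T $$ (k, i) * R $$ (i, j)))" .
  define P where "P k j = cmod (\<Sum>i<n. T $$ (k, i) * R $$ (i, j))" for k j
  have colR: "L2_set (\<lambda>i. cmod (R $$ (i, j))) {..<n} \<le> 1 / Im z" if j: "j < n" for j
  proof -
    \<comment> \<open>Column j of R is R applied to the j-th unit vector.\<close>
    let ?e = "\<lambda>k. if k = j then 1 else 0 :: complex"
    have e: "(\<Sum>k<n. R $$ (i, k) * ?e k) = R $$ (i, j)" for i
    proof -
      have "(\<Sum>k<n. R $$ (i, k) * ?e k) = (\<Sum>k<n. if k = j then R $$ (i, k) else 0)"
        by (intro sum.cong) auto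
      then show ?thesis using j by simp
    qed
    have "(\<Sum>k<n. (cmod (?e k))\<^sup>2) = (\<Sum>k<n. if k = j then 1 else 0)" by (intro sum.cong) auto
    then have "L2_set (\<lambda>k. cmod (?e k)) {..<n} = 1" using j by (simp add: L2_set_def)
    with resolvent_bound[OF A z, of ?e] show ?thesis
      using z unfolding R_def[symmetric] e by (simp add: field_simps)
  qed
  \<comment> \<open>Column j of T R is T applied to column j of R, which brings a second factor 1/Im
    z.\<close>
  have colP: "L2_set (\<lambda>k. P k j) {..<n} \<le> 1 / (Im z)\<^sup>2" if j: "j < n" for j
  proof -
    have "Im z * L2_set (\<lambda>k. P k j) {..<n} \<le> L2_set (\<lambda>i. cmod (R $$ (i, j))) {..<n}"
      unfolding P_def T_def by (rule resolvent_bound[OF B z])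
    also have "\<dots> \<le> 1 / Im z" by (rule colR[OF j])
    finally show ?thesis using z by (simp add: field_simps power2_eq_square)
  qed
  have "(frobenius n (\<lambda>j k. P k j))\<^sup>2 = (\<Sum>j<n. (L2_set (\<lambda>k. P k j) {..<n})\<^sup>2)"
    by (simp add: frobenius_power2 L2_set_power2)
  also have "\<dots> \<le> (\<Sum>j<n. (1 / (Im z)\<^sup>2)\<^sup>2)"
    using colP by (intro sum_mono power_mono) auto
  also have "\<dots> = (sqrt (real n) / (Im z)\<^sup>2)\<^sup>2" by (simp add: power_divide)
  finally have P: "frobenius n (\<lambda>j k. P k j) \<le> sqrt (real n) / (Im z)\<^sup>2"
    by (rule power2_le_imp_le) simp
  define d where "d j k = A $$ (j, k) - B $$ (j, k)" for j k
  have Dd: "cmod (D $$ (j, k)) = \<bar>d j k\<bar>" if "j < n" "k < n" for j k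
  proof -
    have "D $$ (j, k) = - complex_of_real (d j k)"
      using that A B by (simp add: D_def HA_def HB_def d_def)
    then show ?thesis by simp
  qed
  have "cmod (mat_trace R - mat_trace T) \<le> (\<Sum>j<n. \<Sum>k<n. \<bar>d j k\<bar> * \<bar>P k j\<bar>)"
    unfolding tr
    by (rule order_trans[OF norm_sum], rule sum_mono, rule order_trans[OF norm_sum], rule sum_mono)
      (simp add: norm_mult Dd P_def)
  also have "\<dots> = (\<Sum>p\<in>{..<n} \<times> {..<n}. \<bar>(\<lambda>(j, k). d j k) p\<bar> * \<bar>(\<lambda>(j, k). P k j) p\<bar>)"
    by (simp add: sum.cartesian_product split_def)
  also have "\<dots> \<le> frobenius n d * frobenius n (\<lambda>j k. P k j)"
    unfolding frobenius_def by (rule L2_set_mult_ineq)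
  also have "\<dots> \<le> frobenius n d * (sqrt (real n) / (Im z)\<^sup>2)"
    by (intro mult_left_mono P frobenius_nonneg)
  finally have fin: "cmod (mat_trace R - mat_trace T) \<le> frobenius n d * (sqrt (real n) / (Im z)\<^sup>2)" .
  have "stieltjes A z - stieltjes B z = (mat_trace R - mat_trace T) / of_nat n"
    using A(1) B(1) by (simp add: stieltjes_def R_def T_def resolvent_def diff_divide_distrib)
  then have "cmod (stieltjes A z - stieltjes B z) = cmod (mat_trace R - mat_trace T) / real n"
    by (simp add: norm_divide)
  also have "\<dots> \<le> frobenius n d * (sqrt (real n) / (Im z)\<^sup>2) / real n"
    using fin by (intro divide_right_mono) auto
  also have "\<dots> = frobenius n d / sqrt (real n) / (Im z)\<^sup>2"
  proof -
    have "sqrt (real n) / real n = 1 / sqrt (real n)"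
      using n by (simp add: real_div_sqrt field_simps)
    then show ?thesis
      by (metis (no_types, opaque_lifting) divide_divide_eq_left mult.commute times_divide_eq_right mult_1_right)
  qed
  finally show ?thesis unfolding d_def .
qed

section \<open>Expansions of Gaussian densities\<close>

text \<open>After squaring and multiplying by 1 + t, both one-sided comparisons become polynomial
  inequalities, because a^2 (1 + t) = 1.\<close>

lemma inverse_sqrt_expansion:
  fixes t :: real
  assumes "\<bar>t\<bar> \<le> 1 / 32"
  shows "\<bar>1 / sqrt (1 + t) - 1 + t / 2\<bar> \<le> t\<^sup>2"
proof -
  define a where "a = 1 / sqrt (1 + t)"
  have t: "- (1 / 32) \<le> t" "t \<le> 1 / 32" using assms by auto
  have a0: "0 < a" using t by (simp add: a_def)
  have a2: "a\<^sup>2 * (1 + t) = 1" using t by (simp add: a_def power_divide)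
  have t2: "0 \<le> t\<^sup>2" "t\<^sup>2 \<le> 1 / 32"
    using power_mono[OF assms, of 2] by (auto simp: power2_eq_square)
  have "1 - t / 2 \<le> a"
  proof (rule power2_le_imp_le)
    have "(1 - t / 2)\<^sup>2 * (1 + t) = 1 - t\<^sup>2 * (3 / 4 - t / 4)"
      by (simp add: power2_eq_square algebra_simps)
    also have "\<dots> \<le> a\<^sup>2 * (1 + t)"
      unfolding a2 using mult_nonneg_nonneg[OF t2(1), of "3 / 4 - t / 4"] t by simp
    finally show "(1 - t / 2)\<^sup>2 \<le> a\<^sup>2" using t by simp
  qed (use a0 in simp)
  moreover have "a \<le> 1 - t / 2 + t\<^sup>2"
  proof (rule power2_le_imp_le)
    have "- (1 / 32) \<le> t * t\<^sup>2"
    proof -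
      have "\<bar>t * t\<^sup>2\<bar> \<le> (1 / 32) * (1 / 32)"
        unfolding abs_mult using assms t2 by (intro mult_mono) auto
      then show ?thesis by auto
    qed
    then have "0 \<le> 5 / 4 + 5 / 4 * t + t * t\<^sup>2" using t by linarith
    then have "0 \<le> t\<^sup>2 * (5 / 4 + 5 / 4 * t + t * t\<^sup>2)"
      using t2 by (intro mult_nonneg_nonneg)
    also have "\<dots> = (1 - t / 2 + t\<^sup>2)\<^sup>2 * (1 + t) - 1"
      by (simp add: power2_eq_square algebra_simps)
    finally have "a\<^sup>2 * (1 + t) \<le> (1 - t / 2 + t\<^sup>2)\<^sup>2 * (1 + t)" unfolding a2 by simp
    then show "a\<^sup>2 \<le> (1 - t / 2 + t\<^sup>2)\<^sup>2" using t by simp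
  qed (use t t2 in simp)
  ultimately show ?thesis using t2 unfolding a_def[symmetric] by auto
qed

lemma inverse_sqrt_le_2:
  fixes t :: real
  assumes "\<bar>t\<bar> \<le> 1 / 32"
  shows "\<bar>1 / sqrt (1 + t)\<bar> \<le> 2"
proof -
  have "t\<^sup>2 \<le> (1 / 32)\<^sup>2" using power_mono[OF assms, of 2] by simp
  then show ?thesis
    using inverse_sqrt_expansion[OF assms] assms by (simp add: power2_eq_square abs_if split: if_splits)
qed

lemma exp_remainder:
  fixes w :: real
  shows "\<bar>exp w - (\<Sum>m<n. w ^ m / fact m)\<bar> \<le> exp \<bar>w\<bar> * \<bar>w\<bar> ^ n"
proof -
  obtain t where t: "\<bar>t\<bar> \<le> \<bar>w\<bar>" "exp w = (\<Sum>m<n. w ^ m / fact m) + exp t / fact n * w ^ n"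
    using Maclaurin_exp_le[of w n] by auto
  have "\<bar>exp t / fact n * w ^ n\<bar> = exp t / fact n * \<bar>w\<bar> ^ n"
    by (simp add: abs_mult power_abs)
  also have "\<dots> \<le> exp t / 1 * \<bar>w\<bar> ^ n"
    by (intro mult_right_mono divide_left_mono) auto
  also have "\<dots> \<le> exp \<bar>w\<bar> * \<bar>w\<bar> ^ n"
    using t(1) by (intro mult_right_mono) auto
  finally show ?thesis using t(2) by simp
qed

text \<open>From y \<le> exp y at y = q/c. A power of q is paid for by an exponential of any
  prescribed rate b > 0, at the price c^k with c = k/b at best.\<close>

lemma power_le_exp:
  fixes q :: real
  assumes "0 \<le> q" "0 < c" "real k / c \<le> b"
  shows "q ^ k \<le> c ^ k * exp (b * q)"
proof -
  have "q / c \<le> exp (q / c)" using exp_ge_add_one_self[of "q / c"] by linarith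
  then have "q \<le> c * exp (q / c)" using assms by (simp add: field_simps)
  then have "q ^ k \<le> (c * exp (q / c)) ^ k" using assms by (intro power_mono)
  also have "\<dots> = c ^ k * exp (real k / c * q)"
    by (simp add: power_mult_distrib exp_of_nat_mult[symmetric])
  also have "\<dots> \<le> c ^ k * exp (b * q)"
    using assms mult_right_mono[OF assms(3,1)] by (intro mult_left_mono) auto
  finally show ?thesis .
qed

text \<open>The Mehler kernel: the density of a standard normal pair of correlation \<rho> relative
  to the product measure, and the closed form of the series of \<rho>^r h_r(x) h_r(y) / r!.\<close>

definition mehler :: "real \<Rightarrow> real \<Rightarrow> real \<Rightarrow> real" where
  "mehler \<rho> x y = exp ((\<rho> * x * y - \<rho>\<^sup>2 * ((x\<^sup>2 + y\<^sup>2) / 2)) / (1 - \<rho>\<^sup>2)) / sqrt (1 - \<rho>\<^sup>2)"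

text \<open>Given X = x, the partner Y is normal with mean \<rho> x and variance 1 - \<rho>^2.
  Completing the square relates its density to the standard one, so integrating out an independent z
  in \<rho> x + sqrt(1 - \<rho>^2) z amounts to integrating against the kernel.\<close>

lemma normal_density_mehler:
  assumes "\<bar>\<rho>\<bar> < 1"
  shows "normal_density (\<rho> * x) (sqrt (1 - \<rho>\<^sup>2)) y = mehler \<rho> x y * std_normal_density y"
proof -
  have \<rho>: "0 < 1 - \<rho>\<^sup>2" using assms by (simp add: abs_square_less_1)
  have "- (y - \<rho> * x)\<^sup>2 / (2 * (1 - \<rho>\<^sup>2))
      = (\<rho> * x * y - \<rho>\<^sup>2 * ((x\<^sup>2 + y\<^sup>2) / 2)) / (1 - \<rho>\<^sup>2) + - y\<^sup>2 / 2"
    using \<rho> by (simp add: field_simps) (simp add: power2_eq_square power4_eq_xxxx algebra_simps)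
  then have "exp (- (y - \<rho> * x)\<^sup>2 / (2 * (1 - \<rho>\<^sup>2)))
      = exp ((\<rho> * x * y - \<rho>\<^sup>2 * ((x\<^sup>2 + y\<^sup>2) / 2)) / (1 - \<rho>\<^sup>2)) * exp (- y\<^sup>2 / 2)"
    by (simp only: exp_add)
  then show ?thesis
    using \<rho> by (simp add: normal_density_def mehler_def real_sqrt_mult)
qed

text \<open>The polynomial consists of the terms of degree 0, 1 and 2 in the Hermite series. With q
  = (x^2 + y^2)/2 the exponent is at most 2 \<bar>\<rho>\<bar> q \<le> q/8, so every remainder is a
  polynomial in q times at most G = exp(q/8). A second factor G absorbs the polynomial, and G^2 is
  the exponential of the statement.\<close>

lemma mehler_expansion:
  assumes \<rho>: "\<bar>\<rho>\<bar> \<le> 1 / 16"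
  shows "\<bar>mehler \<rho> x y - (1 + \<rho> * x * y + \<rho>\<^sup>2 * ((x\<^sup>2 - 1) * (y\<^sup>2 - 1) / 2))\<bar>
    \<le> 300000 * \<bar>\<rho>\<bar> ^ 3 * exp ((x\<^sup>2 + y\<^sup>2) / 8)"
proof -
  define r where "r = \<bar>\<rho>\<bar>"
  define q where "q = (x\<^sup>2 + y\<^sup>2) / 2"
  define G where "G = exp (q / 8)"
  define \<kappa> where "\<kappa> = 1 / (1 - \<rho>\<^sup>2)"
  define w0 where "w0 = \<rho> * x * y - \<rho>\<^sup>2 * q"
  define w where "w = w0 * \<kappa>"
  define a where "a = 1 / sqrt (1 - \<rho>\<^sup>2)"
  \<comment> \<open>Second-order Taylor polynomial in \<rho> of the exponential factor; the
    prefactor \<open>a\<close> contributes the missing \<rho>^2/2.\<close>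
  define T where "T = 1 + \<rho> * x * y - \<rho>\<^sup>2 * q + \<rho>\<^sup>2 * x\<^sup>2 * y\<^sup>2 / 2"
  have r: "0 \<le> r" "r \<le> 1 / 16" using \<rho> by (auto simp: r_def)
  have r2: "\<rho>\<^sup>2 = r\<^sup>2" by (simp add: r_def)
  have r2le: "r\<^sup>2 \<le> 1 / 256" using power_mono[OF r(2,1), of 2] by (simp add: power2_eq_square)
  have r2r: "r\<^sup>2 \<le> r / 16" using r mult_left_mono[OF r(2,1)] by (simp add: power2_eq_square)
  have q: "0 \<le> q" by (simp add: q_def)
  have G: "1 \<le> G" using q by (simp add: G_def)
  have xy: "\<bar>x * y\<bar> \<le> q"
    using zero_le_power2[of "\<bar>x\<bar> - \<bar>y\<bar>"] by (simp add: q_def power2_diff abs_mult)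
  have rxy: "\<bar>\<rho> * x * y\<bar> \<le> r * q"
    unfolding mult.assoc abs_mult[of \<rho>] r_def[symmetric] using xy r(1) by (rule mult_left_mono)
  have r2q: "0 \<le> r\<^sup>2 * q" "r\<^sup>2 * q \<le> r * q"
    using r q r2r by (auto intro!: mult_right_mono)
  have r2xy: "0 \<le> \<rho>\<^sup>2 * x\<^sup>2 * y\<^sup>2" "\<rho>\<^sup>2 * x\<^sup>2 * y\<^sup>2 \<le> r\<^sup>2 * q\<^sup>2"
  proof -
    have "\<bar>\<rho> * x * y\<bar>\<^sup>2 \<le> (r * q)\<^sup>2" using rxy by (intro power_mono) auto
    then show "\<rho>\<^sup>2 * x\<^sup>2 * y\<^sup>2 \<le> r\<^sup>2 * q\<^sup>2" by (simp add: power_mult_distrib)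
  qed simp
  have w0: "\<bar>w0\<bar> \<le> r * q + r\<^sup>2 * q"
    unfolding w0_def r2 using rxy r2q by linarith
  have \<kappa>: "1 \<le> \<kappa>" "\<kappa> \<le> 256 / 255" "\<kappa> - 1 = r\<^sup>2 * \<kappa>"
    using r2le unfolding \<kappa>_def r2 by (auto simp: field_simps)
  have ww0: "\<bar>w - w0\<bar> \<le> 4 * r ^ 3 * q"
  proof -
    have "w - w0 = w0 * (r\<^sup>2 * \<kappa>)"
      by (simp add: w_def right_diff_distrib flip: \<kappa>(3))
    then have "\<bar>w - w0\<bar> = \<bar>w0\<bar> * (r\<^sup>2 * \<kappa>)"
      using \<kappa>(1) by (simp add: abs_mult)
    also have "\<dots> \<le> (r * q + r * q) * (r\<^sup>2 * 2)"
    proof (rule mult_mono)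
      show "\<bar>w0\<bar> \<le> r * q + r * q" using w0 r2q by linarith
      show "r\<^sup>2 * \<kappa> \<le> r\<^sup>2 * 2" using \<kappa> by (intro mult_left_mono) auto
    qed (use r q \<kappa> in auto)
    finally show ?thesis by (simp add: power2_eq_square power3_eq_cube mult_ac)
  qed
  have w: "\<bar>w\<bar> \<le> 2 * (r * q)"
  proof -
    have "\<bar>w\<bar> = \<bar>w0\<bar> * \<kappa>" using \<kappa> by (simp add: w_def abs_mult)
    also have "\<dots> \<le> (r * q + r / 16 * q) * (256 / 255)"
    proof (rule mult_mono)
      show "\<bar>w0\<bar> \<le> r * q + r / 16 * q" using w0 mult_right_mono[OF r2r q] by linarith
    qed (use r q \<kappa> in auto)
    also have "\<dots> = 16 / 15 * (r * q)" by (simp add: field_simps)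
    also have "\<dots> \<le> 2 * (r * q)" using mult_nonneg_nonneg[OF r(1) q] by linarith
    finally show ?thesis .
  qed
  have wG: "exp \<bar>w\<bar> \<le> G"
    using w mult_right_mono[OF r(2) q] by (simp add: G_def)
  have "\<bar>exp w - (\<Sum>m<3. w ^ m / fact m)\<bar> \<le> exp \<bar>w\<bar> * \<bar>w\<bar> ^ 3" by (rule exp_remainder)
  also have "\<dots> \<le> G * (2 * (r * q)) ^ 3"
    using wG w G by (intro mult_mono power_mono) auto
  finally have e1: "\<bar>exp w - (1 + w + w\<^sup>2 / 2)\<bar> \<le> 8 * (r ^ 3 * (q ^ 3 * G))"
    by (simp add: eval_nat_numeral power_mult_distrib mult_ac)
  have wr: "\<bar>w - \<rho> * x * y\<bar> \<le> 2 * (r\<^sup>2 * q)"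
  proof -
    have "4 * r ^ 3 * q \<le> r\<^sup>2 * q"
    proof -
      have "4 * r ^ 3 * q = (4 * r) * (r\<^sup>2 * q)" by (simp add: power2_eq_square power3_eq_cube)
      also have "\<dots> \<le> 1 * (r\<^sup>2 * q)" using r r2q by (intro mult_right_mono) auto
      finally show ?thesis by simp
    qed
    moreover have "\<bar>w0 - \<rho> * x * y\<bar> \<le> r\<^sup>2 * q" using r2q by (simp add: w0_def r2)
    ultimately show ?thesis using ww0 by linarith
  qed
  have e2: "\<bar>w\<^sup>2 - \<rho>\<^sup>2 * x\<^sup>2 * y\<^sup>2\<bar> \<le> 6 * (r ^ 3 * q\<^sup>2)"
  proof -
    have "\<bar>w\<^sup>2 - \<rho>\<^sup>2 * x\<^sup>2 * y\<^sup>2\<bar> = \<bar>w - \<rho> * x * y\<bar> * \<bar>w + \<rho> * x * y\<bar>"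
      by (simp add: abs_mult[symmetric] power2_eq_square algebra_simps)
    also have "\<dots> \<le> (2 * (r\<^sup>2 * q)) * (3 * (r * q))"
      using wr w rxy r q by (intro mult_mono) auto
    finally show ?thesis by (simp add: power2_eq_square power3_eq_cube mult_ac)
  qed
  have e3: "\<bar>exp w - T\<bar> \<le> 8 * (r ^ 3 * (q ^ 3 * G)) + 4 * (r ^ 3 * q) + 3 * (r ^ 3 * q\<^sup>2)"
  proof -
    have "exp w - T = (exp w - (1 + w + w\<^sup>2 / 2)) + (w - w0) + (w\<^sup>2 - \<rho>\<^sup>2 * x\<^sup>2 * y\<^sup>2) / 2"
      by (simp add: T_def w0_def field_simps)
    \<comment> \<open>Stated for arbitrary reals, so that linear arithmetic meets atoms in place of
      the nonlinear summands.\<close>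
    moreover have "\<bar>A + B + D / 2\<bar> \<le> a' + b' + d' / 2"
      if "\<bar>A\<bar> \<le> a'" "\<bar>B\<bar> \<le> b'" "\<bar>D\<bar> \<le> d'" for A B D a' b' d' :: real
      using that by linarith
    ultimately have "\<bar>exp w - T\<bar> \<le> 8 * (r ^ 3 * (q ^ 3 * G)) + 4 * r ^ 3 * q + 6 * (r ^ 3 * q\<^sup>2) / 2"
      using e1 ww0 e2 by presburger
    then show ?thesis by (simp add: mult_ac)
  qed
  have t: "\<bar>- \<rho>\<^sup>2\<bar> \<le> 1 / 32" using r2le by (simp add: r2)
  have a1: "\<bar>a - 1 - \<rho>\<^sup>2 / 2\<bar> \<le> r ^ 3"
  proof -
    have "\<bar>a - 1 - \<rho>\<^sup>2 / 2\<bar> \<le> (- \<rho>\<^sup>2)\<^sup>2"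
      using inverse_sqrt_expansion[OF t] by (simp add: a_def)
    also have "\<dots> = (r\<^sup>2)\<^sup>2" by (simp add: r2)
    also have "\<dots> = r * r ^ 3" by (simp add: power2_eq_square power3_eq_cube)
    also have "\<dots> \<le> 1 * r ^ 3" using r by (intro mult_right_mono) auto
    finally show ?thesis by simp
  qed
  have a2: "\<bar>a\<bar> \<le> 2" using inverse_sqrt_le_2[OF t] by (simp add: a_def)
  \<comment> \<open>Here one order of r must be gained, because T - 1 will be multiplied by
    \<rho>^2/2 and a cubic remainder is wanted.\<close>
  have T1: "\<bar>T - 1\<bar> \<le> r * (2 * q + q\<^sup>2)"
  proof -
    have "r\<^sup>2 * q\<^sup>2 \<le> r * q\<^sup>2" using r2r r by (intro mult_right_mono) auto
    moreover have "T - 1 = \<rho> * x * y - r\<^sup>2 * q + \<rho>\<^sup>2 * x\<^sup>2 * y\<^sup>2 / 2"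
      by (simp add: T_def r2)
    moreover have "\<bar>A - B + D / 2\<bar> \<le> a' + a' + d'"
      if "\<bar>A\<bar> \<le> a'" "0 \<le> B" "B \<le> a'" "0 \<le> D" "D \<le> d''" "d'' \<le> d'" for A B D a' d' d'' :: real
      using that by linarith
    ultimately have "\<bar>T - 1\<bar> \<le> r * q + r * q + r * q\<^sup>2"
      using rxy r2q r2xy by presburger
    then show ?thesis by (simp add: algebra_simps)
  qed
  have T0: "\<bar>T\<bar> \<le> 1 + 2 * q + q\<^sup>2"
  proof -
    have "r * (2 * q + q\<^sup>2) \<le> 1 * (2 * q + q\<^sup>2)" using r q by (intro mult_right_mono) auto
    with T1 have "\<bar>T - 1\<bar> \<le> 1 * (2 * q + q\<^sup>2)" by (rule order_trans)
    moreover have "\<bar>T\<bar> \<le> \<bar>T - 1\<bar> + \<bar>1\<bar>" using abs_triangle_ineq[of "T - 1" 1] by simp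
    ultimately show ?thesis by simp
  qed
  have "mehler \<rho> x y = a * exp w"
    by (simp add: mehler_def a_def w_def w0_def q_def \<kappa>_def)
  then have "mehler \<rho> x y - (1 + \<rho> * x * y + \<rho>\<^sup>2 * ((x\<^sup>2 - 1) * (y\<^sup>2 - 1) / 2))
      = a * (exp w - T) + (a - 1 - \<rho>\<^sup>2 / 2) * T + \<rho>\<^sup>2 / 2 * (T - 1)"
    by (simp add: T_def q_def field_simps)
  also have "\<bar>\<dots>\<bar> \<le> \<bar>a\<bar> * \<bar>exp w - T\<bar> + \<bar>a - 1 - \<rho>\<^sup>2 / 2\<bar> * \<bar>T\<bar> + \<rho>\<^sup>2 / 2 * \<bar>T - 1\<bar>"
    by (auto simp: abs_mult intro!: order_trans[OF abs_triangle_ineq] add_mono)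
  also have "\<dots> \<le> 2 * (8 * (r ^ 3 * (q ^ 3 * G)) + 4 * (r ^ 3 * q) + 3 * (r ^ 3 * q\<^sup>2))
      + r ^ 3 * (1 + 2 * q + q\<^sup>2) + r\<^sup>2 / 2 * (r * (2 * q + q\<^sup>2))"
    unfolding r2 using a2 e3 a1[unfolded r2] T0 T1 r q by (intro add_mono mult_mono) auto
  also have "\<dots> = r ^ 3 * (16 * (q ^ 3 * G) + 11 * q + 15 / 2 * q\<^sup>2 + 1)"
    by (simp add: field_simps power2_eq_square power3_eq_cube)
  also have "\<dots> \<le> r ^ 3 * (300000 * (G * G))"
  proof (rule mult_left_mono)
    \<comment> \<open>24, 16 and 8 are k/b for k = 3, 2, 1 and b = 1/8. The resulting sum 16 * 13824
      + 11 * 8 + 15/2 * 256 + 1 is rounded up to 300000.\<close>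
    have q3: "q ^ 3 \<le> 13824 * G" using power_le_exp[OF q, of 24 3 "1 / 8"] by (simp add: G_def)
    have q2: "q\<^sup>2 \<le> 256 * G" using power_le_exp[OF q, of 16 2 "1 / 8"] by (simp add: G_def)
    have q1: "q \<le> 8 * G" using power_le_exp[OF q, of 8 1 "1 / 8"] by (simp add: G_def)
    have GG: "G \<le> G * G" using G by simp
    have "q ^ 3 * G \<le> 13824 * G * G" using q3 G by (intro mult_right_mono) auto
    then have "q ^ 3 * G \<le> 13824 * (G * G)" by simp
    then show "16 * (q ^ 3 * G) + 11 * q + 15 / 2 * q\<^sup>2 + 1 \<le> 300000 * (G * G)"
      using q2 q1 GG G by linarith
  qed (use r in simp)
  also have "G * G = exp ((x\<^sup>2 + y\<^sup>2) / 8)"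
    by (simp add: G_def q_def exp_add[symmetric])
  finally show ?thesis by (simp add: r_def)
qed

text \<open>Likelihood ratio of the centred normal law of variance 1 + d against the standard
  one.\<close>

definition scale_kernel :: "real \<Rightarrow> real \<Rightarrow> real" where
  "scale_kernel d x = exp (x\<^sup>2 * d / (2 * (1 + d))) / sqrt (1 + d)"

lemma normal_density_scale_kernel:
  assumes "-1 < d"
  shows "normal_density 0 (sqrt (1 + d)) x = scale_kernel d x * std_normal_density x"
proof -
  have "- x\<^sup>2 / (2 * (1 + d)) = x\<^sup>2 * d / (2 * (1 + d)) + - x\<^sup>2 / 2"
    using assms by (simp add: field_simps)
  then have "exp (- x\<^sup>2 / (2 * (1 + d))) = exp (x\<^sup>2 * d / (2 * (1 + d))) * exp (- x\<^sup>2 / 2)"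
    by (simp only: exp_add)
  then show ?thesis
    using assms by (simp add: normal_density_def scale_kernel_def real_sqrt_mult)
qed

text \<open>The coefficient of d/2 is the second Hermite polynomial, so to first order a change of
  variance acts only through \<zeta>_2. Here q is x^2 itself: the exponent is at most q/32, which
  stays below the rate of G = exp(q/16), and G^2 = exp(q/8) again absorbs the polynomial
  factors.\<close>

lemma scale_kernel_expansion:
  assumes d: "\<bar>d\<bar> \<le> 1 / 32"
  shows "\<bar>scale_kernel d x - (1 + d / 2 * (x\<^sup>2 - 1))\<bar> \<le> 3000 * d\<^sup>2 * exp (x\<^sup>2 / 8)"
proof -
  define q where "q = x\<^sup>2"
  define G where "G = exp (q / 16)"
  define w where "w = q * d / (2 * (1 + d))"
  define a where "a = 1 / sqrt (1 + d)"
  define T where "T = 1 + d / 2 * q"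
  have q: "0 \<le> q" by (simp add: q_def)
  have G: "1 \<le> G" using q by (simp add: G_def)
  have d': "- (1 / 32) \<le> d" "d \<le> 1 / 32" using d by auto
  have k: "0 < 1 / (2 * (1 + d))" "1 / (2 * (1 + d)) \<le> 1"
    using d' by (auto simp: field_simps)
  have w: "\<bar>w\<bar> \<le> \<bar>d\<bar> * q"
  proof -
    have "\<bar>w\<bar> = \<bar>d\<bar> * q * (1 / (2 * (1 + d)))"
      using q d' by (simp add: w_def abs_mult)
    also have "\<dots> \<le> \<bar>d\<bar> * q * 1" using k q by (intro mult_left_mono) auto
    finally show ?thesis by simp
  qed
  have wG: "exp \<bar>w\<bar> \<le> G"
    using w mult_right_mono[OF d q] q by (simp add: G_def)
  have "\<bar>exp w - (\<Sum>m<2. w ^ m / fact m)\<bar> \<le> exp \<bar>w\<bar> * \<bar>w\<bar> ^ 2" by (rule exp_remainder)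
  also have "\<dots> \<le> G * (\<bar>d\<bar> * q)\<^sup>2" using wG w G by (intro mult_mono power_mono) auto
  finally have e1: "\<bar>exp w - (1 + w)\<bar> \<le> d\<^sup>2 * (q\<^sup>2 * G)"
    by (simp add: eval_nat_numeral power_mult_distrib mult_ac)
  have e2: "\<bar>w - d / 2 * q\<bar> \<le> d\<^sup>2 * q"
  proof -
    have "w - d / 2 * q = - (d\<^sup>2 * q * (1 / (2 * (1 + d))))"
      using d' by (simp add: w_def field_simps power2_eq_square)
    then have "\<bar>w - d / 2 * q\<bar> = d\<^sup>2 * q * (1 / (2 * (1 + d)))"
      using k q by (simp add: abs_mult)
    also have "\<dots> \<le> d\<^sup>2 * q * 1" using k q by (intro mult_left_mono) auto
    finally show ?thesis by simp
  qed
  have e3: "\<bar>exp w - T\<bar> \<le> d\<^sup>2 * (q\<^sup>2 * G) + d\<^sup>2 * q"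
  proof -
    have "exp w - T = (exp w - (1 + w)) + (w - d / 2 * q)" by (simp add: T_def)
    then show ?thesis using e1 e2 by linarith
  qed
  have a1: "\<bar>a - 1 + d / 2\<bar> \<le> d\<^sup>2" using inverse_sqrt_expansion[OF d] by (simp add: a_def)
  have a2: "\<bar>a\<bar> \<le> 2" using inverse_sqrt_le_2[OF d] by (simp add: a_def)
  have T1: "\<bar>T - 1\<bar> \<le> \<bar>d\<bar> * q" using q by (simp add: T_def abs_mult)
  have T0: "\<bar>T\<bar> \<le> 1 + q"
  proof -
    have "\<bar>d\<bar> * q \<le> 1 * q" using d q by (intro mult_right_mono) auto
    then show ?thesis using T1 by linarith
  qed
  have "scale_kernel d x = a * exp w" by (simp add: scale_kernel_def a_def w_def q_def)
  then have "scale_kernel d x - (1 + d / 2 * (x\<^sup>2 - 1))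
      = a * (exp w - T) + (a - 1 + d / 2) * T + (- d / 2) * (T - 1)"
    by (simp add: T_def q_def field_simps)
  also have "\<bar>\<dots>\<bar> \<le> \<bar>a\<bar> * \<bar>exp w - T\<bar> + \<bar>a - 1 + d / 2\<bar> * \<bar>T\<bar> + \<bar>- d / 2\<bar> * \<bar>T - 1\<bar>"
    unfolding abs_mult[symmetric] by (intro order_trans[OF abs_triangle_ineq] add_mono order_refl)
  also have "\<dots> \<le> 2 * (d\<^sup>2 * (q\<^sup>2 * G) + d\<^sup>2 * q) + d\<^sup>2 * (1 + q) + \<bar>d\<bar> * (\<bar>d\<bar> * q)"
    using a2 e3 a1 T0 T1 q by (intro add_mono mult_mono) auto
  also have "\<dots> = d\<^sup>2 * (2 * (q\<^sup>2 * G) + 4 * q + 1)"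
    by (simp add: field_simps power2_eq_square abs_mult[symmetric])
  also have "\<dots> \<le> d\<^sup>2 * (3000 * (G * G))"
  proof (rule mult_left_mono)
    \<comment> \<open>32 and 16 are k/b for k = 2, 1 and b = 1/16; the sum 2 * 1024 + 4 * 16 + 1
      stays below 3000.\<close>
    have q2: "q\<^sup>2 \<le> 1024 * G" using power_le_exp[OF q, of 32 2 "1 / 16"] by (simp add: G_def)
    have q1: "q \<le> 16 * G" using power_le_exp[OF q, of 16 1 "1 / 16"] by (simp add: G_def)
    have GG: "G \<le> G * G" using G by simp
    have "q\<^sup>2 * G \<le> 1024 * G * G" using q2 G by (intro mult_right_mono) auto
    then have "q\<^sup>2 * G \<le> 1024 * (G * G)" by (simp add: mult.assoc)
    then show "2 * (q\<^sup>2 * G) + 4 * q + 1 \<le> 3000 * (G * G)"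
      using q1 GG G by linarith
  qed simp
  also have "G * G = exp (x\<^sup>2 / 8)" by (simp add: G_def q_def exp_add[symmetric])
  finally show ?thesis by simp
qed

section \<open>Gaussian vectors\<close>

lemma std_gaussian_eq: "std_gaussian = std_normal_distribution"
  by (simp add: std_gaussian_def)

lemma real_distribution_std_gaussian: "real_distribution std_gaussian"
  unfolding std_gaussian_eq by (rule real_dist_normal_dist)

lemma char_std_gaussian: "char std_gaussian t = complex_of_real (exp (- t\<^sup>2 / 2))"
  unfolding std_gaussian_eq by (simp add: char_std_normal_distribution)

text \<open>Tilting \<open>M\<close> by W/m, with m the integral of W, gives a probability measure
  under which X has the characteristic function of \<open>N\<close>; Levy's theorem identifies its
  law. A factorisation known for characteristic functions thereby passes to events.\<close>

lemma weighted_char_unique: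
  fixes X W :: "'a \<Rightarrow> real"
  assumes M: "prob_space M" and [measurable]: "X \<in> borel_measurable M" "W \<in> borel_measurable M"
    and W: "\<And>\<omega>. 0 \<le> W \<omega>" "\<And>\<omega>. W \<omega> \<le> B"
    and N: "real_distribution N"
    and char: "\<And>s. (\<integral>\<omega>. W \<omega> *\<^sub>R iexp (s * X \<omega>) \<partial>M) = (\<integral>\<omega>. W \<omega> \<partial>M) *\<^sub>R char N s"
    and A [measurable]: "A \<in> sets borel"
  shows "(\<integral>\<omega>. W \<omega> * indicator A (X \<omega>) \<partial>M) = (\<integral>\<omega>. W \<omega> \<partial>M) * measure N A"
proof -
  interpret prob_space M by fact
  interpret N: real_distribution N by fact
  define m where "m = (\<integral>\<omega>. W \<omega> \<partial>M)"
  have int: "integrable M W" using W by (intro integrable_const_bound[of _ B]) auto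
  show ?thesis
  proof (cases "m = 0")
    case True
    \<comment> \<open>A weight of total mass zero cannot be normalised, but then both sides
      vanish.\<close>
    then have "AE \<omega> in M. W \<omega> = 0"
      using integral_nonneg_eq_0_iff_AE[OF int] W by (simp add: m_def)
    then have "(\<integral>\<omega>. W \<omega> * indicator A (X \<omega>) \<partial>M) = (\<integral>\<omega>. 0 \<partial>M)"
      by (intro integral_cong_AE) auto
    then show ?thesis using True by (simp add: m_def)
  next
    case False
    moreover have "0 \<le> m" using W by (simp add: m_def integral_nonneg)
    ultimately have m: "0 < m" by simp
    define P where "P = density M (\<lambda>\<omega>. ennreal (W \<omega> / m))"
    have [measurable_cong]: "sets P = sets M" by (simp add: P_def)
    have "emeasure P (space P) = (\<integral>\<^sup>+\<omega>. ennreal (W \<omega> / m) \<partial>M)"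
      by (simp add: P_def emeasure_density cong: nn_integral_cong)
    also have "\<dots> = ennreal (\<integral>\<omega>. W \<omega> / m \<partial>M)"
      using W m int by (intro nn_integral_eq_integral) auto
    also have "\<dots> = 1" using m by (simp add: m_def)
    finally interpret P: prob_space P by (rule prob_spaceI)
    have [measurable]: "X \<in> borel_measurable P" by simp
    have dist: "real_distribution (distr P borel X)"
      by (intro P.real_distribution_distr) simp
    have "char (distr P borel X) = char N"
    proof
      fix s
      have "char (distr P borel X) s = (\<integral>\<omega>. iexp (s * X \<omega>) \<partial>P)"
        unfolding char_def by (subst integral_distr) auto
      also have "\<dots> = (\<integral>\<omega>. (W \<omega> / m) *\<^sub>R iexp (s * X \<omega>) \<partial>M)"
        unfolding P_def using W m by (subst integral_density) auto
      also have "\<dots> = (\<integral>\<omega>. (1 / m) *\<^sub>R (W \<omega> *\<^sub>R iexp (s * X \<omega>)) \<partial>M)" by simp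
      also have "\<dots> = (1 / m) *\<^sub>R (m *\<^sub>R char N s)"
        unfolding integral_scaleR_right char m_def ..
      finally show "char (distr P borel X) s = char N s" using m by simp
    qed
    then have eq: "distr P borel X = N" by (rule Levy_uniqueness[OF dist N])
    have "measure N A = (\<integral>x. indicator A x \<partial>distr P borel X)"
      unfolding eq by simp
    also have "\<dots> = (\<integral>\<omega>. indicator A (X \<omega>) \<partial>P)" by (subst integral_distr) auto
    also have "\<dots> = (\<integral>\<omega>. (W \<omega> / m) *\<^sub>R indicator A (X \<omega>) \<partial>M)"
      unfolding P_def using W m by (subst integral_density) auto
    also have "\<dots> = (\<integral>\<omega>. W \<omega> * indicator A (X \<omega>) \<partial>M) / m" by simp
    finally show ?thesis using m by (simp add: m_def)
  qed
qed

text \<open>Weighting by \<open>1 + cos (t Z)\<close> and \<open>1 + sin (t Z)\<close> reduces uniqueness in two dimensions to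
  Levy's uniqueness theorem on the line.\<close>

lemma distr_pair_std_gaussian:
  fixes X Z :: "'a \<Rightarrow> real"
  assumes M: "prob_space M" and [measurable]: "X \<in> borel_measurable M" "Z \<in> borel_measurable M"
    and char: "\<And>s t. (\<integral>\<omega>. iexp (s * X \<omega> + t * Z \<omega>) \<partial>M) = complex_of_real (exp (- (s\<^sup>2 + t\<^sup>2) / 2))"
  shows "distr M (borel \<Otimes>\<^sub>M borel) (\<lambda>\<omega>. (X \<omega>, Z \<omega>)) = std_gaussian \<Otimes>\<^sub>M std_gaussian"
proof -
  interpret prob_space M by fact
  interpret G: real_distribution std_gaussian by (rule real_distribution_std_gaussian)
  define \<phi> where "\<phi> s = exp (- s\<^sup>2 / 2)" for s :: real
  have char': "(\<integral>\<omega>. iexp (s * X \<omega> + t * Z \<omega>) \<partial>M) = complex_of_real (\<phi> s * \<phi> t)" for s t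
    unfolding char \<phi>_def exp_add[symmetric] by (simp add: add_divide_distrib)
  have charX: "(\<integral>\<omega>. iexp (s * X \<omega>) \<partial>M) = complex_of_real (\<phi> s)" for s
    using char'[of s 0] by (simp add: \<phi>_def)
  have int[simp]: "integrable M (\<lambda>\<omega>. iexp (g \<omega>))" if [measurable]: "g \<in> borel_measurable M" for g :: "'a \<Rightarrow> real"
    by (intro integrable_const_bound[of _ 1]) auto
  have lin: "(\<integral>\<omega>. P \<omega> + (Q \<omega> + R \<omega>) / c \<partial>M) = (\<integral>\<omega>. P \<omega> \<partial>M) + ((\<integral>\<omega>. Q \<omega> \<partial>M) + (\<integral>\<omega>. R \<omega> \<partial>M)) / c"
    "(\<integral>\<omega>. P \<omega> + (Q \<omega> - R \<omega>) / c \<partial>M) = (\<integral>\<omega>. P \<omega> \<partial>M) + ((\<integral>\<omega>. Q \<omega> \<partial>M) - (\<integral>\<omega>. R \<omega> \<partial>M)) / c"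
    if "integrable M P" "integrable M Q" "integrable M R" for P Q R :: "'a \<Rightarrow> complex" and c
    using that by simp_all
  have charN: "char std_gaussian s = complex_of_real (\<phi> s)" for s
    by (simp add: char_std_gaussian \<phi>_def)
  have intr: "integrable M (\<lambda>\<omega>. g \<omega>)" if [measurable]: "g \<in> borel_measurable M" and "\<And>\<omega>. \<bar>g \<omega>\<bar> \<le> 2"
    for g :: "'a \<Rightarrow> real"
    using that by (intro integrable_const_bound[of _ 2]) auto
  have \<phi>m: "\<phi> (- t) = \<phi> t" for t by (simp add: \<phi>_def)
  have cosw: "(\<integral>\<omega>. (1 + cos (t * Z \<omega>)) *\<^sub>R iexp (s * X \<omega>) \<partial>M) = complex_of_real ((1 + \<phi> t) * \<phi> s)" for s t
  proof -
    have "(1 + cos (t * Z \<omega>)) *\<^sub>R iexp (s * X \<omega>) = iexp (s * X \<omega>)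
        + (iexp (s * X \<omega> + t * Z \<omega>) + iexp (s * X \<omega> + (- t) * Z \<omega>)) / 2" for \<omega>
    proof -
      have "iexp (s * X \<omega> + t * Z \<omega>) = iexp (s * X \<omega>) * iexp (t * Z \<omega>)"
        "iexp (s * X \<omega> + (- t) * Z \<omega>) = iexp (s * X \<omega>) * exp (- (\<i> * complex_of_real (t * Z \<omega>)))"
        unfolding exp_add[symmetric] by (simp_all add: ring_distribs)
      then have "iexp (s * X \<omega> + t * Z \<omega>) + iexp (s * X \<omega> + (- t) * Z \<omega>)
          = iexp (s * X \<omega>) * (2 * complex_of_real (cos (t * Z \<omega>)))"
        by (simp only: cos_of_real[symmetric] cos_exp_eq) (simp add: algebra_simps)
      then show ?thesis by (simp add: scaleR_conv_of_real algebra_simps)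
    qed
    note eq = this
    have "(\<integral>\<omega>. (1 + cos (t * Z \<omega>)) *\<^sub>R iexp (s * X \<omega>) \<partial>M)
        = (\<integral>\<omega>. iexp (s * X \<omega>) \<partial>M) + ((\<integral>\<omega>. iexp (s * X \<omega> + t * Z \<omega>) \<partial>M)
          + (\<integral>\<omega>. iexp (s * X \<omega> + (- t) * Z \<omega>) \<partial>M)) / 2"
      unfolding eq by (rule lin) (intro int; simp)+
    also have "\<dots> = complex_of_real ((1 + \<phi> t) * \<phi> s)"
      unfolding charX char' \<phi>m by (simp add: algebra_simps)
    finally show ?thesis .
  qed
  have sinw: "(\<integral>\<omega>. (1 + sin (t * Z \<omega>)) *\<^sub>R iexp (s * X \<omega>) \<partial>M) = complex_of_real (\<phi> s)" for s t
  proof -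
    have "(1 + sin (t * Z \<omega>)) *\<^sub>R iexp (s * X \<omega>) = iexp (s * X \<omega>)
        + (iexp (s * X \<omega> + t * Z \<omega>) - iexp (s * X \<omega> + (- t) * Z \<omega>)) / (2 * \<i>)" for \<omega>
    proof -
      have "iexp (s * X \<omega> + t * Z \<omega>) = iexp (s * X \<omega>) * iexp (t * Z \<omega>)"
        "iexp (s * X \<omega> + (- t) * Z \<omega>) = iexp (s * X \<omega>) * exp (- (\<i> * complex_of_real (t * Z \<omega>)))"
        unfolding exp_add[symmetric] by (simp_all add: ring_distribs)
      then have "iexp (s * X \<omega> + t * Z \<omega>) - iexp (s * X \<omega> + (- t) * Z \<omega>)
          = iexp (s * X \<omega>) * (2 * \<i> * complex_of_real (sin (t * Z \<omega>)))"
        by (simp only: sin_of_real[symmetric] sin_exp_eq) (simp add: field_simps)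
      then show ?thesis by (simp add: scaleR_conv_of_real algebra_simps)
    qed
    note eq = this
    have "(\<integral>\<omega>. (1 + sin (t * Z \<omega>)) *\<^sub>R iexp (s * X \<omega>) \<partial>M)
        = (\<integral>\<omega>. iexp (s * X \<omega>) \<partial>M) + ((\<integral>\<omega>. iexp (s * X \<omega> + t * Z \<omega>) \<partial>M)
          - (\<integral>\<omega>. iexp (s * X \<omega> + (- t) * Z \<omega>) \<partial>M)) / (2 * \<i>)"
      unfolding eq by (rule lin) (intro int; simp)+
    also have "\<dots> = complex_of_real (\<phi> s)"
      unfolding charX char' \<phi>m by simp
    finally show ?thesis .
  qed
  have cos_le: "1 + cos x \<le> 2" "0 \<le> 1 + cos x" for x :: real
    using cos_le_one[of x] cos_ge_minus_one[of x] by linarith+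
  have sin_le: "1 + sin x \<le> 2" "0 \<le> 1 + sin x" for x :: real
    using sin_le_one[of x] sin_ge_minus_one[of x] by linarith+
  have cos1: "(\<integral>\<omega>. 1 + cos (t * Z \<omega>) \<partial>M) = 1 + \<phi> t" for t
  proof -
    have "complex_of_real (\<integral>\<omega>. 1 + cos (t * Z \<omega>) \<partial>M)
        = (\<integral>\<omega>. complex_of_real (1 + cos (t * Z \<omega>)) \<partial>M)"
      by (rule integral_complex_of_real[symmetric])
    also have "\<dots> = (\<integral>\<omega>. (1 + cos (t * Z \<omega>)) *\<^sub>R iexp (0 * X \<omega>) \<partial>M)"
      by (simp add: scaleR_conv_of_real)
    also have "\<dots> = complex_of_real (1 + \<phi> t)" unfolding cosw by (simp add: \<phi>_def)
    finally have "complex_of_real (\<integral>\<omega>. 1 + cos (t * Z \<omega>) \<partial>M) = complex_of_real (1 + \<phi> t)" .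
    then show ?thesis by (simp only: of_real_eq_iff)
  qed
  have sin1: "(\<integral>\<omega>. 1 + sin (t * Z \<omega>) \<partial>M) = 1" for t
  proof -
    have "complex_of_real (\<integral>\<omega>. 1 + sin (t * Z \<omega>) \<partial>M)
        = (\<integral>\<omega>. complex_of_real (1 + sin (t * Z \<omega>)) \<partial>M)"
      by (rule integral_complex_of_real[symmetric])
    also have "\<dots> = (\<integral>\<omega>. (1 + sin (t * Z \<omega>)) *\<^sub>R iexp (0 * X \<omega>) \<partial>M)"
      by (simp add: scaleR_conv_of_real)
    also have "\<dots> = complex_of_real 1" unfolding sinw by (simp add: \<phi>_def)
    finally have "complex_of_real (\<integral>\<omega>. 1 + sin (t * Z \<omega>) \<partial>M) = complex_of_real 1" .
    then show ?thesis by (simp only: of_real_eq_iff)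
  qed
  have AX: "(\<integral>\<omega>. (1 + cos (t * Z \<omega>)) * indicator A (X \<omega>) \<partial>M) = (1 + \<phi> t) * measure std_gaussian A"
    "(\<integral>\<omega>. (1 + sin (t * Z \<omega>)) * indicator A (X \<omega>) \<partial>M) = measure std_gaussian A"
    if A: "A \<in> sets borel" for A t
  proof -
    have "(\<integral>\<omega>. (1 + cos (t * Z \<omega>)) * indicator A (X \<omega>) \<partial>M)
        = (\<integral>\<omega>. 1 + cos (t * Z \<omega>) \<partial>M) * measure std_gaussian A"
    proof (rule weighted_char_unique[OF M _ _ cos_le(2) cos_le(1) G.real_distribution_axioms _ A])
      show "(\<integral>\<omega>. (1 + cos (t * Z \<omega>)) *\<^sub>R iexp (s * X \<omega>) \<partial>M)
          = (\<integral>\<omega>. 1 + cos (t * Z \<omega>) \<partial>M) *\<^sub>R char std_gaussian s" for s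
        unfolding cosw cos1 charN by (simp add: scaleR_conv_of_real)
    qed simp_all
    then show "(\<integral>\<omega>. (1 + cos (t * Z \<omega>)) * indicator A (X \<omega>) \<partial>M)
        = (1 + \<phi> t) * measure std_gaussian A"
      unfolding cos1 .
    have "(\<integral>\<omega>. (1 + sin (t * Z \<omega>)) * indicator A (X \<omega>) \<partial>M)
        = (\<integral>\<omega>. 1 + sin (t * Z \<omega>) \<partial>M) * measure std_gaussian A"
    proof (rule weighted_char_unique[OF M _ _ sin_le(2) sin_le(1) G.real_distribution_axioms _ A])
      show "(\<integral>\<omega>. (1 + sin (t * Z \<omega>)) *\<^sub>R iexp (s * X \<omega>) \<partial>M)
          = (\<integral>\<omega>. 1 + sin (t * Z \<omega>) \<partial>M) *\<^sub>R char std_gaussian s" for s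
        unfolding sinw sin1 charN by simp
    qed simp_all
    then show "(\<integral>\<omega>. (1 + sin (t * Z \<omega>)) * indicator A (X \<omega>) \<partial>M) = measure std_gaussian A"
      unfolding sin1 by simp
  qed
  \<comment> \<open>The roles change: trigonometric weights in Z have led to events of X; now the
    indicator of such an event is the weight and the law of Z is identified.\<close>
  have joint: "(\<integral>\<omega>. indicator A (X \<omega>) * indicator B (Z \<omega>) \<partial>M) = measure std_gaussian A * measure std_gaussian B"
    if A[measurable]: "A \<in> sets borel" and B[measurable]: "B \<in> sets borel" for A B
  proof -
    have ind: "(\<integral>\<omega>. indicator A (X \<omega>) \<partial>M) = measure std_gaussian A"
      using AX(2)[OF A, of 0] by simp
    have intA: "integrable M (\<lambda>\<omega>. indicator A (X \<omega>) :: real)"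
      by (intro intr) (auto simp: indicator_def)
    have intc: "integrable M (\<lambda>\<omega>. cos (t * Z \<omega>) * indicator A (X \<omega>))" for t
      by (intro intr) (auto simp: indicator_def intro: order_trans[OF abs_cos_le_one])
    have ints: "integrable M (\<lambda>\<omega>. sin (t * Z \<omega>) * indicator A (X \<omega>))" for t
      by (intro intr) (auto simp: indicator_def intro: order_trans[OF abs_sin_le_one])
    \<comment> \<open>Subtracting the plain indicator undoes the shift by 1 that kept the weights
      nonnegative.\<close>
    have c: "(\<integral>\<omega>. cos (t * Z \<omega>) * indicator A (X \<omega>) \<partial>M) = \<phi> t * measure std_gaussian A" for t
    proof -
      have "(\<integral>\<omega>. (1 + cos (t * Z \<omega>)) * indicator A (X \<omega>) \<partial>M)
          = (\<integral>\<omega>. indicator A (X \<omega>) \<partial>M) + (\<integral>\<omega>. cos (t * Z \<omega>) * indicator A (X \<omega>) \<partial>M)"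
        using intA intc by (simp add: ring_distribs)
      then show ?thesis unfolding AX(1)[OF A] ind by (simp add: algebra_simps)
    qed
    have s: "(\<integral>\<omega>. sin (t * Z \<omega>) * indicator A (X \<omega>) \<partial>M) = 0" for t
    proof -
      have "(\<integral>\<omega>. (1 + sin (t * Z \<omega>)) * indicator A (X \<omega>) \<partial>M)
          = (\<integral>\<omega>. indicator A (X \<omega>) \<partial>M) + (\<integral>\<omega>. sin (t * Z \<omega>) * indicator A (X \<omega>) \<partial>M)"
        using intA ints by (simp add: ring_distribs)
      then show ?thesis unfolding AX(2)[OF A] ind by simp
    qed
    have "(\<integral>\<omega>. indicator A (X \<omega>) *\<^sub>R iexp (t * Z \<omega>) \<partial>M)
        = complex_of_real (measure std_gaussian A * \<phi> t)" for t
    proof -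
      have "indicator A (X \<omega>) *\<^sub>R iexp (t * Z \<omega>)
          = complex_of_real (cos (t * Z \<omega>) * indicator A (X \<omega>))
            + \<i> * complex_of_real (sin (t * Z \<omega>) * indicator A (X \<omega>))" for \<omega>
        unfolding scaleR_conv_of_real exp_Euler cos_of_real sin_of_real
        by (simp add: algebra_simps)
      then have "(\<integral>\<omega>. indicator A (X \<omega>) *\<^sub>R iexp (t * Z \<omega>) \<partial>M)
          = complex_of_real (\<integral>\<omega>. cos (t * Z \<omega>) * indicator A (X \<omega>) \<partial>M)
            + \<i> * complex_of_real (\<integral>\<omega>. sin (t * Z \<omega>) * indicator A (X \<omega>) \<partial>M)"
        using intc ints by (simp del: of_real_mult)
      then show ?thesis unfolding c s by (simp add: mult.commute)
    qed
    note char_A = this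
    have "(\<integral>\<omega>. indicator A (X \<omega>) * indicator B (Z \<omega>) \<partial>M)
        = (\<integral>\<omega>. indicator A (X \<omega>) \<partial>M) * measure std_gaussian B"
    proof (rule weighted_char_unique[OF M _ _ _ _ G.real_distribution_axioms _ B])
      show "(\<integral>\<omega>. indicator A (X \<omega>) *\<^sub>R iexp (t * Z \<omega>) \<partial>M)
          = (\<integral>\<omega>. indicator A (X \<omega>) \<partial>M) *\<^sub>R char std_gaussian t" for t
        unfolding char_A ind charN by (simp add: scaleR_conv_of_real)
      show "indicator A (X \<omega>) \<le> (1 :: real)" for \<omega> by (simp add: indicator_def)
    qed simp_all
    then show ?thesis unfolding ind .
  qed
  show ?thesis
  proof (rule pair_measure_eqI[symmetric])
    show "sigma_finite_measure std_gaussian" "sigma_finite_measure std_gaussian"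
      by (rule G.sigma_finite_measure_axioms)+
    show "sets (std_gaussian \<Otimes>\<^sub>M std_gaussian) = sets (distr M (borel \<Otimes>\<^sub>M borel) (\<lambda>\<omega>. (X \<omega>, Z \<omega>)))"
      by (simp cong: sets_pair_measure_cong)
    fix A B assume "A \<in> sets std_gaussian" "B \<in> sets std_gaussian"
    then have [measurable]: "A \<in> sets borel" "B \<in> sets borel" by auto
    have "emeasure (distr M (borel \<Otimes>\<^sub>M borel) (\<lambda>\<omega>. (X \<omega>, Z \<omega>))) (A \<times> B)
        = emeasure M {\<omega> \<in> space M. X \<omega> \<in> A \<and> Z \<omega> \<in> B}"
      by (subst emeasure_distr) (auto intro!: arg_cong[where f = "emeasure M"])
    also have "\<dots> = ennreal (\<integral>\<omega>. indicat_real {\<omega> \<in> space M. X \<omega> \<in> A \<and> Z \<omega> \<in> B} \<omega> \<partial>M)"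
      by (simp add: emeasure_eq_measure)
    also have "(\<integral>\<omega>. indicat_real {\<omega> \<in> space M. X \<omega> \<in> A \<and> Z \<omega> \<in> B} \<omega> \<partial>M)
        = (\<integral>\<omega>. indicat_real A (X \<omega>) * indicat_real B (Z \<omega>) \<partial>M)"
      by (intro Bochner_Integration.integral_cong) (auto simp: indicator_def)
    also have "\<dots> = measure std_gaussian A * measure std_gaussian B" by (rule joint) auto
    finally show "emeasure std_gaussian A * emeasure std_gaussian B
        = emeasure (distr M (borel \<Otimes>\<^sub>M borel) (\<lambda>\<omega>. (X \<omega>, Z \<omega>))) (A \<times> B)"
      by (simp add: G.emeasure_eq_measure ennreal_mult)
  qed
qed

section \<open>One-dimensional Gaussian laws, point masses included\<close>

lemma gaussian_rv_integrable:
  assumes M: "prob_space M" and V: "gaussian_rv M V"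
  shows "integrable M V" "integrable M (\<lambda>\<omega>. (V \<omega>)\<^sup>2)"
proof -
  interpret prob_space M by fact
  have [measurable]: "V \<in> borel_measurable M" using V by (simp add: gaussian_rv_def)
  have "\<exists>\<mu>. integrable M (\<lambda>\<omega>. V \<omega> - \<mu>) \<and> integrable M (\<lambda>\<omega>. (V \<omega> - \<mu>)\<^sup>2)"
    using V unfolding gaussian_rv_def
  proof (elim conjE exE disjE)
    fix \<mu> assume "AE \<omega> in M. V \<omega> = \<mu>"
    then have "integrable M (\<lambda>\<omega>. V \<omega> - \<mu>)" "integrable M (\<lambda>\<omega>. (V \<omega> - \<mu>)\<^sup>2)"
      by (auto intro!: integrable_const_bound[of _ 0])
    then show ?thesis by blast
  next
    fix \<mu> \<sigma> assume \<sigma>: "0 < \<sigma>" and D: "distributed M lborel V (\<lambda>x. ennreal (normal_density \<mu> \<sigma> x))"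
    have "integrable M (\<lambda>\<omega>. (V \<omega> - \<mu>) ^ k)" for k
      using integrable_normal_moment[OF \<sigma>, of \<mu> k] distributed_integrable[OF D, of "\<lambda>x. (x - \<mu>) ^ k"]
      by simp
    from this[of 1] this[of 2] show ?thesis by auto
  qed
  then obtain \<mu> where i: "integrable M (\<lambda>\<omega>. V \<omega> - \<mu>)" "integrable M (\<lambda>\<omega>. (V \<omega> - \<mu>)\<^sup>2)" by blast
  have "integrable M (\<lambda>\<omega>. (V \<omega> - \<mu>) + \<mu>)" using i(1) by (intro Bochner_Integration.integrable_add) auto
  then show "integrable M V" by simp
  have "integrable M (\<lambda>\<omega>. (V \<omega> - \<mu>)\<^sup>2 + (2 * \<mu> * (V \<omega> - \<mu>) + \<mu>\<^sup>2))"
    using i by (intro Bochner_Integration.integrable_add) auto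
  then show "integrable M (\<lambda>\<omega>. (V \<omega>)\<^sup>2)"
    by (simp add: power2_eq_square algebra_simps)
qed

lemma gaussian_rv_standardize:
  assumes M: "prob_space M" and V: "gaussian_rv M V" and mean: "(\<integral>\<omega>. V \<omega> \<partial>M) = 0"
    and v: "(\<integral>\<omega>. (V \<omega>)\<^sup>2 \<partial>M) = s\<^sup>2" "0 < s"
  shows "distr M borel (\<lambda>\<omega>. V \<omega> / s) = std_gaussian"
proof -
  interpret prob_space M by fact
  have [measurable]: "V \<in> borel_measurable M" using V by (simp add: gaussian_rv_def)
  show ?thesis using V unfolding gaussian_rv_def
  proof (elim conjE exE disjE)
    fix \<mu> assume c: "AE \<omega> in M. V \<omega> = \<mu>"
    have "(\<integral>\<omega>. V \<omega> \<partial>M) = (\<integral>\<omega>. \<mu> \<partial>M)" using c by (intro integral_cong_AE) auto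
    \<comment> \<open>A centred point mass sits at 0 and has variance zero, against
      \<open>0 < s\<close>.\<close>
    then have "\<mu> = 0" using mean by (simp add: prob_space)
    then have "(\<integral>\<omega>. (V \<omega>)\<^sup>2 \<partial>M) = (\<integral>\<omega>. 0 \<partial>M)" using c by (intro integral_cong_AE) auto
    then show ?thesis using v by simp
  next
    fix \<mu> \<sigma> assume \<sigma>: "0 < \<sigma>" and D: "distributed M lborel V (\<lambda>x. ennreal (normal_density \<mu> \<sigma> x))"
    have \<mu>: "\<mu> = 0" using normal_distributed_expectation[OF \<sigma> D] mean by simp
    have "\<sigma>\<^sup>2 = s\<^sup>2" using normal_distributed_variance[OF \<sigma> D] mean v by simp
    then have s: "\<sigma> = s" using \<sigma> v by simp
    have "distributed M lborel (\<lambda>\<omega>. (V \<omega> - \<mu>) / \<sigma>) (\<lambda>x. ennreal (std_normal_density x))"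
      using normal_standard_normal_convert[OF \<sigma>, of V \<mu>] D by simp
    then have "distr M lborel (\<lambda>\<omega>. V \<omega> / s) = std_gaussian"
      unfolding \<mu> s std_gaussian_def by (simp add: distributed_def)
    moreover have "distr M lborel (\<lambda>\<omega>. V \<omega> / s) = distr M borel (\<lambda>\<omega>. V \<omega> / s)"
      by (rule distr_cong) simp_all
    ultimately show ?thesis by simp
  qed
qed

text \<open>Linear combinations of coordinates may degenerate, so variance zero is included: such a
  centred variable vanishes almost everywhere. Otherwise scaling reduces to the standard
  characteristic function.\<close>

lemma gaussian_rv_char:
  assumes M: "prob_space M" and V: "gaussian_rv M V" and mean: "(\<integral>\<omega>. V \<omega> \<partial>M) = 0"
  shows "(\<integral>\<omega>. iexp (V \<omega>) \<partial>M) = complex_of_real (exp (- (\<integral>\<omega>. (V \<omega>)\<^sup>2 \<partial>M) / 2))"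
proof -
  interpret prob_space M by fact
  have [measurable]: "V \<in> borel_measurable M" using V by (simp add: gaussian_rv_def)
  define v where "v = (\<integral>\<omega>. (V \<omega>)\<^sup>2 \<partial>M)"
  have v0: "0 \<le> v" by (simp add: v_def)
  show ?thesis
  proof (cases "v = 0")
    case True
    then have "AE \<omega> in M. (V \<omega>)\<^sup>2 = 0"
      using integral_nonneg_eq_0_iff_AE[OF gaussian_rv_integrable(2)[OF M V]] by (simp add: v_def)
    then have "(\<integral>\<omega>. iexp (V \<omega>) \<partial>M) = (\<integral>\<omega>. 1 \<partial>M)" by (intro integral_cong_AE) auto
    then show ?thesis using True by (simp add: v_def[symmetric] prob_space)
  next
    case False
    define s where "s = sqrt v"
    have s: "0 < s" "v = s\<^sup>2" using False v0 by (auto simp: s_def)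
    have d: "distr M borel (\<lambda>\<omega>. V \<omega> / s) = std_gaussian"
      using gaussian_rv_standardize[OF M V mean] s by (simp add: v_def)
    have "(\<integral>\<omega>. iexp (V \<omega>) \<partial>M) = (\<integral>x. iexp (s * x) \<partial>distr M borel (\<lambda>\<omega>. V \<omega> / s))"
      using s by (subst integral_distr) auto
    also have "\<dots> = char std_gaussian s" unfolding d char_def ..
    finally show ?thesis
      by (simp add: char_std_gaussian v_def[symmetric] s)
  qed
qed

text \<open>The dimension of \<open>u \<omega>\<close> is known only for points of the space, so
  identities between linear forms of \<open>u\<close> hold only there.\<close>

lemma gaussian_rv_cong:
  assumes "\<And>\<omega>. \<omega> \<in> space M \<Longrightarrow> X \<omega> = Y \<omega>"
  shows "gaussian_rv M X = gaussian_rv M Y"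
proof -
  have "X \<in> borel_measurable M \<longleftrightarrow> Y \<in> borel_measurable M"
    by (rule measurable_cong) (rule assms)
  moreover have "(AE \<omega> in M. X \<omega> = \<mu>) \<longleftrightarrow> (AE \<omega> in M. Y \<omega> = \<mu>)" for \<mu>
    by (rule AE_cong) (simp add: assms)
  moreover have "distributed M lborel X g = distributed M lborel Y g" for g
  proof -
    have "distr M lborel X = distr M lborel Y" by (rule distr_cong) (simp_all add: assms)
    moreover have "X \<in> measurable M lborel \<longleftrightarrow> Y \<in> measurable M lborel"
      by (rule measurable_cong) (rule assms)
    ultimately show ?thesis unfolding distributed_def by simp
  qed
  ultimately show ?thesis by (simp add: gaussian_rv_def)
qed

lemma gaussian_vector_combination:
  assumes u: "gaussian_vector M n u" and i: "i < n" and j: "j < n"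
  shows "gaussian_rv M (\<lambda>\<omega>. \<alpha> * u \<omega> $ i + \<beta> * u \<omega> $ j)"
proof -
  let ?a = "\<alpha> \<cdot>\<^sub>v unit_vec n i + \<beta> \<cdot>\<^sub>v unit_vec n j"
  have "gaussian_rv M (\<lambda>\<omega>. ?a \<bullet> u \<omega>)"
    using u by (simp add: gaussian_vector_def)
  also have "gaussian_rv M (\<lambda>\<omega>. ?a \<bullet> u \<omega>) = gaussian_rv M (\<lambda>\<omega>. \<alpha> * u \<omega> $ i + \<beta> * u \<omega> $ j)"
  proof (rule gaussian_rv_cong)
    fix \<omega> assume "\<omega> \<in> space M"
    then have c: "u \<omega> \<in> carrier_vec n" using u by (auto simp: gaussian_vector_def)
    show "?a \<bullet> u \<omega> = \<alpha> * u \<omega> $ i + \<beta> * u \<omega> $ j"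
      using c i j by (simp add: add_scalar_prod_distrib[of _ n] scalar_prod_left_unit)
  qed
  finally show ?thesis .
qed

lemma gaussian_vector_component:
  assumes "gaussian_vector M n u" "i < n"
  shows "gaussian_rv M (\<lambda>\<omega>. u \<omega> $ i)"
  using gaussian_vector_combination[OF assms assms(2), of 1 0] by simp

section \<open>Decorrelating two coordinates of a Gaussian vector\<close>

context
  fixes M :: "'a measure" and n :: nat and u :: "'a \<Rightarrow> real vec" and i j :: nat
    and a b \<rho> :: real
  assumes u: "gaussian_vector M n u" and i: "i < n" and j: "j < n"
    and mean: "(\<integral>\<omega>. u \<omega> $ i \<partial>M) = 0" "(\<integral>\<omega>. u \<omega> $ j \<partial>M) = 0"
    and a: "0 < a" "(\<integral>\<omega>. (u \<omega> $ i)\<^sup>2 \<partial>M) = a\<^sup>2"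
    and b: "0 < b" "(\<integral>\<omega>. (u \<omega> $ j)\<^sup>2 \<partial>M) = b\<^sup>2"
    and \<rho>: "\<bar>\<rho>\<bar> < 1" "(\<integral>\<omega>. u \<omega> $ i * u \<omega> $ j \<partial>M) = a * b * \<rho>"
begin

text \<open>Gram-Schmidt: the second component is the residual of the normalised j-th coordinate
  after regression on the i-th, rescaled to variance one. Every combination of the two components
  with coefficients s and t is a linear form in \<open>u\<close>, hence Gaussian, and its variance
  comes out as s^2 + t^2.\<close>

lemma gaussian_vector_pair_distr:
  "distr M (borel \<Otimes>\<^sub>M borel)
      (\<lambda>\<omega>. (u \<omega> $ i / a, (u \<omega> $ j / b - \<rho> * (u \<omega> $ i / a)) / sqrt (1 - \<rho>\<^sup>2)))
    = std_gaussian \<Otimes>\<^sub>M std_gaussian"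
proof (rule distr_pair_std_gaussian)
  show M: "prob_space M" using u by (simp add: gaussian_vector_def)
  then interpret prob_space M .
  note rv = gaussian_vector_component[OF u i] gaussian_vector_component[OF u j]
  have [measurable]: "(\<lambda>\<omega>. u \<omega> $ i) \<in> borel_measurable M" "(\<lambda>\<omega>. u \<omega> $ j) \<in> borel_measurable M"
    using rv by (simp_all add: gaussian_rv_def)
  note int = gaussian_rv_integrable[OF M rv(1)] gaussian_rv_integrable[OF M rv(2)]
  have intp: "integrable M (\<lambda>\<omega>. u \<omega> $ i * u \<omega> $ j)"
  proof (rule Bochner_Integration.integrable_bound)
    show "integrable M (\<lambda>\<omega>. (u \<omega> $ i)\<^sup>2 + (u \<omega> $ j)\<^sup>2)"
      using int by (intro Bochner_Integration.integrable_add)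
    have "\<bar>x * y\<bar> \<le> x\<^sup>2 + y\<^sup>2" for x y :: real
    proof -
      have "2 * (\<bar>x\<bar> * \<bar>y\<bar>) \<le> x\<^sup>2 + y\<^sup>2"
        using zero_le_power2[of "\<bar>x\<bar> - \<bar>y\<bar>"] by (simp add: power2_diff)
      moreover have "0 \<le> \<bar>x\<bar> * \<bar>y\<bar>" by simp
      ultimately show ?thesis unfolding abs_mult by linarith
    qed
    then show "AE \<omega> in M. norm (u \<omega> $ i * u \<omega> $ j) \<le> norm ((u \<omega> $ i)\<^sup>2 + (u \<omega> $ j)\<^sup>2)" by simp
  qed simp
  define k where "k = sqrt (1 - \<rho>\<^sup>2)"
  have k2: "k\<^sup>2 = 1 - \<rho>\<^sup>2" "0 < k" using \<rho> by (auto simp: k_def abs_square_less_1 less_imp_le)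
  show "(\<lambda>\<omega>. u \<omega> $ i / a) \<in> borel_measurable M"
    "(\<lambda>\<omega>. (u \<omega> $ j / b - \<rho> * (u \<omega> $ i / a)) / sqrt (1 - \<rho>\<^sup>2)) \<in> borel_measurable M" by simp_all
  fix s t :: real
  \<comment> \<open>The combination of the two components with coefficients s and t, rewritten in
    the original coordinates.\<close>
  define \<alpha> where "\<alpha> = (s - t * \<rho> / k) / a"
  define \<beta> where "\<beta> = t / (k * b)"
  let ?V = "\<lambda>\<omega>. \<alpha> * u \<omega> $ i + \<beta> * u \<omega> $ j"
  have V: "gaussian_rv M ?V" by (rule gaussian_vector_combination[OF u i j])
  have V0: "(\<integral>\<omega>. ?V \<omega> \<partial>M) = 0" using int mean by simp
  have sq: "(?V \<omega>)\<^sup>2 = \<alpha>\<^sup>2 * (u \<omega> $ i)\<^sup>2 + (2 * \<alpha> * \<beta>) * (u \<omega> $ i * u \<omega> $ j) + \<beta>\<^sup>2 * (u \<omega> $ j)\<^sup>2" for \<omega>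
    by (simp add: power2_eq_square algebra_simps)
  have "(\<integral>\<omega>. (?V \<omega>)\<^sup>2 \<partial>M) = \<alpha>\<^sup>2 * a\<^sup>2 + (2 * \<alpha> * \<beta>) * (a * b * \<rho>) + \<beta>\<^sup>2 * b\<^sup>2"
    unfolding sq using int intp a b \<rho> by simp
  also have "\<dots> = (\<alpha> * a)\<^sup>2 + 2 * (\<alpha> * a) * (\<beta> * b) * \<rho> + (\<beta> * b)\<^sup>2"
    by (simp add: power2_eq_square)
  also have "\<alpha> * a = s - t * \<rho> / k" using a by (simp add: \<alpha>_def)
  also have "\<beta> * b = t / k" using b by (simp add: \<beta>_def)
  also have "(s - t * \<rho> / k)\<^sup>2 + 2 * (s - t * \<rho> / k) * (t / k) * \<rho> + (t / k)\<^sup>2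
      = s\<^sup>2 + t\<^sup>2 * ((1 - \<rho>\<^sup>2) / k\<^sup>2)"
    using k2(2) by (simp add: power2_eq_square field_simps)
  also have "\<dots> = s\<^sup>2 + t\<^sup>2" using k2(2) by (simp flip: k2(1))
  finally have V2: "(\<integral>\<omega>. (?V \<omega>)\<^sup>2 \<partial>M) = s\<^sup>2 + t\<^sup>2" .
  have "s * (u \<omega> $ i / a) + t * ((u \<omega> $ j / b - \<rho> * (u \<omega> $ i / a)) / sqrt (1 - \<rho>\<^sup>2)) = ?V \<omega>" for \<omega>
    unfolding k_def[symmetric] using a b k2(2) by (simp add: \<alpha>_def \<beta>_def field_simps)
  then show "(\<integral>\<omega>. iexp (s * (u \<omega> $ i / a) + t * ((u \<omega> $ j / b - \<rho> * (u \<omega> $ i / a)) / sqrt (1 - \<rho>\<^sup>2))) \<partial>M)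
      = complex_of_real (exp (- (s\<^sup>2 + t\<^sup>2) / 2))"
    using gaussian_rv_char[OF M V V0] unfolding V2 by simp
qed

end

section \<open>Gaussian moments\<close>

lemma sets_std_gaussian [measurable_cong, simp]: "sets std_gaussian = sets borel"
  by (simp add: std_gaussian_def)

lemma space_std_gaussian [simp]: "space std_gaussian = UNIV"
  by (simp add: std_gaussian_def)

interpretation std_gaussian: prob_space std_gaussian
  using real_distribution_std_gaussian by (rule real_distribution.axioms)

lemma integral_std_gaussian:
  fixes g :: "real \<Rightarrow> real"
  assumes "g \<in> borel_measurable borel"
  shows "(\<integral>x. g x \<partial>std_gaussian) = (\<integral>x. std_normal_density x * g x \<partial>lborel)"
    and "integrable std_gaussian g \<longleftrightarrow> integrable lborel (\<lambda>x. std_normal_density x * g x)"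
  unfolding std_gaussian_def using assms
  by (simp_all add: integral_density integrable_density)

text \<open>Multiplication by exp(x^2/4) turns the standard density into sqrt 2 times the normal
  density of variance 2. This function is the common majorant of all later integrands.\<close>

lemma exp_quarter_std_gaussian:
  shows "integrable std_gaussian (\<lambda>x. exp (x\<^sup>2 / 4))"
    and "(\<integral>x. exp (x\<^sup>2 / 4) \<partial>std_gaussian) = sqrt 2"
proof -
  have eq: "std_normal_density x * exp (x\<^sup>2 / 4) = sqrt 2 * normal_density 0 (sqrt 2) x" for x
  proof -
    have "exp (- x\<^sup>2 / 2) * exp (x\<^sup>2 / 4) = exp (- x\<^sup>2 / 4)" by (simp add: exp_add[symmetric])
    then show ?thesis by (simp add: normal_density_def real_sqrt_mult field_simps)
  qed
  show "integrable std_gaussian (\<lambda>x. exp (x\<^sup>2 / 4))"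
    and "(\<integral>x. exp (x\<^sup>2 / 4) \<partial>std_gaussian) = sqrt 2"
    by (simp_all add: integral_std_gaussian eq)
qed

lemma
  fixes g :: "real \<Rightarrow> real"
  assumes g [measurable]: "g \<in> borel_measurable borel" and le: "\<And>x. \<bar>g x\<bar> \<le> K * exp (x\<^sup>2 / 4)"
  shows integrable_std_gaussian_bound: "integrable std_gaussian g"
    and integral_std_gaussian_bound: "\<bar>\<integral>x. g x \<partial>std_gaussian\<bar> \<le> 2 * K"
proof -
  have K: "0 \<le> K" using le[of 0] by simp
  have i: "integrable std_gaussian (\<lambda>x. K * exp (x\<^sup>2 / 4))"
    using exp_quarter_std_gaussian(1) by (rule integrable_mult_right)
  show g': "integrable std_gaussian g"
    by (rule Bochner_Integration.integrable_bound[OF i])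
      (auto intro!: AE_I2 order_trans[OF le] simp: K)
  have "(\<integral>x. \<bar>g x\<bar> \<partial>std_gaussian) \<le> (\<integral>x. K * exp (x\<^sup>2 / 4) \<partial>std_gaussian)"
    using g' i le by (intro integral_mono) auto
  also have "\<dots> = K * sqrt 2" by (simp add: exp_quarter_std_gaussian)
  also have "\<dots> \<le> K * 2" using K real_sqrt_le_mono[of 2 4] by (intro mult_left_mono) auto
  finally have a: "(\<integral>x. \<bar>g x\<bar> \<partial>std_gaussian) \<le> 2 * K" by simp
  have "\<bar>\<integral>x. g x \<partial>std_gaussian\<bar> \<le> (\<integral>x. \<bar>g x\<bar> \<partial>std_gaussian)" by (rule integral_abs_bound)
  then show "\<bar>\<integral>x. g x \<partial>std_gaussian\<bar> \<le> 2 * K" using a by (rule order_trans)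
qed

text \<open>The affine map passes from the argument of g to the kernel k, so its parameters can be
  expanded although g is merely measurable.\<close>

lemma integral_std_gaussian_affine:
  fixes g k :: "real \<Rightarrow> real"
  assumes s: "0 < s" and [measurable]: "g \<in> borel_measurable borel" "k \<in> borel_measurable borel"
    and k: "\<And>y. normal_density \<mu> s y = k y * std_normal_density y"
  shows "(\<integral>x. g (\<mu> + s * x) \<partial>std_gaussian) = (\<integral>y. k y * g y \<partial>std_gaussian)"
proof -
  have "distributed std_gaussian lborel (\<lambda>x. x) (\<lambda>x. ennreal (std_normal_density x))"
    unfolding distributed_def by (auto simp: std_gaussian_def intro!: distr_id2)
  from std_gaussian.normal_density_affine[OF this, of s \<mu>] s
  have D: "distributed std_gaussian lborel (\<lambda>x. \<mu> + s * x) (\<lambda>x. ennreal (normal_density \<mu> s x))"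
    by simp
  have "(\<integral>x. g (\<mu> + s * x) \<partial>std_gaussian) = (\<integral>y. normal_density \<mu> s y * g y \<partial>lborel)"
    using distributed_integral[OF D, of g] by simp
  also have "\<dots> = (\<integral>y. std_normal_density y * (k y * g y) \<partial>lborel)"
    by (simp add: k mult_ac)
  finally show ?thesis by (simp add: integral_std_gaussian)
qed

text \<open>All follow from 1 + x^2/16 \<le> exp(x^2/16). They assign the Hermite polynomials of
  degree 0, 1 and 2 the same growth rate as Lipschitz functions.\<close>

lemma exp_sixteenth_bounds:
  fixes x :: real
  shows "1 \<le> exp (x\<^sup>2 / 16)" "\<bar>x\<bar> \<le> 8 * exp (x\<^sup>2 / 16)" "\<bar>x\<^sup>2 - 1\<bar> \<le> 16 * exp (x\<^sup>2 / 16)"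
proof -
  have e: "1 + x\<^sup>2 / 16 \<le> exp (x\<^sup>2 / 16)" by (rule exp_ge_add_one_self)
  have x2: "0 \<le> x\<^sup>2" by simp
  show "1 \<le> exp (x\<^sup>2 / 16)" by simp
  have "2 * \<bar>x\<bar> \<le> 1 + x\<^sup>2" using zero_le_power2[of "\<bar>x\<bar> - 1"] by (simp add: power2_diff)
  then show "\<bar>x\<bar> \<le> 8 * exp (x\<^sup>2 / 16)" using e x2 by linarith
  show "\<bar>x\<^sup>2 - 1\<bar> \<le> 16 * exp (x\<^sup>2 / 16)" using e x2 unfolding abs_le_iff by linarith
qed

lemma exp_sixteenth_mult:
  fixes x :: real
  shows "exp (x\<^sup>2 / 16) * exp (x\<^sup>2 / 16) \<le> exp (x\<^sup>2 / 4)"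
    and "exp (x\<^sup>2 / 16) * exp (x\<^sup>2 / 8) \<le> exp (x\<^sup>2 / 4)"
    and "exp (x\<^sup>2 / 16) \<le> exp (x\<^sup>2 / 4)"
  by (simp_all add: exp_add[symmetric])

lemma mult_exp_bound:
  fixes a b :: real
  assumes "\<bar>a\<bar> \<le> K * exp (x\<^sup>2 / 16)" "\<bar>b\<bar> \<le> L * exp (x\<^sup>2 / 16)"
  shows "\<bar>a * b\<bar> \<le> K * L * exp (x\<^sup>2 / 4)"
proof -
  have "0 \<le> K * exp (x\<^sup>2 / 16)" "0 \<le> L * exp (x\<^sup>2 / 16)" using assms by linarith+
  then have KL: "0 \<le> K" "0 \<le> L" by (simp_all add: zero_le_mult_iff)
  have "\<bar>a * b\<bar> \<le> (K * exp (x\<^sup>2 / 16)) * (L * exp (x\<^sup>2 / 16))"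
    unfolding abs_mult using assms KL by (intro mult_mono) auto
  also have "\<dots> = K * L * (exp (x\<^sup>2 / 16) * exp (x\<^sup>2 / 16))" by simp
  also have "\<dots> \<le> K * L * exp (x\<^sup>2 / 4)"
    using KL by (intro mult_left_mono exp_sixteenth_mult) auto
  finally show ?thesis .
qed

lemma mult_exp_bound_eighth:
  fixes a b :: real
  assumes "\<bar>a\<bar> \<le> K * exp (x\<^sup>2 / 16)" "\<bar>b\<bar> \<le> L * exp (x\<^sup>2 / 8)"
  shows "\<bar>a * b\<bar> \<le> K * L * exp (x\<^sup>2 / 4)"
proof -
  have "0 \<le> K * exp (x\<^sup>2 / 16)" "0 \<le> L * exp (x\<^sup>2 / 8)" using assms by linarith+
  then have KL: "0 \<le> K" "0 \<le> L" by (simp_all add: zero_le_mult_iff)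
  have "\<bar>a * b\<bar> \<le> (K * exp (x\<^sup>2 / 16)) * (L * exp (x\<^sup>2 / 8))"
    unfolding abs_mult using assms KL by (intro mult_mono) auto
  also have "\<dots> = K * L * (exp (x\<^sup>2 / 16) * exp (x\<^sup>2 / 8))" by simp
  also have "\<dots> \<le> K * L * exp (x\<^sup>2 / 4)"
    using KL by (intro mult_left_mono exp_sixteenth_mult) auto
  finally show ?thesis .
qed

text \<open>An unnormalised Hermite coefficient: for p = h_r it is sqrt(r!) times \<zeta>_r(g). With
  p as a parameter, one Lipschitz estimate in the scale serves degrees 1 and 2 alike.\<close>

definition gauss_moment :: "(real \<Rightarrow> real) \<Rightarrow> (real \<Rightarrow> real) \<Rightarrow> real" where
  "gauss_moment p g = (\<integral>x. g x * p x \<partial>std_gaussian)"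

abbreviation (input) He0 :: "real \<Rightarrow> real" where "He0 \<equiv> \<lambda>_. 1"
abbreviation (input) He1 :: "real \<Rightarrow> real" where "He1 \<equiv> \<lambda>x. x"
abbreviation (input) He2 :: "real \<Rightarrow> real" where "He2 \<equiv> \<lambda>x. x\<^sup>2 - 1"

lemma integrable_gauss_moment:
  assumes [measurable]: "g \<in> borel_measurable borel" and K: "\<And>x. \<bar>g x\<bar> \<le> K * exp (x\<^sup>2 / 16)"
  shows "integrable std_gaussian (\<lambda>x. g x)"
    "integrable std_gaussian (\<lambda>x. g x * x)" "integrable std_gaussian (\<lambda>x. g x * (x\<^sup>2 - 1))"
proof -
  have "\<bar>g x * 1\<bar> \<le> K * 1 * exp (x\<^sup>2 / 4)" for x
    using K exp_sixteenth_bounds(1)[of x] by (intro mult_exp_bound) auto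
  then show "integrable std_gaussian (\<lambda>x. g x)"
    using integrable_std_gaussian_bound[of "\<lambda>x. g x" K] by simp
  show "integrable std_gaussian (\<lambda>x. g x * x)"
    by (rule integrable_std_gaussian_bound[of _ "K * 8"], simp)
      (intro mult_exp_bound K exp_sixteenth_bounds)
  show "integrable std_gaussian (\<lambda>x. g x * (x\<^sup>2 - 1))"
    by (rule integrable_std_gaussian_bound[of _ "K * 16"], simp)
      (intro mult_exp_bound K exp_sixteenth_bounds)
qed

text \<open>Move the scale into \<open>scale_kernel\<close> and integrate its expansion; 6000 is
  3000 times the bound 2 for the Gaussian integral of exp(x^2/4).\<close>

lemma gauss_moment_scale_expansion:
  assumes g [measurable]: "g \<in> borel_measurable borel" and K: "\<And>x. \<bar>g x\<bar> \<le> K * exp (x\<^sup>2 / 16)"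
    and d: "\<bar>d\<bar> \<le> 1 / 32"
  shows "\<bar>(\<integral>x. g (sqrt (1 + d) * x) \<partial>std_gaussian)
      - (gauss_moment He0 g + d / 2 * gauss_moment He2 g)\<bar> \<le> 6000 * K * d\<^sup>2"
proof -
  have d': "-1 < d" using d by auto
  define R where "R x = scale_kernel d x - (1 + d / 2 * (x\<^sup>2 - 1))" for x
  have [measurable]: "scale_kernel d \<in> borel_measurable borel" by (simp add: scale_kernel_def[abs_def])
  have [measurable]: "R \<in> borel_measurable borel" by (simp add: R_def[abs_def])
  have R: "\<bar>R x\<bar> \<le> 3000 * d\<^sup>2 * exp (x\<^sup>2 / 8)" for x
    unfolding R_def by (rule scale_kernel_expansion[OF d])
  have gR: "\<bar>g x * R x\<bar> \<le> K * (3000 * d\<^sup>2) * exp (x\<^sup>2 / 4)" for x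
    by (intro mult_exp_bound_eighth K R)
  note int = integrable_gauss_moment[OF g K] integrable_std_gaussian_bound[OF _ gR, simplified]
  have "(\<integral>x. g (sqrt (1 + d) * x) \<partial>std_gaussian) = (\<integral>y. scale_kernel d y * g y \<partial>std_gaussian)"
    using integral_std_gaussian_affine[of "sqrt (1 + d)" g "scale_kernel d" 0]
      normal_density_scale_kernel[OF d'] d' by simp
  also have "\<dots> = (\<integral>y. g y + d / 2 * (g y * (y\<^sup>2 - 1)) + g y * R y \<partial>std_gaussian)"
    by (simp add: R_def algebra_simps)
  also have "\<dots> = gauss_moment He0 g + d / 2 * gauss_moment He2 g + (\<integral>y. g y * R y \<partial>std_gaussian)"
    using int by (simp add: gauss_moment_def)
  finally show ?thesis
    using integral_std_gaussian_bound[OF _ gR] by simp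
qed

text \<open>The inner integral over z is an integral of h against the Mehler kernel, whose expansion
  separates the variables; the outer one then produces products of moments. Each integration
  contributes a factor 2 to 1200000 = 4 * 300000.\<close>

lemma gauss_moment_mehler_expansion:
  assumes g [measurable]: "g \<in> borel_measurable borel" and K: "\<And>x. \<bar>g x\<bar> \<le> K * exp (x\<^sup>2 / 16)"
    and h [measurable]: "h \<in> borel_measurable borel" and L: "\<And>x. \<bar>h x\<bar> \<le> L * exp (x\<^sup>2 / 16)"
    and \<rho>: "\<bar>\<rho>\<bar> \<le> 1 / 16"
  shows "\<bar>(\<integral>(x, z). g x * h (\<rho> * x + sqrt (1 - \<rho>\<^sup>2) * z) \<partial>(std_gaussian \<Otimes>\<^sub>M std_gaussian))
      - (gauss_moment He0 g * gauss_moment He0 h + \<rho> * (gauss_moment He1 g * gauss_moment He1 h)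
        + \<rho>\<^sup>2 / 2 * (gauss_moment He2 g * gauss_moment He2 h))\<bar>
    \<le> 1200000 * K * L * \<bar>\<rho>\<bar> ^ 3"
proof -
  interpret P: pair_sigma_finite std_gaussian std_gaussian ..
  define k where "k = sqrt (1 - \<rho>\<^sup>2)"
  have \<rho>1: "\<bar>\<rho>\<bar> < 1" using \<rho> by simp
  have k: "0 < k" "k\<^sup>2 = 1 - \<rho>\<^sup>2" using \<rho>1 by (auto simp: k_def abs_square_less_1 less_imp_le)
  have L0: "0 \<le> L" using L[of 0] by simp
  have hk: "\<bar>h (\<rho> * x + k * z)\<bar> \<le> L * exp (x\<^sup>2 / 16) * exp (z\<^sup>2 / 16)" for x z
  proof -
    \<comment> \<open>A rotation of the plane preserves x^2 + z^2, so the growth of h splits into a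
      factor in x and one in z.\<close>
    have "(\<rho> * x + k * z)\<^sup>2 + (k * x - \<rho> * z)\<^sup>2 = (\<rho>\<^sup>2 + k\<^sup>2) * (x\<^sup>2 + z\<^sup>2)"
      by (simp add: power2_eq_square algebra_simps)
    then have "(\<rho> * x + k * z)\<^sup>2 + (k * x - \<rho> * z)\<^sup>2 = x\<^sup>2 + z\<^sup>2" by (simp add: k)
    then have "(\<rho> * x + k * z)\<^sup>2 \<le> x\<^sup>2 + z\<^sup>2"
      using zero_le_power2[of "k * x - \<rho> * z"] by linarith
    then have "exp ((\<rho> * x + k * z)\<^sup>2 / 16) \<le> exp (x\<^sup>2 / 16) * exp (z\<^sup>2 / 16)"
      by (simp add: exp_add[symmetric] add_divide_distrib[symmetric] divide_right_mono)
    then have "L * exp ((\<rho> * x + k * z)\<^sup>2 / 16) \<le> L * (exp (x\<^sup>2 / 16) * exp (z\<^sup>2 / 16))"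
      using L0 by (rule mult_left_mono)
    then show ?thesis using L[of "\<rho> * x + k * z"] by (simp add: mult.assoc)
  qed
  have inner_bound: "\<bar>g x * h (\<rho> * x + k * z)\<bar>
      \<le> (\<bar>g x\<bar> * (L * exp (x\<^sup>2 / 16))) * exp (z\<^sup>2 / 4)" for x z
  proof -
    have "\<bar>g x * h (\<rho> * x + k * z)\<bar> \<le> \<bar>g x\<bar> * (L * exp (x\<^sup>2 / 16) * exp (z\<^sup>2 / 16))"
      unfolding abs_mult by (intro mult_left_mono hk) simp
    also have "\<dots> = (\<bar>g x\<bar> * (L * exp (x\<^sup>2 / 16))) * exp (z\<^sup>2 / 16)" by simp
    also have "\<dots> \<le> (\<bar>g x\<bar> * (L * exp (x\<^sup>2 / 16))) * exp (z\<^sup>2 / 4)"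
      using L0 by (intro mult_left_mono exp_sixteenth_mult) auto
    finally show ?thesis .
  qed
  have outer_bound: "\<bar>\<integral>z. \<bar>g x * h (\<rho> * x + k * z)\<bar> \<partial>std_gaussian\<bar> \<le> (2 * (K * L)) * exp (x\<^sup>2 / 4)" for x
  proof -
    have "\<bar>\<integral>z. \<bar>g x * h (\<rho> * x + k * z)\<bar> \<partial>std_gaussian\<bar> \<le> 2 * (\<bar>g x\<bar> * (L * exp (x\<^sup>2 / 16)))"
      using inner_bound by (intro integral_std_gaussian_bound) auto
    moreover have "\<bar>\<bar>g x\<bar> * (L * exp (x\<^sup>2 / 16))\<bar> \<le> K * L * exp (x\<^sup>2 / 4)"
      using K L0 by (intro mult_exp_bound) auto
    ultimately show ?thesis by simp
  qed
  \<comment> \<open>Joint integrability for Fubini: after the integration over z, the rates of g and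
    h in x add up to 1/8, below the admissible 1/4.\<close>
  have int2: "integrable (std_gaussian \<Otimes>\<^sub>M std_gaussian) (\<lambda>(x, z). g x * h (\<rho> * x + k * z))"
  proof (rule P.Fubini_integrable)
    show "integrable std_gaussian (\<lambda>x. \<integral>z. norm (case (x, z) of (x, z) \<Rightarrow> g x * h (\<rho> * x + k * z)) \<partial>std_gaussian)"
      using outer_bound by (intro integrable_std_gaussian_bound[of _ "2 * (K * L)"]) auto
    show "AE x in std_gaussian. integrable std_gaussian (\<lambda>z. case (x, z) of (x, z) \<Rightarrow> g x * h (\<rho> * x + k * z))"
      unfolding prod.case
      by (intro AE_I2 integrable_std_gaussian_bound[OF _ inner_bound]) simp
  qed simp
  \<comment> \<open>What the inner integral leaves beyond second order. Its rate 1/8 in x is the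
    share of the kernel remainder that the integration over y does not use.\<close>
  define J where "J x = (\<integral>z. h (\<rho> * x + k * z) \<partial>std_gaussian)
      - (gauss_moment He0 h + \<rho> * x * gauss_moment He1 h + \<rho>\<^sup>2 / 2 * (x\<^sup>2 - 1) * gauss_moment He2 h)" for x
  have [measurable]: "J \<in> borel_measurable borel" unfolding J_def[abs_def] by measurable
  have J: "\<bar>J x\<bar> \<le> (2 * (L * (300000 * \<bar>\<rho>\<bar> ^ 3))) * exp (x\<^sup>2 / 8)" for x
  proof -
    define R where "R y = mehler \<rho> x y - (1 + \<rho> * x * y + \<rho>\<^sup>2 * ((x\<^sup>2 - 1) * (y\<^sup>2 - 1) / 2))" for y
    have [measurable]: "mehler \<rho> x \<in> borel_measurable borel" by (simp add: mehler_def[abs_def])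
    have [measurable]: "R \<in> borel_measurable borel" by (simp add: R_def[abs_def])
    have R: "\<bar>R y\<bar> \<le> (300000 * \<bar>\<rho>\<bar> ^ 3 * exp (x\<^sup>2 / 8)) * exp (y\<^sup>2 / 8)" for y
      using mehler_expansion[OF \<rho>, of x y]
      by (simp add: R_def exp_add[symmetric] add_divide_distrib mult.assoc)
    have hR: "\<bar>h y * R y\<bar> \<le> L * (300000 * \<bar>\<rho>\<bar> ^ 3 * exp (x\<^sup>2 / 8)) * exp (y\<^sup>2 / 4)" for y
      by (intro mult_exp_bound_eighth L R)
    note int = integrable_gauss_moment[OF h L] integrable_std_gaussian_bound[OF _ hR, simplified]
    have "(\<integral>z. h (\<rho> * x + k * z) \<partial>std_gaussian) = (\<integral>y. mehler \<rho> x y * h y \<partial>std_gaussian)"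
      using k normal_density_mehler[OF \<rho>1, of x]
      by (intro integral_std_gaussian_affine) (auto simp: k_def)
    also have "\<dots> = (\<integral>y. h y + \<rho> * x * (h y * y) + \<rho>\<^sup>2 / 2 * (x\<^sup>2 - 1) * (h y * (y\<^sup>2 - 1)) + h y * R y \<partial>std_gaussian)"
      by (simp add: R_def algebra_simps)
    also have "\<dots> = gauss_moment He0 h + \<rho> * x * gauss_moment He1 h
        + \<rho>\<^sup>2 / 2 * (x\<^sup>2 - 1) * gauss_moment He2 h + (\<integral>y. h y * R y \<partial>std_gaussian)"
      using int by (simp add: gauss_moment_def)
    finally have "J x = (\<integral>y. h y * R y \<partial>std_gaussian)" by (simp add: J_def)
    then show ?thesis using integral_std_gaussian_bound[OF _ hR] by (simp add: mult_ac)
  qed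
  have gJ: "\<bar>g x * J x\<bar> \<le> K * (2 * (L * (300000 * \<bar>\<rho>\<bar> ^ 3))) * exp (x\<^sup>2 / 4)" for x
    by (intro mult_exp_bound_eighth K J)
  note int = integrable_gauss_moment[OF g K] integrable_std_gaussian_bound[OF _ gJ, simplified]
  have "(\<integral>(x, z). g x * h (\<rho> * x + k * z) \<partial>(std_gaussian \<Otimes>\<^sub>M std_gaussian))
      = (\<integral>x. \<integral>z. g x * h (\<rho> * x + k * z) \<partial>std_gaussian \<partial>std_gaussian)"
    using P.integral_fst[OF int2] by simp
  also have "\<dots> = (\<integral>x. g x * gauss_moment He0 h + g x * x * (\<rho> * gauss_moment He1 h)
      + g x * (x\<^sup>2 - 1) * (\<rho>\<^sup>2 / 2 * gauss_moment He2 h) + g x * J x \<partial>std_gaussian)"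
    by (simp add: J_def algebra_simps)
  also have "\<dots> = gauss_moment He0 g * gauss_moment He0 h + gauss_moment He1 g * (\<rho> * gauss_moment He1 h)
      + gauss_moment He2 g * (\<rho>\<^sup>2 / 2 * gauss_moment He2 h) + (\<integral>x. g x * J x \<partial>std_gaussian)"
    using int by (simp add: gauss_moment_def)
  finally show ?thesis
    using integral_std_gaussian_bound[OF _ gJ] unfolding k_def[symmetric] by (simp add: algebra_simps)
qed

section \<open>Lipschitz functions of Gaussian vectors\<close>

lemma hermite_0: "hermite 0 t = 1"
  by (simp add: hermite_def exp_add[symmetric])

lemma deriv_exp_half:
  "deriv (\<lambda>s. exp (- s\<^sup>2 / 2)) = (\<lambda>t :: real. - t * exp (- t\<^sup>2 / 2))"
  by (rule ext, rule DERIV_imp_deriv) (auto intro!: derivative_eq_intros)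

lemma deriv_mult_exp_half:
  "deriv (\<lambda>t. - t * exp (- t\<^sup>2 / 2)) = (\<lambda>t :: real. (t\<^sup>2 - 1) * exp (- t\<^sup>2 / 2))"
  by (rule ext, rule DERIV_imp_deriv)
    (auto intro!: derivative_eq_intros simp: power2_eq_square algebra_simps)

lemma hermite_1: "hermite 1 t = t"
  by (simp add: hermite_def deriv_exp_half[simplified] exp_add[symmetric] mult.left_commute)

lemma hermite_2: "hermite 2 t = t\<^sup>2 - 1"
proof -
  have "(deriv ^^ 2) (\<lambda>s. exp (- s\<^sup>2 / 2)) t = (t\<^sup>2 - 1) * exp (- t\<^sup>2 / 2)"
  proof -
    have two: "(deriv ^^ 2) g = deriv (deriv g)" for g :: "real \<Rightarrow> real" by (simp add: numeral_2_eq_2)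
    show ?thesis unfolding two deriv_exp_half deriv_mult_exp_half ..
  qed
  then show ?thesis
    by (simp add: hermite_def exp_add[symmetric] mult.left_commute)
qed

text \<open>Degree 2 is squared, so that the normalisation enters as 2! and not as its root.\<close>

lemma hermite_coeff_gauss_moment:
  shows "hermite_coeff 0 f = gauss_moment He0 f"
    and "hermite_coeff 1 f = gauss_moment He1 f"
    and "(hermite_coeff 2 f)\<^sup>2 = (gauss_moment He2 f)\<^sup>2 / 2"
  by (simp_all add: hermite_coeff_def gauss_moment_def hermite_0 hermite_1[simplified] hermite_2 power_divide)

section \<open>Growth and scaling of a fixed Lipschitz function\<close>

context
  fixes f :: "real \<Rightarrow> real" and L :: real
  assumes lip: "L-lipschitz_on UNIV f"
begin

lemma lipschitz_measurable [measurable]: "f \<in> borel_measurable borel"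
  by (rule borel_measurable_continuous_onI) (rule lipschitz_on_continuous_on[OF lip])

lemma lipschitz_scale_diff: "\<bar>f (s * x) - f (t * x)\<bar> \<le> 8 * L * \<bar>s - t\<bar> * exp (x\<^sup>2 / 16)"
proof -
  have L: "0 \<le> L" using lip by (rule lipschitz_on_nonneg)
  have "\<bar>f (s * x) - f (t * x)\<bar> \<le> L * \<bar>s * x - t * x\<bar>"
    using lipschitz_onD[OF lip, of "s * x" "t * x"] by (simp add: dist_real_def)
  also have "\<dots> = L * \<bar>s - t\<bar> * \<bar>x\<bar>" by (simp add: abs_mult flip: left_diff_distrib)
  also have "\<dots> \<le> L * \<bar>s - t\<bar> * (8 * exp (x\<^sup>2 / 16))"
    using L by (intro mult_left_mono exp_sixteenth_bounds) auto
  finally show ?thesis by (simp add: mult_ac)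
qed

text \<open>Chosen so that \<bar>f(s x)\<bar> is at most this constant times exp(x^2/16) for all
  \<bar>s\<bar> \<le> 2: the 16 is the maximal scale 2 times the 8 from \<bar>x\<bar> \<le> 8
  exp(x^2/16).\<close>

definition growth :: real where "growth = \<bar>f 0\<bar> + 16 * L"

lemma growth_nonneg: "0 \<le> growth"
  using lipschitz_on_nonneg[OF lip] by (simp add: growth_def)

lemma lipschitz_growth:
  assumes "\<bar>s\<bar> \<le> 2"
  shows "\<bar>f (s * x)\<bar> \<le> growth * exp (x\<^sup>2 / 16)"
proof -
  have L: "0 \<le> L" using lip by (rule lipschitz_on_nonneg)
  have "\<bar>f (s * x) - f 0\<bar> \<le> 8 * L * \<bar>s\<bar> * exp (x\<^sup>2 / 16)"
    using lipschitz_scale_diff[of s x 0] by simp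
  also have "\<dots> \<le> 8 * L * 2 * exp (x\<^sup>2 / 16)"
    using L assms by (intro mult_right_mono mult_left_mono) auto
  finally have "\<bar>f (s * x) - f 0\<bar> \<le> 16 * L * exp (x\<^sup>2 / 16)" by simp
  moreover have "\<bar>f 0\<bar> * 1 \<le> \<bar>f 0\<bar> * exp (x\<^sup>2 / 16)"
    by (intro mult_left_mono exp_sixteenth_bounds) auto
  ultimately show ?thesis by (simp add: growth_def distrib_right)
qed

lemma gauss_moment_scale_lipschitz:
  assumes [measurable]: "p \<in> borel_measurable borel" and P: "\<And>x. \<bar>p x\<bar> \<le> P * exp (x\<^sup>2 / 16)"
    and s: "\<bar>s\<bar> \<le> 2" and t: "\<bar>t\<bar> \<le> 2"
  shows "\<bar>gauss_moment p (\<lambda>x. f (s * x)) - gauss_moment p (\<lambda>x. f (t * x))\<bar> \<le> 16 * L * P * \<bar>s - t\<bar>"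
proof -
  have "integrable std_gaussian (\<lambda>x. f (r * x) * p x)" if "\<bar>r\<bar> \<le> 2" for r
    by (rule integrable_std_gaussian_bound[of _ "growth * P"], simp)
      (intro mult_exp_bound lipschitz_growth[OF that] P)
  note int = this[OF s] this[OF t]
  have "\<bar>\<integral>x. (f (s * x) - f (t * x)) * p x \<partial>std_gaussian\<bar> \<le> 2 * (8 * L * \<bar>s - t\<bar> * P)"
    by (rule integral_std_gaussian_bound, simp) (intro mult_exp_bound lipschitz_scale_diff P)
  moreover have "(\<integral>x. (f (s * x) - f (t * x)) * p x \<partial>std_gaussian)
      = gauss_moment p (\<lambda>x. f (s * x)) - gauss_moment p (\<lambda>x. f (t * x))"
    using int by (simp add: gauss_moment_def left_diff_distrib)
  ultimately show ?thesis by (simp add: mult_ac)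
qed

text \<open>In the difference of squares one factor is Lipschitz in the scale, and the other is
  bounded by twice the growth constant.\<close>

lemma square_scale_lipschitz:
  assumes s: "\<bar>s\<bar> \<le> 2" and t: "\<bar>t\<bar> \<le> 2"
  shows "\<bar>(\<integral>x. (f (s * x))\<^sup>2 \<partial>std_gaussian) - (\<integral>x. (f (t * x))\<^sup>2 \<partial>std_gaussian)\<bar>
    \<le> 32 * L * growth * \<bar>s - t\<bar>"
proof -
  have "integrable std_gaussian (\<lambda>x. f (r * x) * f (r * x))" if "\<bar>r\<bar> \<le> 2" for r
    by (rule integrable_std_gaussian_bound[of _ "growth * growth"], simp)
      (intro mult_exp_bound lipschitz_growth[OF that])
  note int = this[OF s] this[OF t]
  have plus: "\<bar>f (s * x) + f (t * x)\<bar> \<le> (2 * growth) * exp (x\<^sup>2 / 16)" for x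
    using lipschitz_growth[OF s, of x] lipschitz_growth[OF t, of x] by linarith
  have "\<bar>\<integral>x. (f (s * x) - f (t * x)) * (f (s * x) + f (t * x)) \<partial>std_gaussian\<bar>
      \<le> 2 * (8 * L * \<bar>s - t\<bar> * (2 * growth))"
    by (rule integral_std_gaussian_bound, simp) (intro mult_exp_bound lipschitz_scale_diff plus)
  also have "(\<lambda>x. (f (s * x) - f (t * x)) * (f (s * x) + f (t * x)))
      = (\<lambda>x. f (s * x) * f (s * x) - f (t * x) * f (t * x))"
    by (simp add: algebra_simps)
  finally show ?thesis using int by (simp add: power2_eq_square mult_ac)
qed

text \<open>Mean of \<open>f\<close> under the centred normal law of variance 1 + d; at d = 0 it is
  \<zeta>_0.\<close>

definition scaled_mean :: "real \<Rightarrow> real" where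
  "scaled_mean d = gauss_moment He0 (\<lambda>x. f (sqrt (1 + d) * x))"

text \<open>The regression coefficient of f(V) on a centred normal V of variance 1 + d, by Stein's
  identity the mean derivative of \<open>f\<close>. Division by the standard deviation makes it a
  factor of the covariance and not of the correlation.\<close>

definition scaled_slope :: "real \<Rightarrow> real" where
  "scaled_slope d = gauss_moment He1 (\<lambda>x. f (sqrt (1 + d) * x)) / sqrt (1 + d)"

context
  fixes d :: real
  assumes d: "\<bar>d\<bar> \<le> 1 / 32"
begin

lemma sqrt_scale: "1 / 2 \<le> sqrt (1 + d)" "\<bar>sqrt (1 + d)\<bar> \<le> 2" "\<bar>sqrt (1 + d) - 1\<bar> \<le> \<bar>d\<bar>"
proof -
  have d': "- (1 / 32) \<le> d" "d \<le> 1 / 32" using d by auto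
  show 1: "1 / 2 \<le> sqrt (1 + d)" using d' by (intro real_le_rsqrt) (simp add: power2_eq_square)
  show "\<bar>sqrt (1 + d)\<bar> \<le> 2" using d' by (auto intro!: real_le_lsqrt)
  have "(sqrt (1 + d) - 1) * (sqrt (1 + d) + 1) = d"
    using d' by (simp add: algebra_simps flip: power2_eq_square)
  then have "\<bar>(sqrt (1 + d) - 1) * (sqrt (1 + d) + 1)\<bar> = \<bar>d\<bar>" by simp
  moreover have "\<bar>sqrt (1 + d) + 1\<bar> = sqrt (1 + d) + 1" using 1 by linarith
  ultimately have "\<bar>sqrt (1 + d) - 1\<bar> * (sqrt (1 + d) + 1) = \<bar>d\<bar>" by (simp only: abs_mult)
  moreover have "\<bar>sqrt (1 + d) - 1\<bar> * 1 \<le> \<bar>sqrt (1 + d) - 1\<bar> * (sqrt (1 + d) + 1)"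
  proof (rule mult_left_mono)
    show "1 \<le> sqrt (1 + d) + 1" using 1 by linarith
  qed simp
  ultimately show "\<bar>sqrt (1 + d) - 1\<bar> \<le> \<bar>d\<bar>" by simp
qed

text \<open>As \<zeta>_0 vanishes, the expansion in d starts with d/2 times the second moment. A
  mere Lipschitz bound in d would leave a rank-one matrix of squared length comparable to the sum of
  the squared diagonal entries, which is bounded but need not be small.\<close>

lemma scaled_mean_bound:
  assumes "gauss_moment He0 f = 0"
  shows "\<bar>scaled_mean d\<bar> \<le> \<bar>gauss_moment He2 f\<bar> * \<bar>d\<bar> + 6000 * growth * d\<^sup>2"
proof -
  have "\<bar>scaled_mean d - d / 2 * gauss_moment He2 f\<bar> \<le> 6000 * growth * d\<^sup>2"
    using gauss_moment_scale_expansion[of f growth d] lipschitz_growth[of 1] d assms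
    by (simp add: scaled_mean_def gauss_moment_def[of He0])
  moreover have "\<bar>d / 2 * gauss_moment He2 f\<bar> \<le> \<bar>gauss_moment He2 f\<bar> * \<bar>d\<bar>"
    by (simp add: abs_mult mult.commute)
  ultimately show ?thesis by linarith
qed

text \<open>First order in d is enough, since slopes multiply entries of \<Delta>, whose operator
  norm is bounded. The 256 consists of 16 * 8 from the moment and 2 from dividing by sqrt(1 + d)
  \<ge> 1/2.\<close>

lemma scaled_slope_bound:
  "\<bar>scaled_slope d - gauss_moment He1 f\<bar> \<le> (256 * L + 2 * \<bar>gauss_moment He1 f\<bar>) * \<bar>d\<bar>"
proof -
  define s where "s = sqrt (1 + d)"
  define c where "c = gauss_moment He1 (\<lambda>x. f (s * x))"
  define p where "p = gauss_moment He1 f"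
  have s: "1 / 2 \<le> s" "\<bar>s\<bar> \<le> 2" "\<bar>s - 1\<bar> \<le> \<bar>d\<bar>" using sqrt_scale by (simp_all add: s_def)
  have L: "0 \<le> L" using lip by (rule lipschitz_on_nonneg)
  have "\<bar>c - p\<bar> \<le> 16 * L * 8 * \<bar>s - 1\<bar>"
    using gauss_moment_scale_lipschitz[of He1 8 s 1] s exp_sixteenth_bounds by (simp add: c_def p_def)
  also have "\<dots> \<le> 16 * L * 8 * \<bar>d\<bar>" using s L by (intro mult_left_mono) auto
  finally have cp: "\<bar>c - p\<bar> \<le> 128 * L * \<bar>d\<bar>" by simp
  have "c / s - p = ((c - p) + p * (1 - s)) / s" using s by (simp add: field_simps)
  then have "\<bar>c / s - p\<bar> = \<bar>(c - p) + p * (1 - s)\<bar> / s" using s by simp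
  also have "\<dots> \<le> \<bar>(c - p) + p * (1 - s)\<bar> / (1 / 2)"
    using s by (intro divide_left_mono) auto
  also have "\<dots> \<le> 2 * (\<bar>c - p\<bar> + \<bar>p\<bar> * \<bar>s - 1\<bar>)"
    using abs_triangle_ineq[of "c - p" "p * (1 - s)"] by (simp add: abs_mult abs_minus_commute)
  also have "\<dots> \<le> 2 * (128 * L * \<bar>d\<bar> + \<bar>p\<bar> * \<bar>d\<bar>)"
    using cp s by (intro mult_left_mono add_mono) auto
  finally show ?thesis
    by (simp add: scaled_slope_def s_def c_def p_def algebra_simps)
qed

lemma scaled_second_bound:
  "\<bar>gauss_moment He2 (\<lambda>x. f (sqrt (1 + d) * x))\<bar> \<le> \<bar>gauss_moment He2 f\<bar> + 256 * L * \<bar>d\<bar>"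
proof -
  have L: "0 \<le> L" using lip by (rule lipschitz_on_nonneg)
  have "\<bar>gauss_moment He2 (\<lambda>x. f (sqrt (1 + d) * x)) - gauss_moment He2 f\<bar> \<le> 16 * L * 16 * \<bar>sqrt (1 + d) - 1\<bar>"
    using gauss_moment_scale_lipschitz[of He2 16 "sqrt (1 + d)" 1] sqrt_scale exp_sixteenth_bounds by simp
  also have "\<dots> \<le> 16 * L * 16 * \<bar>d\<bar>" using sqrt_scale L by (intro mult_left_mono) auto
  finally show ?thesis by linarith
qed

text \<open>A coordinate has correlation one with itself, out of reach of the Mehler expansion. Only
  the standard deviation varies, and the second moment is Lipschitz in it.\<close>

lemma second_moment_diag:
  assumes u: "gaussian_vector M n u" and i: "i < n"
    and mean: "(\<integral>\<omega>. u \<omega> $ i \<partial>M) = 0" and var: "(\<integral>\<omega>. (u \<omega> $ i)\<^sup>2 \<partial>M) = 1 + d"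
  shows "\<bar>(\<integral>\<omega>. f (u \<omega> $ i) * f (u \<omega> $ i) \<partial>M) - (gauss_norm f)\<^sup>2\<bar> \<le> 32 * L * growth * \<bar>d\<bar>"
proof -
  define s where "s = sqrt (1 + d)"
  have s: "0 < s" "\<bar>s\<bar> \<le> 2" "\<bar>s - 1\<bar> \<le> \<bar>d\<bar>"
    unfolding s_def using sqrt_scale by linarith+
  have M: "prob_space M" using u by (simp add: gaussian_vector_def)
  note rv = gaussian_vector_component[OF u i]
  have [measurable]: "(\<lambda>\<omega>. u \<omega> $ i) \<in> borel_measurable M"
    using rv by (simp add: gaussian_rv_def)
  have "1 + d = s\<^sup>2" using d by (auto simp: s_def)
  then have D: "distr M borel (\<lambda>\<omega>. u \<omega> $ i / s) = std_gaussian"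
    using gaussian_rv_standardize[OF M rv mean] var s by simp
  have "(\<integral>x. (f (s * x))\<^sup>2 \<partial>std_gaussian) = (\<integral>\<omega>. f (u \<omega> $ i) * f (u \<omega> $ i) \<partial>M)"
    unfolding D[symmetric] using s by (subst integral_distr) (auto simp: power2_eq_square)
  moreover have "(gauss_norm f)\<^sup>2 = (\<integral>x. (f (1 * x))\<^sup>2 \<partial>std_gaussian)"
    by (simp add: gauss_norm_def)
  ultimately have "\<bar>(\<integral>\<omega>. f (u \<omega> $ i) * f (u \<omega> $ i) \<partial>M) - (gauss_norm f)\<^sup>2\<bar> \<le> 32 * L * growth * \<bar>s - 1\<bar>"
    using square_scale_lipschitz[of s 1] s by simp
  also have "\<dots> \<le> 32 * L * growth * \<bar>d\<bar>"
    using s growth_nonneg lipschitz_on_nonneg[OF lip] by (intro mult_left_mono) auto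
  finally show ?thesis .
qed

end

text \<open>With D = s t \<rho> for the standard deviations s, t, order 0 gives the product of means
  and order 1, after the scales cancel, the slopes times D. At order 2 the product of second moments
  is O(q^2 + \<delta>), and the cubic remainder gives up one factor for \<delta>; both become
  multiples of D^2.\<close>

lemma second_moment_offdiag:
  assumes u: "gaussian_vector M n u" and ij: "i < n" "j < n"
    and mean: "(\<integral>\<omega>. u \<omega> $ i \<partial>M) = 0" "(\<integral>\<omega>. u \<omega> $ j \<partial>M) = 0"
    and var: "(\<integral>\<omega>. (u \<omega> $ i)\<^sup>2 \<partial>M) = 1 + d" "(\<integral>\<omega>. (u \<omega> $ j)\<^sup>2 \<partial>M) = 1 + e"
    and cov: "(\<integral>\<omega>. u \<omega> $ i * u \<omega> $ j \<partial>M) = D"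
    and \<delta>: "\<bar>d\<bar> \<le> \<delta>" "\<bar>e\<bar> \<le> \<delta>" "\<bar>D\<bar> \<le> \<delta>" "\<delta> \<le> 1 / 32"
  shows "\<bar>(\<integral>\<omega>. f (u \<omega> $ i) * f (u \<omega> $ j) \<partial>M)
      - (scaled_mean d * scaled_mean e + scaled_slope d * scaled_slope e * D)\<bar>
    \<le> (4 + 262144 * L\<^sup>2 + 9600000 * growth\<^sup>2) * ((gauss_moment He2 f)\<^sup>2 + \<delta>) * D\<^sup>2"
proof -
  have de: "\<bar>d\<bar> \<le> 1 / 32" "\<bar>e\<bar> \<le> 1 / 32" "\<bar>D\<bar> \<le> 1 / 32" using \<delta> by linarith+
  have \<delta>0: "0 \<le> \<delta>" using \<delta>(1) by linarith
  have L: "0 \<le> L" using lip by (rule lipschitz_on_nonneg)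
  define s where "s = sqrt (1 + d)"
  define t where "t = sqrt (1 + e)"
  have s: "0 < s" "\<bar>s\<bar> \<le> 2" "s\<^sup>2 = 1 + d" using sqrt_scale[OF de(1)] de by (auto simp: s_def)
  have t: "0 < t" "\<bar>t\<bar> \<le> 2" "t\<^sup>2 = 1 + e" using sqrt_scale[OF de(2)] de by (auto simp: t_def)
  \<comment> \<open>Both variances are at least 31/32. This gives \<bar>\<rho>\<bar> \<le> 2
    \<bar>D\<bar> \<le> 1/16, the range of the Mehler expansion.\<close>
  have st: "1 / 2 \<le> s * t"
  proof (rule power2_le_imp_le)
    have "(1 / 2)\<^sup>2 \<le> (31 / 32) * (31 / 32 :: real)" by (simp add: power2_eq_square)
    also have "\<dots> \<le> (1 + d) * (1 + e)" using de by (intro mult_mono) auto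
    finally show "(1 / 2)\<^sup>2 \<le> (s * t)\<^sup>2" by (simp add: power_mult_distrib s t)
  qed (use s t in simp)
  define \<rho> where "\<rho> = D / (s * t)"
  have \<rho>D: "D = s * t * \<rho>" using s t by (simp add: \<rho>_def)
  have "\<bar>\<rho>\<bar> = \<bar>D\<bar> / (s * t)" using s t by (simp add: \<rho>_def abs_mult)
  also have "\<dots> \<le> \<bar>D\<bar> / (1 / 2)" using st by (intro divide_left_mono) auto
  finally have \<rho>2: "\<bar>\<rho>\<bar> \<le> 2 * \<bar>D\<bar>" by simp
  then have \<rho>: "\<bar>\<rho>\<bar> \<le> 1 / 16" using de by linarith
  then have \<rho>1: "\<bar>\<rho>\<bar> < 1" by linarith
  define k where "k = sqrt (1 - \<rho>\<^sup>2)"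
  have k: "0 < k" using \<rho>1 by (simp add: k_def abs_square_less_1)
  note rv = gaussian_vector_component[OF u ij(1)] gaussian_vector_component[OF u ij(2)]
  have [measurable]: "(\<lambda>\<omega>. u \<omega> $ i) \<in> borel_measurable M" "(\<lambda>\<omega>. u \<omega> $ j) \<in> borel_measurable M"
    using rv by (simp_all add: gaussian_rv_def)
  have distr: "distr M (borel \<Otimes>\<^sub>M borel) (\<lambda>\<omega>. (u \<omega> $ i / s, (u \<omega> $ j / t - \<rho> * (u \<omega> $ i / s)) / k))
      = std_gaussian \<Otimes>\<^sub>M std_gaussian"
    unfolding k_def using s t var \<rho>1 cov \<rho>D by (intro gaussian_vector_pair_distr[OF u ij mean]) auto
  \<comment> \<open>Inverting the decorrelation: the i-th coordinate is s x and the j-th is t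
    (\<rho> x + k z).\<close>
  have eq: "(\<integral>\<omega>. f (u \<omega> $ i) * f (u \<omega> $ j) \<partial>M)
      = (\<integral>(x, z). f (s * x) * f (t * (\<rho> * x + k * z)) \<partial>(std_gaussian \<Otimes>\<^sub>M std_gaussian))"
    unfolding distr[symmetric] using s t k by (subst integral_distr) (auto simp: field_simps)
  let ?g = "\<lambda>x. f (s * x)" and ?h = "\<lambda>x. f (t * x)"
  define A where "A = gauss_moment He2 ?g"
  define B where "B = gauss_moment He2 ?h"
  define q where "q = gauss_moment He2 f"
  define I where "I = (\<integral>\<omega>. f (u \<omega> $ i) * f (u \<omega> $ j) \<partial>M)"
  have slope: "\<rho> * (gauss_moment He1 ?g * gauss_moment He1 ?h) = scaled_slope d * scaled_slope e * D"
    using s t by (simp add: scaled_slope_def \<rho>_def s_def[symmetric] t_def[symmetric])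
  have main: "\<bar>I - (scaled_mean d * scaled_mean e + scaled_slope d * scaled_slope e * D + \<rho>\<^sup>2 / 2 * (A * B))\<bar>
      \<le> 1200000 * growth * growth * \<bar>\<rho>\<bar> ^ 3"
    using gauss_moment_mehler_expansion[of ?g growth ?h growth \<rho>] lipschitz_growth[OF s(2)]
      lipschitz_growth[OF t(2)] \<rho>
    unfolding slope k_def[symmetric] eq I_def A_def B_def
    by (simp add: scaled_mean_def s_def[symmetric] t_def[symmetric])
  have \<rho>3: "\<bar>\<rho>\<bar> ^ 3 \<le> 8 * (\<delta> * D\<^sup>2)"
  proof -
    have "\<bar>\<rho>\<bar> ^ 3 \<le> (2 * \<bar>D\<bar>) ^ 3" using \<rho>2 by (intro power_mono) auto
    also have "\<dots> = 8 * (\<bar>D\<bar> * D\<^sup>2)" by (simp add: power2_eq_square power3_eq_cube flip: abs_mult)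
    also have "\<dots> \<le> 8 * (\<delta> * D\<^sup>2)" using \<delta> by (intro mult_left_mono mult_right_mono) auto
    finally show ?thesis .
  qed
  have \<rho>sq: "\<rho>\<^sup>2 / 2 \<le> 2 * D\<^sup>2"
    using power_mono[OF \<rho>2 abs_ge_zero, of 2] by (simp add: power_mult_distrib)
  \<comment> \<open>Each second moment differs from q by O(\<delta>). The square of the sum is split
    by (a + b)^2 \<le> 2 a^2 + 2 b^2, and one factor of \<delta>^2 is replaced by 1.\<close>
  have AB: "\<bar>A * B\<bar> \<le> 2 * q\<^sup>2 + 131072 * L\<^sup>2 * \<delta>"
  proof -
    have "256 * L * \<bar>d\<bar> \<le> 256 * L * \<delta>" "256 * L * \<bar>e\<bar> \<le> 256 * L * \<delta>"
      using L \<delta> by (auto intro!: mult_left_mono)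
    then have "\<bar>A\<bar> \<le> \<bar>q\<bar> + 256 * L * \<delta>" "\<bar>B\<bar> \<le> \<bar>q\<bar> + 256 * L * \<delta>"
      using scaled_second_bound[OF de(1)] scaled_second_bound[OF de(2)]
      by (simp_all add: A_def B_def q_def s_def t_def)
    then have "\<bar>A * B\<bar> \<le> (\<bar>q\<bar> + 256 * L * \<delta>) * (\<bar>q\<bar> + 256 * L * \<delta>)"
      unfolding abs_mult by (intro mult_mono) auto
    also have "\<dots> \<le> 2 * q\<^sup>2 + 2 * (256 * L * \<delta>)\<^sup>2"
      using zero_le_power2[of "\<bar>q\<bar> - 256 * L * \<delta>"] by (simp add: power2_eq_square algebra_simps)
    also have "(256 * L * \<delta>)\<^sup>2 = 65536 * L\<^sup>2 * (\<delta> * \<delta>)" by (simp add: power2_eq_square)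
    also have "2 * q\<^sup>2 + 2 * (65536 * L\<^sup>2 * (\<delta> * \<delta>)) \<le> 2 * q\<^sup>2 + 2 * (65536 * L\<^sup>2 * (\<delta> * 1))"
      using \<delta> \<delta>0 by (intro add_left_mono mult_left_mono) auto
    finally show ?thesis by simp
  qed
  have "\<bar>I - (scaled_mean d * scaled_mean e + scaled_slope d * scaled_slope e * D)\<bar>
      \<le> 1200000 * growth * growth * \<bar>\<rho>\<bar> ^ 3 + \<rho>\<^sup>2 / 2 * \<bar>A * B\<bar>"
  proof -
    have "\<rho>\<^sup>2 / 2 * \<bar>A * B\<bar> = \<bar>\<rho>\<^sup>2 / 2 * (A * B)\<bar>" by (simp add: abs_mult)
    then show ?thesis using main by linarith
  qed
  also have "\<dots> \<le> 1200000 * growth * growth * (8 * (\<delta> * D\<^sup>2)) + 2 * D\<^sup>2 * (2 * q\<^sup>2 + 131072 * L\<^sup>2 * \<delta>)"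
    using \<rho>3 \<rho>sq AB growth_nonneg \<delta>0 by (intro add_mono mult_mono) auto
  also have "\<dots> = (4 * q\<^sup>2 + 262144 * L\<^sup>2 * \<delta> + 9600000 * growth\<^sup>2 * \<delta>) * D\<^sup>2"
    by (simp add: power2_eq_square algebra_simps)
  also have "\<dots> \<le> ((4 + 262144 * L\<^sup>2 + 9600000 * growth\<^sup>2) * (q\<^sup>2 + \<delta>)) * D\<^sup>2"
    using \<delta>0 by (intro mult_right_mono) (simp_all add: algebra_simps)
  finally show ?thesis by (simp add: I_def q_def)
qed

end

section \<open>The error matrix\<close>

text \<open>The factor C (\<bar>q\<bar> + \<bar>d\<bar>) squares to at most 2 C^2 (q^2 + \<delta>),
  the kind of weight that the off-diagonal remainder carries, so both are summed by the same
  pattern.\<close>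

lemma power2_perturbed_bound:
  fixes d :: real
  assumes \<delta>: "\<delta> \<le> 1" and d: "\<bar>d\<bar> \<le> \<delta>" and a: "\<bar>a\<bar> \<le> C * (\<bar>q\<bar> * \<bar>d\<bar> + d\<^sup>2)"
  shows "a\<^sup>2 \<le> 2 * C\<^sup>2 * (q\<^sup>2 + \<delta>) * d\<^sup>2"
proof -
  have \<delta>0: "0 \<le> \<delta>" using d by linarith
  have "\<bar>a\<bar>\<^sup>2 \<le> (C * (\<bar>q\<bar> * \<bar>d\<bar> + d\<^sup>2))\<^sup>2" using a by (intro power_mono) auto
  also have "C * (\<bar>q\<bar> * \<bar>d\<bar> + d\<^sup>2) = C * (\<bar>q\<bar> + \<bar>d\<bar>) * \<bar>d\<bar>"
    by (simp add: algebra_simps power2_eq_square)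
  also have "(C * (\<bar>q\<bar> + \<bar>d\<bar>) * \<bar>d\<bar>)\<^sup>2 = C\<^sup>2 * (\<bar>q\<bar> + \<bar>d\<bar>)\<^sup>2 * d\<^sup>2"
    by (simp add: power_mult_distrib)
  also have "\<dots> \<le> C\<^sup>2 * (2 * (q\<^sup>2 + \<delta>)) * d\<^sup>2"
  proof (intro mult_right_mono mult_left_mono)
    have "\<bar>d\<bar>\<^sup>2 \<le> \<delta>\<^sup>2" using d by (intro power_mono) auto
    also have "\<dots> \<le> \<delta>" using \<delta> \<delta>0 by (simp add: power2_eq_square mult_left_le)
    finally have "\<bar>d\<bar>\<^sup>2 \<le> \<delta>" .
    moreover have "(\<bar>q\<bar> + \<bar>d\<bar>)\<^sup>2 \<le> 2 * \<bar>q\<bar>\<^sup>2 + 2 * \<bar>d\<bar>\<^sup>2"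
      using zero_le_power2[of "\<bar>q\<bar> - \<bar>d\<bar>"] by (simp add: power2_diff power2_sum)
    ultimately show "(\<bar>q\<bar> + \<bar>d\<bar>)\<^sup>2 \<le> 2 * (q\<^sup>2 + \<delta>)" by simp
  qed auto
  finally show ?thesis by (simp add: algebra_simps)
qed

section \<open>Deterministic bounds for an array with the structure of the error\<close>

context
  fixes n :: nat and C B p q \<delta> :: real and \<Delta> E :: "nat \<Rightarrow> nat \<Rightarrow> real" and \<alpha> w :: "nat \<Rightarrow> real"
  assumes C: "0 \<le> C" and B: "0 \<le> B" and \<delta>: "0 \<le> \<delta>" "\<delta> \<le> 1"
    and \<Delta>_sym: "\<And>i j. i < n \<Longrightarrow> j < n \<Longrightarrow> \<Delta> i j = \<Delta> j i"
    and \<Delta>_le: "\<And>i j. i < n \<Longrightarrow> j < n \<Longrightarrow> \<bar>\<Delta> i j\<bar> \<le> \<delta>"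
    and \<Delta>_op: "op_bounded n \<Delta> B"
    and \<Delta>_diag: "(\<Sum>i<n. (\<Delta> i i)\<^sup>2) \<le> B\<^sup>2"
    and \<alpha>: "\<And>i. i < n \<Longrightarrow> \<bar>\<alpha> i\<bar> \<le> C * (\<bar>q\<bar> * \<bar>\<Delta> i i\<bar> + (\<Delta> i i)\<^sup>2)"
    and w: "\<And>i. i < n \<Longrightarrow> \<bar>w i - p\<bar> \<le> C * \<delta>"
    and off: "\<And>i j. i < n \<Longrightarrow> j < n \<Longrightarrow> i \<noteq> j \<Longrightarrow>
      \<bar>E i j - \<alpha> i * \<alpha> j - (w i * w j - p\<^sup>2) * \<Delta> i j\<bar> \<le> C * (q\<^sup>2 + \<delta>) * (\<Delta> i j)\<^sup>2"
    and diag: "\<And>i. i < n \<Longrightarrow> \<bar>E i i\<bar> \<le> C * \<delta>"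
begin

text \<open>Comes from \<open>w i * w j - p\<^sup>2 = (w i - p) * w j + p * (w j - p)\<close>. This
  constant and the next two are built from C, B, p and q alone, hence free of the dimension and of
  \<delta>.\<close>

definition slope_const :: real where "slope_const = C * (2 * \<bar>p\<bar> + C)"
text \<open>Collects the three contributions to a diagonal entry of the rest: the error itself, the
  rank-one part and the slope part.\<close>

definition diag_const :: real where
  "diag_const = C + 2 * C\<^sup>2 * (q\<^sup>2 + 1) + slope_const"
text \<open>A common majorant of the four sums in \<open>full_const_bounds\<close>, which arise, in
  this order, from the entrywise, the bounded spectral, the small spectral and the Frobenius
  estimate.\<close>

definition full_const :: real where
  "full_const = 2 * C\<^sup>2 * (q\<^sup>2 + 1) * (1 + B\<^sup>2) + slope_const * (1 + B) + C * (q\<^sup>2 + 1) * (1 + B + B\<^sup>2) + diag_const"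

lemma consts_nonneg: "0 \<le> slope_const" "0 \<le> diag_const" "0 \<le> full_const"
  using C B by (auto simp: slope_const_def diag_const_def full_const_def intro!: add_nonneg_nonneg mult_nonneg_nonneg)

lemma full_const_bounds:
  shows "2 * C\<^sup>2 * (q\<^sup>2 + 1) + slope_const + C * (q\<^sup>2 + 1) + diag_const \<le> full_const"
    and "2 * C\<^sup>2 * (q\<^sup>2 + 1) * B\<^sup>2 + slope_const * B + C * (q\<^sup>2 + 1) * B\<^sup>2 + diag_const \<le> full_const"
    and "2 * C\<^sup>2 * (1 + B\<^sup>2) + slope_const * B + C * (1 + B\<^sup>2) + diag_const \<le> full_const"
    and "2 * C\<^sup>2 * (1 + B\<^sup>2) + slope_const * B + C * (1 + B) + diag_const \<le> full_const"
proof -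
  have *: "2 * C\<^sup>2 * x * y + slope_const * s + C * x' * t + diag_const \<le> full_const"
    if "0 \<le> x" "x \<le> q\<^sup>2 + 1" "0 \<le> x'" "x' \<le> q\<^sup>2 + 1" "0 \<le> y" "y \<le> 1 + B\<^sup>2" "s \<le> 1 + B" "0 \<le> t" "t \<le> 1 + B + B\<^sup>2"
    for x x' y s t
    unfolding full_const_def using that C consts_nonneg
    by (intro add_mono mult_mono mult_left_mono order_refl) auto
  show "2 * C\<^sup>2 * (q\<^sup>2 + 1) + slope_const + C * (q\<^sup>2 + 1) + diag_const \<le> full_const"
    using *[of "q\<^sup>2 + 1" "q\<^sup>2 + 1" 1 1 1] B by simp
  show "2 * C\<^sup>2 * (q\<^sup>2 + 1) * B\<^sup>2 + slope_const * B + C * (q\<^sup>2 + 1) * B\<^sup>2 + diag_const \<le> full_const"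
    using *[of "q\<^sup>2 + 1" "q\<^sup>2 + 1" "B\<^sup>2" B "B\<^sup>2"] B by simp
  show "2 * C\<^sup>2 * (1 + B\<^sup>2) + slope_const * B + C * (1 + B\<^sup>2) + diag_const \<le> full_const"
    using *[of 1 1 "1 + B\<^sup>2" B "1 + B\<^sup>2"] B by simp
  show "2 * C\<^sup>2 * (1 + B\<^sup>2) + slope_const * B + C * (1 + B) + diag_const \<le> full_const"
    using *[of 1 1 "1 + B\<^sup>2" B "1 + B"] B by simp
qed

lemma \<alpha>_power2: "i < n \<Longrightarrow> (\<alpha> i)\<^sup>2 \<le> 2 * C\<^sup>2 * (q\<^sup>2 + 1) * \<delta>"
proof -
  assume i: "i < n"
  have "(\<alpha> i)\<^sup>2 \<le> 2 * C\<^sup>2 * (q\<^sup>2 + \<delta>) * (\<Delta> i i)\<^sup>2"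
    by (rule power2_perturbed_bound[OF \<delta>(2) \<Delta>_le[OF i i] \<alpha>[OF i]])
  also have "\<dots> \<le> 2 * C\<^sup>2 * (q\<^sup>2 + 1) * \<delta>"
  proof (intro mult_mono)
    have "\<bar>\<Delta> i i\<bar> * \<bar>\<Delta> i i\<bar> \<le> \<delta> * 1" using \<Delta>_le[OF i i] \<delta> by (intro mult_mono) auto
    then show "(\<Delta> i i)\<^sup>2 \<le> \<delta>" by (simp add: power2_eq_square)
  qed (use \<delta> in auto)
  finally show ?thesis .
qed

lemma \<Delta>_power2: "i < n \<Longrightarrow> j < n \<Longrightarrow> (\<Delta> i j)\<^sup>2 \<le> \<delta>\<^sup>2"
  using \<Delta>_le[of i j] power_mono[of "\<bar>\<Delta> i j\<bar>" \<delta> 2] by simp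

lemma sum_\<Delta>_diag_le: "(\<Sum>i<n. (\<Delta> i i)\<^sup>2) \<le> real n * \<delta>\<^sup>2"
  using sum_mono[of "{..<n}" "\<lambda>i. (\<Delta> i i)\<^sup>2" "\<lambda>_. \<delta>\<^sup>2"] \<Delta>_power2 by simp

lemma row_\<Delta>: 
  assumes i: "i < n"
  shows "(\<Sum>j<n. (\<Delta> i j)\<^sup>2) \<le> B\<^sup>2" "(\<Sum>j<n. (\<Delta> i j)\<^sup>2) \<le> real n * \<delta>\<^sup>2"
proof -
  have "(\<Sum>j<n. (\<Delta> i j)\<^sup>2) = (\<Sum>j<n. (\<Delta> j i)\<^sup>2)" using i by (intro sum.cong) (auto simp: \<Delta>_sym)
  then show "(\<Sum>j<n. (\<Delta> i j)\<^sup>2) \<le> B\<^sup>2" using op_bounded_column[OF \<Delta>_op i] by simp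
  show "(\<Sum>j<n. (\<Delta> i j)\<^sup>2) \<le> real n * \<delta>\<^sup>2"
    using sum_mono[of "{..<n}" "\<lambda>j. (\<Delta> i j)\<^sup>2" "\<lambda>_. \<delta>\<^sup>2"] \<Delta>_power2 i by simp
qed

text \<open>The squared diagonal entries of \<Delta> sum to at most B^2 and to at most n \<delta>^2.
  In the second claim n \<delta>^2 goes with the weight q^2 and B^2 with the weight \<delta>, so
  that n only meets q^2 \<delta>^2.\<close>

lemma rank_one_norm:
  shows "(L2_set \<alpha> {..<n})\<^sup>2 \<le> 2 * C\<^sup>2 * (q\<^sup>2 + 1) * B\<^sup>2"
    and "(L2_set \<alpha> {..<n})\<^sup>2 \<le> 2 * C\<^sup>2 * (1 + B\<^sup>2) * (\<delta> + real n * (q\<^sup>2 * \<delta>\<^sup>2))"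
proof -
  let ?S = "\<Sum>i<n. (\<Delta> i i)\<^sup>2"
  have S0: "0 \<le> ?S" by (simp add: sum_nonneg)
  have main: "(L2_set \<alpha> {..<n})\<^sup>2 \<le> 2 * C\<^sup>2 * (q\<^sup>2 + \<delta>) * ?S"
    unfolding L2_set_power2 sum_distrib_left
    by (intro sum_mono power2_perturbed_bound[OF \<delta>(2) \<Delta>_le \<alpha>]) auto
  also have "\<dots> \<le> 2 * C\<^sup>2 * (q\<^sup>2 + 1) * B\<^sup>2"
    using \<delta> \<Delta>_diag S0 by (intro mult_mono) auto
  finally show "(L2_set \<alpha> {..<n})\<^sup>2 \<le> 2 * C\<^sup>2 * (q\<^sup>2 + 1) * B\<^sup>2" .
  have "(q\<^sup>2 + \<delta>) * ?S = q\<^sup>2 * ?S + \<delta> * ?S" by (simp add: distrib_right)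
  also have "\<dots> \<le> q\<^sup>2 * (real n * \<delta>\<^sup>2) + \<delta> * B\<^sup>2"
    using \<delta> sum_\<Delta>_diag_le \<Delta>_diag by (intro add_mono mult_left_mono) auto
  also have "\<dots> \<le> (1 + B\<^sup>2) * (\<delta> + real n * (q\<^sup>2 * \<delta>\<^sup>2))"
    using \<delta> by (simp add: algebra_simps)
  finally have "2 * C\<^sup>2 * ((q\<^sup>2 + \<delta>) * ?S) \<le> 2 * C\<^sup>2 * ((1 + B\<^sup>2) * (\<delta> + real n * (q\<^sup>2 * \<delta>\<^sup>2)))"
    by (intro mult_left_mono) auto
  then show "(L2_set \<alpha> {..<n})\<^sup>2 \<le> 2 * C\<^sup>2 * (1 + B\<^sup>2) * (\<delta> + real n * (q\<^sup>2 * \<delta>\<^sup>2))"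
    using main by (simp add: mult.assoc)
qed

abbreviation (input) slope_part :: "nat \<Rightarrow> nat \<Rightarrow> real" where
  "slope_part \<equiv> \<lambda>i j. (w i * w j - p\<^sup>2) * \<Delta> i j"

abbreviation (input) rest_part :: "nat \<Rightarrow> nat \<Rightarrow> real" where
  "rest_part \<equiv> \<lambda>i j. E i j - \<alpha> i * \<alpha> j - slope_part i j"

lemma w_le: "i < n \<Longrightarrow> \<bar>w i\<bar> \<le> \<bar>p\<bar> + C"
  using w[of i] mult_left_mono[OF \<delta>(2) C] by linarith

lemma slope_diff: "i < n \<Longrightarrow> j < n \<Longrightarrow> \<bar>w i * w j - p\<^sup>2\<bar> \<le> slope_const * \<delta>"
proof -
  assume i: "i < n" and j: "j < n"
  have "w i * w j - p\<^sup>2 = (w i - p) * w j + p * (w j - p)"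
    by (simp add: power2_eq_square algebra_simps)
  then have "\<bar>w i * w j - p\<^sup>2\<bar> \<le> \<bar>w i - p\<bar> * \<bar>w j\<bar> + \<bar>p\<bar> * \<bar>w j - p\<bar>"
    by (simp add: abs_mult[symmetric])
  also have "\<dots> \<le> (C * \<delta>) * (\<bar>p\<bar> + C) + \<bar>p\<bar> * (C * \<delta>)"
    using w[OF i] w[OF j] w_le[OF j] C \<delta> by (intro add_mono mult_mono) auto
  finally show ?thesis by (simp add: slope_const_def algebra_simps)
qed

text \<open>The telescoped difference of slopes gives two diagonal multiples of \<Delta>, each with
  one factor of size C \<delta>. Passing to absolute values of entries could lose a power of
  n.\<close>

lemma op_bounded_slope_part: "op_bounded n slope_part (slope_const * B * \<delta>)"
proof -
  have "op_bounded n (\<lambda>i j. (w i - p) * \<Delta> i j * w j + p * \<Delta> i j * (w j - p))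
      (C * \<delta> * (\<bar>p\<bar> + C) * B + \<bar>p\<bar> * (C * \<delta>) * B)"
    using w w_le C \<delta> by (intro op_bounded_add op_bounded_diag_mult[OF \<Delta>_op B]) auto
  moreover have "(\<lambda>i j. (w i - p) * \<Delta> i j * w j + p * \<Delta> i j * (w j - p)) = slope_part"
    by (simp add: fun_eq_iff power2_eq_square algebra_simps)
  moreover have "C * \<delta> * (\<bar>p\<bar> + C) * B + \<bar>p\<bar> * (C * \<delta>) * B = slope_const * B * \<delta>"
    by (simp add: slope_const_def algebra_simps)
  ultimately show ?thesis by simp
qed

text \<open>Off the diagonal this is a hypothesis. On the diagonal that hypothesis is silent, and
  the three pieces are bounded one by one by multiples of \<delta>.\<close>

lemma rest_le:
  assumes i: "i < n" and j: "j < n"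
  shows "\<bar>rest_part i j\<bar> \<le> C * (q\<^sup>2 + \<delta>) * (\<Delta> i j)\<^sup>2 + (if i = j then diag_const * \<delta> else 0)"
proof (cases "i = j")
  case True
  have "\<bar>slope_part i i\<bar> \<le> slope_const * \<delta> * 1"
    unfolding abs_mult using slope_diff[OF i i] \<Delta>_le[OF i i] \<delta> consts_nonneg by (intro mult_mono) auto
  moreover have "\<bar>\<alpha> i * \<alpha> i\<bar> \<le> 2 * C\<^sup>2 * (q\<^sup>2 + 1) * \<delta>"
    using \<alpha>_power2[OF i] by (simp add: power2_eq_square)
  ultimately have "\<bar>rest_part i i\<bar> \<le> C * \<delta> + 2 * C\<^sup>2 * (q\<^sup>2 + 1) * \<delta> + slope_const * \<delta>"
    using diag[OF i] by linarith
  also have "\<dots> = diag_const * \<delta>" by (simp add: diag_const_def algebra_simps)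
  finally have "\<bar>rest_part i i\<bar> \<le> diag_const * \<delta>" .
  moreover have "0 \<le> C * (q\<^sup>2 + \<delta>) * (\<Delta> i i)\<^sup>2" using C \<delta> by simp
  ultimately show ?thesis using True by simp
qed (use off[OF i j] in simp)

lemma row_rest:
  assumes i: "i < n"
  shows "(\<Sum>j<n. C * (q\<^sup>2 + \<delta>) * (\<Delta> i j)\<^sup>2 + (if i = j then diag_const * \<delta> else 0))
    = C * (q\<^sup>2 + \<delta>) * (\<Sum>j<n. (\<Delta> i j)\<^sup>2) + diag_const * \<delta>"
  using i by (simp add: sum.distrib sum_distrib_left)

text \<open>Schur test with the symmetric majorant of \<open>rest_le\<close>. For the small bound,
  row sums of squares are estimated by n \<delta>^2 next to q^2 and by B^2 next to \<delta>; the
  diagonal adds a single entry to each row.\<close>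

lemma op_bounded_rest_part:
  shows "op_bounded n rest_part (C * (q\<^sup>2 + 1) * B\<^sup>2 + diag_const)"
    and "op_bounded n rest_part ((C * (1 + B\<^sup>2) + diag_const) * (\<delta> + real n * (q\<^sup>2 * \<delta>\<^sup>2)))"
proof -
  let ?F = "\<lambda>i j. C * (q\<^sup>2 + \<delta>) * (\<Delta> i j)\<^sup>2 + (if i = j then diag_const * \<delta> else 0)"
  show "op_bounded n rest_part (C * (q\<^sup>2 + 1) * B\<^sup>2 + diag_const)"
  proof (rule op_bounded_schur[where F = ?F])
    fix i assume i: "i < n"
    show "(\<Sum>j<n. ?F i j) \<le> C * (q\<^sup>2 + 1) * B\<^sup>2 + diag_const"
      unfolding row_rest[OF i] using C \<delta> row_\<Delta>(1)[OF i] consts_nonneg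
      by (intro add_mono mult_mono) (auto simp: sum_nonneg mult_left_le)
  qed (use rest_le \<Delta>_sym C consts_nonneg in auto)
  show "op_bounded n rest_part ((C * (1 + B\<^sup>2) + diag_const) * (\<delta> + real n * (q\<^sup>2 * \<delta>\<^sup>2)))"
  proof (rule op_bounded_schur[where F = ?F])
    fix i assume i: "i < n"
    have "(\<Sum>j<n. ?F i j) = C * (q\<^sup>2 * (\<Sum>j<n. (\<Delta> i j)\<^sup>2) + \<delta> * (\<Sum>j<n. (\<Delta> i j)\<^sup>2)) + diag_const * \<delta>"
      unfolding row_rest[OF i] by (simp add: algebra_simps)
    also have "\<dots> \<le> C * (q\<^sup>2 * (real n * \<delta>\<^sup>2) + \<delta> * B\<^sup>2) + diag_const * \<delta>"
      using C \<delta> row_\<Delta>[OF i] consts_nonneg by (intro add_mono mult_left_mono) auto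
    also have "\<dots> \<le> C * ((1 + B\<^sup>2) * (\<delta> + real n * (q\<^sup>2 * \<delta>\<^sup>2))) + diag_const * (\<delta> + real n * (q\<^sup>2 * \<delta>\<^sup>2))"
      using C \<delta> consts_nonneg by (intro add_mono mult_left_mono) (auto simp: algebra_simps)
    finally show "(\<Sum>j<n. ?F i j) \<le> (C * (1 + B\<^sup>2) + diag_const) * (\<delta> + real n * (q\<^sup>2 * \<delta>\<^sup>2))"
      by (simp add: algebra_simps)
  qed (use rest_le \<Delta>_sym C \<delta> consts_nonneg in auto)
qed

text \<open>Where the weight is q^2, squared entries are replaced by \<delta>^2, which leaves a
  constant array. Where the weight is \<delta>, they are replaced by their moduli, an array of
  Frobenius norm at most sqrt n times B.\<close>

lemma frobenius_rest_part:
  "frobenius n rest_part \<le> (C * (1 + B) + diag_const) * (sqrt (real n) * \<delta> + real n * (q\<^sup>2 * \<delta>\<^sup>2))"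
proof -
  let ?D = "\<lambda>i j. \<bar>\<Delta> i j\<bar>"
  have D: "frobenius n ?D \<le> sqrt (real n) * B"
    using frobenius_le_op_bounded[OF \<Delta>_op B]
    by (simp add: frobenius_def split_def L2_set_def)
  have "frobenius n rest_part
      \<le> frobenius n (\<lambda>i j. (C * q\<^sup>2 * \<delta>\<^sup>2 + C * \<delta> * ?D i j) + (if i = j then diag_const * \<delta> else 0))"
  proof (rule frobenius_mono)
    fix i j assume ij: "i < n" "j < n"
    have "C * (q\<^sup>2 + \<delta>) * (\<Delta> i j)\<^sup>2 = C * q\<^sup>2 * (\<Delta> i j)\<^sup>2 + C * \<delta> * (?D i j * ?D i j)"
      by (simp add: algebra_simps power2_eq_square)
    also have "\<dots> \<le> C * q\<^sup>2 * \<delta>\<^sup>2 + C * \<delta> * (?D i j * 1)"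
      using C \<delta> \<Delta>_power2[OF ij] \<Delta>_le[OF ij] by (intro add_mono mult_left_mono) auto
    finally show "\<bar>rest_part i j\<bar> \<le> (C * q\<^sup>2 * \<delta>\<^sup>2 + C * \<delta> * ?D i j) + (if i = j then diag_const * \<delta> else 0)"
      using rest_le[OF ij] by simp
  qed
  also have "\<dots> \<le> (frobenius n (\<lambda>i j. C * q\<^sup>2 * \<delta>\<^sup>2) + frobenius n (\<lambda>i j. C * \<delta> * ?D i j))
      + frobenius n (\<lambda>i j. if i = j then diag_const * \<delta> else 0)"
    by (intro order_trans[OF frobenius_triangle] add_right_mono frobenius_triangle)
  also have "\<dots> \<le> (real n * (C * q\<^sup>2 * \<delta>\<^sup>2) + C * \<delta> * (sqrt (real n) * B)) + sqrt (real n) * (diag_const * \<delta>)"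
  proof (intro add_mono)
    show "frobenius n (\<lambda>i j. C * \<delta> * ?D i j) \<le> C * \<delta> * (sqrt (real n) * B)"
      using C \<delta> D by (subst frobenius_scale) (auto intro: mult_left_mono)
  qed (use C \<delta> consts_nonneg in \<open>simp_all add: frobenius_const frobenius_diag\<close>)
  also have "\<dots> \<le> (C * (1 + B) + diag_const) * (sqrt (real n) * \<delta> + real n * (q\<^sup>2 * \<delta>\<^sup>2))"
    using C B \<delta> consts_nonneg by (simp add: algebra_simps)
  finally show ?thesis .
qed

lemma error_split: "E i j = (\<alpha> i * \<alpha> j + slope_part i j) + rest_part i j"
  by simp

lemma error_entry_le:
  assumes i: "i < n" and j: "j < n"
  shows "\<bar>E i j\<bar> \<le> full_const * \<delta>"
proof -
  have "\<bar>\<alpha> i * \<alpha> j\<bar> \<le> 2 * C\<^sup>2 * (q\<^sup>2 + 1) * \<delta>"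
  proof (rule power2_le_imp_le)
    have "\<bar>\<alpha> i * \<alpha> j\<bar>\<^sup>2 = (\<alpha> i)\<^sup>2 * (\<alpha> j)\<^sup>2" by (simp add: power_mult_distrib)
    also have "\<dots> \<le> (2 * C\<^sup>2 * (q\<^sup>2 + 1) * \<delta>) * (2 * C\<^sup>2 * (q\<^sup>2 + 1) * \<delta>)"
      using \<alpha>_power2[OF i] \<alpha>_power2[OF j] \<delta> by (intro mult_mono) auto
    finally show "\<bar>\<alpha> i * \<alpha> j\<bar>\<^sup>2 \<le> (2 * C\<^sup>2 * (q\<^sup>2 + 1) * \<delta>)\<^sup>2" by (simp add: power2_eq_square)
  qed (use \<delta> in simp)
  moreover have "\<bar>slope_part i j\<bar> \<le> slope_const * \<delta> * 1"
    unfolding abs_mult using slope_diff[OF i j] \<Delta>_le[OF i j] \<delta> consts_nonneg by (intro mult_mono) auto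
  moreover have "\<bar>rest_part i j\<bar> \<le> C * (q\<^sup>2 + 1) * \<delta> + diag_const * \<delta>"
  proof -
    have "\<delta>\<^sup>2 \<le> \<delta>" using \<delta> by (simp add: power2_eq_square mult_left_le)
    then have "(\<Delta> i j)\<^sup>2 \<le> \<delta>" using \<Delta>_power2[OF i j] by linarith
    then have "C * (q\<^sup>2 + \<delta>) * (\<Delta> i j)\<^sup>2 \<le> C * (q\<^sup>2 + 1) * \<delta>"
      using C \<delta> by (intro mult_mono) auto
    moreover have "(if i = j then diag_const * \<delta> else 0) \<le> diag_const * \<delta>"
      using \<delta> consts_nonneg by simp
    ultimately show ?thesis using rest_le[OF i j] by linarith
  qed
  ultimately have "\<bar>E i j\<bar> \<le> (2 * C\<^sup>2 * (q\<^sup>2 + 1) + slope_const + C * (q\<^sup>2 + 1) + diag_const) * \<delta>"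
    unfolding distrib_right by linarith
  also have "\<dots> \<le> full_const * \<delta>"
    using \<delta>(1) full_const_bounds(1) by (intro mult_right_mono)
  finally show ?thesis .
qed

lemma op_bounded_rank_one: "op_bounded n (\<lambda>i j. \<alpha> i * \<alpha> j) ((L2_set \<alpha> {..<n})\<^sup>2)"
  using op_bounded_frobenius[of n "\<lambda>i j. \<alpha> i * \<alpha> j"]
  by (simp add: frobenius_rank_one power2_eq_square)

text \<open>The same splitting assembled twice: with B^2 throughout for boundedness, and with n
  \<delta>^2 next to q^2 for the rate.\<close>

lemma op_bounded_error:
  shows "op_bounded n E full_const"
    and "op_bounded n E (full_const * (\<delta> + real n * (q\<^sup>2 * \<delta>\<^sup>2)))"
proof -
  let ?r = "\<delta> + real n * (q\<^sup>2 * \<delta>\<^sup>2)"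
  have r: "0 \<le> ?r" "\<delta> \<le> ?r" using \<delta> by auto
  have "op_bounded n (\<lambda>i j. (\<alpha> i * \<alpha> j + slope_part i j) + rest_part i j)
      (((L2_set \<alpha> {..<n})\<^sup>2 + slope_const * B * \<delta>) + (C * (q\<^sup>2 + 1) * B\<^sup>2 + diag_const))"
    by (intro op_bounded_add op_bounded_rank_one op_bounded_slope_part op_bounded_rest_part)
  then show "op_bounded n E full_const"
    unfolding error_split[symmetric]
  proof (rule op_bounded_mono)
    have "slope_const * B * \<delta> \<le> slope_const * B * 1"
      using B \<delta> consts_nonneg by (intro mult_left_mono) auto
    then show "(L2_set \<alpha> {..<n})\<^sup>2 + slope_const * B * \<delta> + (C * (q\<^sup>2 + 1) * B\<^sup>2 + diag_const) \<le> full_const"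
      using rank_one_norm(1) full_const_bounds(2) by linarith
  qed
  have "op_bounded n (\<lambda>i j. (\<alpha> i * \<alpha> j + slope_part i j) + rest_part i j)
      (((L2_set \<alpha> {..<n})\<^sup>2 + slope_const * B * \<delta>) + (C * (1 + B\<^sup>2) + diag_const) * ?r)"
    by (intro op_bounded_add op_bounded_rank_one op_bounded_slope_part op_bounded_rest_part)
  then show "op_bounded n E (full_const * ?r)"
    unfolding error_split[symmetric]
  proof (rule op_bounded_mono)
    have "slope_const * B * \<delta> \<le> slope_const * B * ?r"
      using B r consts_nonneg by (intro mult_left_mono) auto
    then have "(L2_set \<alpha> {..<n})\<^sup>2 + slope_const * B * \<delta> + (C * (1 + B\<^sup>2) + diag_const) * ?r
        \<le> (2 * C\<^sup>2 * (1 + B\<^sup>2) + slope_const * B + (C * (1 + B\<^sup>2) + diag_const)) * ?r"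
      using rank_one_norm(2) unfolding distrib_right[of _ _ ?r] by linarith
    also have "\<dots> \<le> full_const * ?r"
      using r full_const_bounds(3) by (intro mult_right_mono) (auto simp: add.assoc)
    finally show "(L2_set \<alpha> {..<n})\<^sup>2 + slope_const * B * \<delta> + (C * (1 + B\<^sup>2) + diag_const) * ?r \<le> full_const * ?r" .
  qed
qed

text \<open>For a rank-one array Frobenius and operator norm agree, so that part pays no sqrt n; the
  slope part and the \<delta> terms of the rest do.\<close>

lemma frobenius_error:
  assumes n: "0 < n"
  shows "frobenius n E \<le> full_const * (sqrt (real n) * \<delta> + real n * (q\<^sup>2 * \<delta>\<^sup>2))"
proof -
  let ?r = "sqrt (real n) * \<delta> + real n * (q\<^sup>2 * \<delta>\<^sup>2)"
  have "1 * \<delta> \<le> sqrt (real n) * \<delta>" using n \<delta> by (intro mult_right_mono) auto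
  then have r: "0 \<le> ?r" "\<delta> + real n * (q\<^sup>2 * \<delta>\<^sup>2) \<le> ?r" "sqrt (real n) * \<delta> \<le> ?r" using \<delta> by auto
  have "frobenius n E = frobenius n (\<lambda>i j. (\<alpha> i * \<alpha> j + slope_part i j) + rest_part i j)"
    by simp
  also have "\<dots> \<le> (frobenius n (\<lambda>i j. \<alpha> i * \<alpha> j) + frobenius n slope_part) + frobenius n rest_part"
    by (intro order_trans[OF frobenius_triangle] add_right_mono frobenius_triangle)
  also have "\<dots> \<le> (2 * C\<^sup>2 * (1 + B\<^sup>2) * ?r + slope_const * B * ?r) + (C * (1 + B) + diag_const) * ?r"
  proof (intro add_mono frobenius_rest_part)
    have "(L2_set \<alpha> {..<n})\<^sup>2 \<le> 2 * C\<^sup>2 * (1 + B\<^sup>2) * ?r"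
      using r(2) by (intro order_trans[OF rank_one_norm(2)] mult_left_mono) auto
    then show "frobenius n (\<lambda>i j. \<alpha> i * \<alpha> j) \<le> 2 * C\<^sup>2 * (1 + B\<^sup>2) * ?r"
      by (simp add: frobenius_rank_one power2_eq_square)
    have "frobenius n slope_part \<le> sqrt (real n) * (slope_const * B * \<delta>)"
      using B \<delta> consts_nonneg by (intro frobenius_le_op_bounded op_bounded_slope_part) auto
    also have "\<dots> = slope_const * B * (sqrt (real n) * \<delta>)" by simp
    also have "\<dots> \<le> slope_const * B * ?r"
      using r(3) B consts_nonneg by (intro mult_left_mono) auto
    finally show "frobenius n slope_part \<le> slope_const * B * ?r" .
  qed
  also have "\<dots> = (2 * C\<^sup>2 * (1 + B\<^sup>2) + slope_const * B + (C * (1 + B) + diag_const)) * ?r"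
    by (simp add: distrib_right)
  also have "\<dots> \<le> full_const * ?r"
    using r full_const_bounds(4) by (intro mult_right_mono) (auto simp: add.assoc)
  finally show ?thesis .
qed

end

section \<open>The covariance of the nonlinear image\<close>

text \<open>One constant above every coefficient in the entry estimates, so that the array bounds
  can be used with a single C.\<close>

definition error_const :: "(real \<Rightarrow> real) \<Rightarrow> real \<Rightarrow> real" where
  "error_const f L = 4 + 262144 * L\<^sup>2 + 9600000 * (growth f L)\<^sup>2 + 6000 * growth f L + 256 * L
    + 2 * \<bar>gauss_moment He1 f\<bar> + 32 * L * growth f L + (gauss_moment He1 f)\<^sup>2"

section \<open>Estimates at a fixed dimension with small entries of \<Delta>\<close>

context
  fixes f :: "real \<Rightarrow> real" and L :: real
    and M :: "'a measure" and n :: nat and u :: "'a \<Rightarrow> real vec"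
    and S \<Sigma> \<Delta> \<Sigma>lin :: "real mat" and B :: real
  assumes lip: "L-lipschitz_on UNIV f" and zeta0: "hermite_coeff 0 f = 0"
    and n: "n \<ge> 1" and u: "gaussian_vector M n u" and centered: "mean_vec M n u = 0\<^sub>v n"
    and S: "S = covariance_mat M n u" and \<Sigma>: "\<Sigma> = second_moment_mat M n (\<lambda>\<omega>. map_vec f (u \<omega>))"
    and \<Delta>: "\<Delta> = S - 1\<^sub>m n"
    and \<Sigma>lin: "\<Sigma>lin = (gauss_norm f)\<^sup>2 \<cdot>\<^sub>m 1\<^sub>m n + (hermite_coeff 1 f)\<^sup>2 \<cdot>\<^sub>m \<Delta>"
    and B: "spectral_norm \<Delta> \<le> B" "euclid_norm (diag_vec \<Delta>) \<le> B"
    and small: "max_norm \<Delta> \<le> 1 / 32"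
begin

lemma centered_entry: "i < n \<Longrightarrow> (\<integral>\<omega>. u \<omega> $ i \<partial>M) = 0"
  using arg_cong[OF centered, of "\<lambda>v. v $ i"] by (simp add: mean_vec_def)

lemma S_entry: "i < n \<Longrightarrow> j < n \<Longrightarrow> S $$ (i, j) = (\<integral>\<omega>. u \<omega> $ i * u \<omega> $ j \<partial>M)"
  by (simp add: S covariance_mat_def second_moment_mat_def centered)

lemma
  shows \<Delta>_carrier: "\<Delta> \<in> carrier_mat n n" and \<Sigma>_carrier: "\<Sigma> \<in> carrier_mat n n"
    and \<Sigma>lin_carrier: "\<Sigma>lin \<in> carrier_mat n n"
  by (auto simp: \<Delta> \<Sigma> \<Sigma>lin S covariance_mat_def second_moment_mat_def intro!: carrier_matI)

lemma \<Delta>_entry: "i < n \<Longrightarrow> j < n \<Longrightarrow> \<Delta> $$ (i, j) = (\<integral>\<omega>. u \<omega> $ i * u \<omega> $ j \<partial>M) - (if i = j then 1 else 0)"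
  by (simp add: \<Delta> S_entry)

lemma \<Sigma>_entry: "i < n \<Longrightarrow> j < n \<Longrightarrow> \<Sigma> $$ (i, j) = (\<integral>\<omega>. f (u \<omega> $ i) * f (u \<omega> $ j) \<partial>M)"
  unfolding \<Sigma> second_moment_mat_def using u
  by (auto simp: gaussian_vector_def intro!: Bochner_Integration.integral_cong)

lemma \<Sigma>lin_entry: "i < n \<Longrightarrow> j < n \<Longrightarrow> \<Sigma>lin $$ (i, j)
    = (if i = j then (gauss_norm f)\<^sup>2 else 0) + (gauss_moment He1 f)\<^sup>2 * \<Delta> $$ (i, j)"
  using \<Delta>_carrier by (simp add: \<Sigma>lin hermite_coeff_gauss_moment[simplified])

lemma symmetric_entries:
  assumes "i < n" "j < n"
  shows "\<Delta> $$ (i, j) = \<Delta> $$ (j, i)" "\<Sigma> $$ (i, j) = \<Sigma> $$ (j, i)" "\<Sigma>lin $$ (i, j) = \<Sigma>lin $$ (j, i)"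
  using assms by (auto simp: \<Delta>_entry \<Sigma>_entry \<Sigma>lin_entry mult.commute)

abbreviation (input) "\<delta> \<equiv> max_norm \<Delta>"
abbreviation (input) "p \<equiv> gauss_moment He1 f"
abbreviation (input) "q \<equiv> gauss_moment He2 f"
abbreviation (input) "C \<equiv> error_const f L"
abbreviation (input) "err \<equiv> \<lambda>i j. \<Sigma> $$ (i, j) - \<Sigma>lin $$ (i, j)"
abbreviation (input) "\<alpha> \<equiv> \<lambda>i. scaled_mean f (\<Delta> $$ (i, i))"
abbreviation (input) "w \<equiv> \<lambda>i. scaled_slope f (\<Delta> $$ (i, i))"

lemma \<Delta>_le: "i < n \<Longrightarrow> j < n \<Longrightarrow> \<bar>\<Delta> $$ (i, j)\<bar> \<le> \<delta>"
  by (rule abs_le_max_norm[OF \<Delta>_carrier])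

lemma \<Delta>_small: "i < n \<Longrightarrow> j < n \<Longrightarrow> \<bar>\<Delta> $$ (i, j)\<bar> \<le> 1 / 32"
  using \<Delta>_le small by (rule order_trans)

lemma \<delta>_bounds: "0 \<le> \<delta>" "\<delta> \<le> 1"
  using \<Delta>_le[of 0 0] n small by linarith+

lemma error_const_ge:
  shows "0 \<le> C" "1 \<le> C" "6000 * growth f L \<le> C" "256 * L + 2 * \<bar>p\<bar> \<le> C"
    "4 + 262144 * L\<^sup>2 + 9600000 * (growth f L)\<^sup>2 \<le> C" "32 * L * growth f L + p\<^sup>2 \<le> C"
  using growth_nonneg[OF lip] lipschitz_on_nonneg[OF lip] unfolding error_const_def
  by (auto intro!: add_nonneg_nonneg add_increasing add_increasing2)

lemma variance_entry: "i < n \<Longrightarrow> (\<integral>\<omega>. (u \<omega> $ i)\<^sup>2 \<partial>M) = 1 + \<Delta> $$ (i, i)"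
  by (simp add: \<Delta>_entry power2_eq_square)

lemma op_bounded_\<Delta>: "op_bounded n (\<lambda>i j. \<Delta> $$ (i, j)) B"
  by (rule op_bounded_mono[OF op_bounded_spectral_norm[OF \<Delta>_carrier] B(1)])

lemma B_nonneg: "0 \<le> B"
  using spectral_norm_nonneg[OF \<Delta>_carrier] B(1) by linarith

lemma diag_\<Delta>: "(\<Sum>i<n. (\<Delta> $$ (i, i))\<^sup>2) \<le> B\<^sup>2"
proof -
  have "dim_row \<Delta> = n" using \<Delta>_carrier by simp
  then have "sqrt (\<Sum>i<n. (\<Delta> $$ (i, i))\<^sup>2) \<le> B"
    using B(2) by (simp add: euclid_norm_def diag_vec_def)
  then show ?thesis by (simp add: sqrt_le_D)
qed

lemma mean_le:
  assumes i: "i < n"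
  shows "\<bar>\<alpha> i\<bar> \<le> C * (\<bar>q\<bar> * \<bar>\<Delta> $$ (i, i)\<bar> + (\<Delta> $$ (i, i))\<^sup>2)"
proof -
  have "\<bar>\<alpha> i\<bar> \<le> 1 * (\<bar>q\<bar> * \<bar>\<Delta> $$ (i, i)\<bar>) + 6000 * growth f L * (\<Delta> $$ (i, i))\<^sup>2"
    using scaled_mean_bound[OF lip \<Delta>_small[OF i i]] zeta0 by (simp add: hermite_coeff_gauss_moment)
  also have "\<dots> \<le> C * (\<bar>q\<bar> * \<bar>\<Delta> $$ (i, i)\<bar>) + C * (\<Delta> $$ (i, i))\<^sup>2"
    using error_const_ge by (intro add_mono mult_right_mono) auto
  finally show ?thesis by (simp add: distrib_left)
qed

lemma slope_le:
  assumes i: "i < n"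
  shows "\<bar>w i - p\<bar> \<le> C * \<delta>"
proof -
  have "\<bar>w i - p\<bar> \<le> (256 * L + 2 * \<bar>p\<bar>) * \<bar>\<Delta> $$ (i, i)\<bar>"
    by (rule scaled_slope_bound[OF lip \<Delta>_small[OF i i]])
  also have "\<dots> \<le> C * \<delta>"
    using error_const_ge \<Delta>_le[OF i i] by (intro mult_mono) auto
  finally show ?thesis .
qed

lemma off_le:
  assumes i: "i < n" and j: "j < n" and ij: "i \<noteq> j"
  shows "\<bar>err i j - \<alpha> i * \<alpha> j - (w i * w j - p\<^sup>2) * \<Delta> $$ (i, j)\<bar> \<le> C * (q\<^sup>2 + \<delta>) * (\<Delta> $$ (i, j))\<^sup>2"
proof -
  let ?c = "4 + 262144 * L\<^sup>2 + 9600000 * (growth f L)\<^sup>2"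
  have cov: "(\<integral>\<omega>. u \<omega> $ i * u \<omega> $ j \<partial>M) = \<Delta> $$ (i, j)" using i j ij by (simp add: \<Delta>_entry)
  have "err i j - \<alpha> i * \<alpha> j - (w i * w j - p\<^sup>2) * \<Delta> $$ (i, j)
      = (\<integral>\<omega>. f (u \<omega> $ i) * f (u \<omega> $ j) \<partial>M) - (\<alpha> i * \<alpha> j + w i * w j * \<Delta> $$ (i, j))"
    using i j ij by (simp add: \<Sigma>_entry \<Sigma>lin_entry algebra_simps)
  also have "\<bar>\<dots>\<bar> \<le> ?c * (q\<^sup>2 + \<delta>) * (\<Delta> $$ (i, j))\<^sup>2"
    by (intro second_moment_offdiag[OF lip u i j] centered_entry variance_entry cov \<Delta>_le i j small)
  also have "\<dots> \<le> C * (q\<^sup>2 + \<delta>) * (\<Delta> $$ (i, j))\<^sup>2"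
    using error_const_ge \<delta>_bounds by (intro mult_right_mono) auto
  finally show ?thesis .
qed

lemma diag_le:
  assumes i: "i < n"
  shows "\<bar>err i i\<bar> \<le> C * \<delta>"
proof -
  let ?d = "\<Delta> $$ (i, i)"
  have "\<bar>(\<integral>\<omega>. f (u \<omega> $ i) * f (u \<omega> $ i) \<partial>M) - (gauss_norm f)\<^sup>2\<bar> \<le> 32 * L * growth f L * \<bar>?d\<bar>"
    by (intro second_moment_diag[OF lip \<Delta>_small u] i centered_entry variance_entry)
  moreover have "err i i = ((\<integral>\<omega>. f (u \<omega> $ i) * f (u \<omega> $ i) \<partial>M) - (gauss_norm f)\<^sup>2) - p\<^sup>2 * ?d"
    using i by (simp add: \<Sigma>_entry \<Sigma>lin_entry)
  moreover have "\<bar>p\<^sup>2 * ?d\<bar> = p\<^sup>2 * \<bar>?d\<bar>" by (simp add: abs_mult)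
  ultimately have "\<bar>err i i\<bar> \<le> (32 * L * growth f L + p\<^sup>2) * \<bar>?d\<bar>" unfolding distrib_right by linarith
  also have "\<dots> \<le> C * \<delta>"
    using error_const_ge \<Delta>_le[OF i i] by (intro mult_mono) auto
  finally show ?thesis .
qed

text \<open>In the order of the hypotheses of the array bounds, so that \<open>OF error_hyps\<close>
  discharges all of them at once.\<close>

lemmas error_hyps = error_const_ge(1) B_nonneg \<delta>_bounds symmetric_entries(1) \<Delta>_le op_bounded_\<Delta>
  diag_\<Delta> mean_le slope_le off_le diag_le

lemma diff_carrier: "\<Sigma> - \<Sigma>lin \<in> carrier_mat n n"
  using \<Sigma>lin_carrier by (intro carrier_matI) auto

lemma diff_entry: "i < n \<Longrightarrow> j < n \<Longrightarrow> (\<Sigma> - \<Sigma>lin) $$ (i, j) = err i j"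
  using \<Sigma>_carrier \<Sigma>lin_carrier by simp

abbreviation (input) "K \<equiv> full_const C B p q"

lemma K_nonneg: "0 \<le> K"
  by (rule consts_nonneg(3)[OF error_hyps])

lemma max_norm_error: "max_norm (\<Sigma> - \<Sigma>lin) \<le> K * \<delta>"
  using n error_entry_le[OF error_hyps] by (intro max_norm_le[OF diff_carrier]) (auto simp: diff_entry)

lemma op_bounded_diff: "op_bounded n (\<lambda>i j. (\<Sigma> - \<Sigma>lin) $$ (i, j)) c = op_bounded n err c"
  by (rule op_bounded_cong) (rule diff_entry)

lemma spectral_norm_error:
  shows "spectral_norm (\<Sigma> - \<Sigma>lin) \<le> K"
    and "spectral_norm (\<Sigma> - \<Sigma>lin) \<le> K * (\<delta> + real n * (q\<^sup>2 * \<delta>\<^sup>2))"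
proof -
  show "spectral_norm (\<Sigma> - \<Sigma>lin) \<le> K"
    by (rule spectral_norm_le[OF diff_carrier, unfolded op_bounded_diff, OF op_bounded_error(1)[OF error_hyps] K_nonneg])
  have "0 \<le> K * (\<delta> + real n * (q\<^sup>2 * \<delta>\<^sup>2))"
    using K_nonneg \<delta>_bounds by (intro mult_nonneg_nonneg add_nonneg_nonneg) auto
  moreover have "op_bounded n err (K * (\<delta> + real n * (q\<^sup>2 * \<delta>\<^sup>2)))"
    by (rule op_bounded_error(2)[OF error_hyps])
  ultimately show "spectral_norm (\<Sigma> - \<Sigma>lin) \<le> K * (\<delta> + real n * (q\<^sup>2 * \<delta>\<^sup>2))"
    by (intro spectral_norm_le[OF diff_carrier]) (simp_all only: op_bounded_diff)
qed

text \<open>Dividing the Frobenius bound by sqrt n turns sqrt n \<delta> into \<delta> and the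
  factor n into sqrt n.\<close>

lemma stieltjes_error:
  assumes z: "Im z > 0"
  shows "cmod (stieltjes \<Sigma> z - stieltjes \<Sigma>lin z) \<le> K * (\<delta> + sqrt (real n) * (q\<^sup>2 * \<delta>\<^sup>2)) / (Im z)\<^sup>2"
proof -
  have n0: "0 < n" using n by simp
  have "cmod (stieltjes \<Sigma> z - stieltjes \<Sigma>lin z) \<le> frobenius n err / sqrt (real n) / (Im z)\<^sup>2"
    by (rule stieltjes_diff_le[OF \<Sigma>_carrier symmetric_entries(2) \<Sigma>lin_carrier symmetric_entries(3) n0 z])
  also have "\<dots> \<le> K * (sqrt (real n) * \<delta> + real n * (q\<^sup>2 * \<delta>\<^sup>2)) / sqrt (real n) / (Im z)\<^sup>2"
    using frobenius_error[OF error_hyps n0] by (intro divide_right_mono) auto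
  also have "K * (sqrt (real n) * \<delta> + real n * (q\<^sup>2 * \<delta>\<^sup>2)) / sqrt (real n)
      = K * (\<delta> + sqrt (real n) * (q\<^sup>2 * \<delta>\<^sup>2))"
  proof -
    have "real n * (q\<^sup>2 * \<delta>\<^sup>2) = sqrt (real n) * (sqrt (real n) * (q\<^sup>2 * \<delta>\<^sup>2))"
      by (simp flip: mult.assoc)
    then have eq: "K * (sqrt (real n) * \<delta> + real n * (q\<^sup>2 * \<delta>\<^sup>2))
        = K * (\<delta> + sqrt (real n) * (q\<^sup>2 * \<delta>\<^sup>2)) * sqrt (real n)"
      by (simp only: distrib_left distrib_right mult_ac)
    show ?thesis unfolding eq using n0 by simp
  qed
  finally show ?thesis .
qed

end

theorem proposition3p10:
  fixes f :: "real \<Rightarrow> real"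
    and M :: "nat \<Rightarrow> 'a measure"
    and u :: "nat \<Rightarrow> 'a \<Rightarrow> real vec"
    and S \<Sigma> \<Delta> \<Sigma>lin :: "nat \<Rightarrow> real mat"
    and \<epsilon> :: "nat \<Rightarrow> real"
  assumes lipschitz: "\<exists>L. L-lipschitz_on UNIV f"
    and zeta0: "hermite_coeff 0 f = 0"
    and gaussian: "\<And>n. n \<ge> 1 \<Longrightarrow> gaussian_vector (M n) n (u n)"
    and centered: "\<And>n. n \<ge> 1 \<Longrightarrow> mean_vec (M n) n (u n) = 0\<^sub>v n"
    and covariance: "\<And>n. n \<ge> 1 \<Longrightarrow> S n = covariance_mat (M n) n (u n)"
    and Sigma: "\<And>n. n \<ge> 1 \<Longrightarrow>
          \<Sigma> n = second_moment_mat (M n) n (\<lambda>\<omega>. map_vec f (u n \<omega>))"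
    and Delta: "\<And>n. n \<ge> 1 \<Longrightarrow> \<Delta> n = S n - 1\<^sub>m n"
    and Sigma_lin: "\<And>n. n \<ge> 1 \<Longrightarrow>
          \<Sigma>lin n = (gauss_norm f)\<^sup>2 \<cdot>\<^sub>m 1\<^sub>m n + (hermite_coeff 1 f)\<^sup>2 \<cdot>\<^sub>m \<Delta> n"
    and epsilon: "\<And>n. n \<ge> 1 \<Longrightarrow>
          \<epsilon> n = (hermite_coeff 2 f)\<^sup>2 * max_norm (\<Delta> n) ^ 2
              + (hermite_coeff 3 f)\<^sup>2 * max_norm (\<Delta> n) ^ 3"
    and Delta_spectral: "Bseq (\<lambda>n. spectral_norm (\<Delta> n))"
    and Delta_diag: "Bseq (\<lambda>n. euclid_norm (diag_vec (\<Delta> n)))"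
    and Delta_max: "(\<lambda>n. max_norm (\<Delta> n)) \<longlonglongrightarrow> 0"
  shows "Bseq (\<lambda>n. spectral_norm (\<Sigma> n - \<Sigma>lin n)) \<and>
    (\<lambda>n. max_norm (\<Sigma> n - \<Sigma>lin n)) \<in> O(\<lambda>n. max_norm (\<Delta> n)) \<and>
    (\<lambda>n. spectral_norm (\<Sigma> n - \<Sigma>lin n)) \<in> O(\<lambda>n. max_norm (\<Delta> n) + real n * \<epsilon> n) \<and>
    (\<exists>C. \<forall>\<^sub>F n in sequentially. \<forall>z. Im z > 0 \<longrightarrow>
       cmod (stieltjes (\<Sigma> n) z - stieltjes (\<Sigma>lin n) z)
         \<le> C * (max_norm (\<Delta> n) + sqrt (real n) * \<epsilon> n) / (Im z)\<^sup>2)"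
proof -
  obtain L where lip: "L-lipschitz_on UNIV f" using lipschitz by blast
  obtain B1 where B1: "\<And>n. \<bar>spectral_norm (\<Delta> n)\<bar> \<le> B1"
    using Delta_spectral by (auto simp: Bseq_def)
  obtain B2 where B2: "\<And>n. \<bar>euclid_norm (diag_vec (\<Delta> n))\<bar> \<le> B2"
    using Delta_diag by (auto simp: Bseq_def)
  define B where "B = max B1 B2"
  have B: "spectral_norm (\<Delta> n) \<le> B" "euclid_norm (diag_vec (\<Delta> n)) \<le> B" for n
    using abs_le_D1[OF B1[of n]] abs_le_D1[OF B2[of n]] by (auto simp: B_def)
  define \<delta> where "\<delta> n = max_norm (\<Delta> n)" for n
  \<comment> \<open>Twice the square of \<zeta>_2(f) is q^2.\<close>
  define q where "q = gauss_moment (\<lambda>x. x\<^sup>2 - 1) f"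
  \<comment> \<open>Built from f, L and B only, which makes the final constants uniform in n and
    z.\<close>
  define K where "K = full_const (error_const f L) B (gauss_moment (\<lambda>x. x) f) q"
  \<comment> \<open>Both conditions hold for all large n, which is all that the four asymptotic
    claims require; \<open>n \<ge> 1\<close> also gives the maximum norm its meaning.\<close>
  define good where "good n \<longleftrightarrow> n \<ge> 1 \<and> \<delta> n \<le> 1 / 32" for n
  have "\<forall>\<^sub>F n in sequentially. \<delta> n < 1 / 32"
    using order_tendstoD(2)[OF Delta_max, of "1 / 32"] by (simp add: \<delta>_def)
  then have good: "\<forall>\<^sub>F n in sequentially. good n"
    using eventually_ge_at_top[of 1] by eventually_elim (simp add: good_def)
  {
    fix n assume "good n"
    then have n: "n \<ge> 1" and small: "max_norm (\<Delta> n) \<le> 1 / 32" by (auto simp: good_def \<delta>_def)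
    note hyps = lip zeta0 n gaussian[OF n] centered[OF n] covariance[OF n] Sigma[OF n] Delta[OF n]
      Sigma_lin[OF n] B small
    have K: "0 \<le> K" unfolding K_def q_def by (rule K_nonneg[OF hyps])
    have \<delta>: "0 \<le> \<delta> n" unfolding \<delta>_def by (rule \<delta>_bounds(1)[OF hyps])
    \<comment> \<open>The \<zeta>_2 term of \<epsilon> is half of q^2 \<delta>^2, and its \<zeta>_3
      term is nonnegative because \<delta> is.\<close>
    have \<epsilon>: "q\<^sup>2 * (\<delta> n)\<^sup>2 \<le> 2 * \<epsilon> n" "0 \<le> \<epsilon> n"
      using \<delta> unfolding epsilon[OF n] hermite_coeff_gauss_moment(3) \<delta>_def q_def by simp_all
    \<comment> \<open>To be used with c = n for the spectral norm and c = sqrt n for the Stieltjes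
      transforms.\<close>
    have le2: "K * (\<delta> n + c * (q\<^sup>2 * (\<delta> n)\<^sup>2)) \<le> 2 * K * (\<delta> n + c * \<epsilon> n)" if "0 \<le> c" for c
    proof -
      have "c * (q\<^sup>2 * (\<delta> n)\<^sup>2) \<le> c * (2 * \<epsilon> n)" using \<epsilon> that by (intro mult_left_mono)
      then have "\<delta> n + c * (q\<^sup>2 * (\<delta> n)\<^sup>2) \<le> 2 * (\<delta> n + c * \<epsilon> n)" using \<delta> by (simp add: algebra_simps)
      then have "K * (\<delta> n + c * (q\<^sup>2 * (\<delta> n)\<^sup>2)) \<le> K * (2 * (\<delta> n + c * \<epsilon> n))" using K by (rule mult_left_mono)
      then show ?thesis by (simp only: mult_ac)
    qed
    have carrier: "\<Sigma> n - \<Sigma>lin n \<in> carrier_mat n n" by (rule diff_carrier[OF hyps])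
    have nonneg: "0 \<le> spectral_norm (\<Sigma> n - \<Sigma>lin n)" by (rule spectral_norm_nonneg[OF carrier])
    have "0 \<le> max_norm (\<Sigma> n - \<Sigma>lin n)"
      using abs_le_max_norm[OF carrier, of 0 0] n by simp
    moreover have "max_norm (\<Sigma> n - \<Sigma>lin n) \<le> K * \<delta> n"
      unfolding K_def q_def \<delta>_def by (rule max_norm_error[OF hyps])
    ultimately have "norm (max_norm (\<Sigma> n - \<Sigma>lin n)) \<le> K * norm (max_norm (\<Delta> n))"
      using \<delta> by (simp add: \<delta>_def)
    moreover have "norm (spectral_norm (\<Sigma> n - \<Sigma>lin n)) \<le> K"
      using nonneg spectral_norm_error(1)[OF hyps] by (simp add: K_def q_def)
    moreover have "norm (spectral_norm (\<Sigma> n - \<Sigma>lin n)) \<le> 2 * K * norm (max_norm (\<Delta> n) + real n * \<epsilon> n)"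
      using nonneg spectral_norm_error(2)[OF hyps] le2[of "real n"] \<delta> \<epsilon> by (simp add: K_def q_def \<delta>_def)
    moreover have "cmod (stieltjes (\<Sigma> n) z - stieltjes (\<Sigma>lin n) z)
        \<le> 2 * K * (max_norm (\<Delta> n) + sqrt (real n) * \<epsilon> n) / (Im z)\<^sup>2" if z: "Im z > 0" for z
    proof (rule order_trans)
      show "cmod (stieltjes (\<Sigma> n) z - stieltjes (\<Sigma>lin n) z)
          \<le> K * (\<delta> n + sqrt (real n) * (q\<^sup>2 * (\<delta> n)\<^sup>2)) / (Im z)\<^sup>2"
        unfolding K_def q_def \<delta>_def by (rule stieltjes_error[OF hyps z])
      show "K * (\<delta> n + sqrt (real n) * (q\<^sup>2 * (\<delta> n)\<^sup>2)) / (Im z)\<^sup>2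
          \<le> 2 * K * (max_norm (\<Delta> n) + sqrt (real n) * \<epsilon> n) / (Im z)\<^sup>2"
        using le2[of "sqrt (real n)"] unfolding \<delta>_def by (intro divide_right_mono) auto
    qed
    ultimately have "norm (spectral_norm (\<Sigma> n - \<Sigma>lin n)) \<le> K"
      "norm (max_norm (\<Sigma> n - \<Sigma>lin n)) \<le> K * norm (max_norm (\<Delta> n))"
      "norm (spectral_norm (\<Sigma> n - \<Sigma>lin n)) \<le> 2 * K * norm (max_norm (\<Delta> n) + real n * \<epsilon> n)"
      "\<forall>z. Im z > 0 \<longrightarrow> cmod (stieltjes (\<Sigma> n) z - stieltjes (\<Sigma>lin n) z)
        \<le> 2 * K * (max_norm (\<Delta> n) + sqrt (real n) * \<epsilon> n) / (Im z)\<^sup>2"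
      by blast+
  }
  note est = this
  have "Bseq (\<lambda>n. spectral_norm (\<Sigma> n - \<Sigma>lin n))"
    by (rule BfunI[of _ K]) (rule eventually_mono[OF good est(1)])
  moreover have "(\<lambda>n. max_norm (\<Sigma> n - \<Sigma>lin n)) \<in> O(\<lambda>n. max_norm (\<Delta> n))"
    by (rule bigoI[of _ K]) (rule eventually_mono[OF good est(2)])
  moreover have "(\<lambda>n. spectral_norm (\<Sigma> n - \<Sigma>lin n)) \<in> O(\<lambda>n. max_norm (\<Delta> n) + real n * \<epsilon> n)"
    by (rule bigoI[of _ "2 * K"]) (rule eventually_mono[OF good est(3)])
  moreover have "\<forall>\<^sub>F n in sequentially. \<forall>z. Im z > 0 \<longrightarrow>
       cmod (stieltjes (\<Sigma> n) z - stieltjes (\<Sigma>lin n) z)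
         \<le> 2 * K * (max_norm (\<Delta> n) + sqrt (real n) * \<epsilon> n) / (Im z)\<^sup>2"
    by (rule eventually_mono[OF good est(4)])
  ultimately show ?thesis by blast
qed

end
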